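(* Let $T:\mathbb{S}^1\to\mathbb{S}^1$ be a $\mathcal{C}^\infty$ expanding map of the circle. Then there exists a Hilbert space $\mathcal{H}$, continuously contained in $\mathcal{C}^\infty(\mathbb{S}^1)$ and containing the trigonometric polynomials as a dense subspace, such that the transfer operator $$\mathcal{L}:\varphi\mapsto\Big(x\mapsto\sum_{y:\,Ty=x}\frac{1}{|T'(y)|}\varphi(y)\Big)$$ defines a compact operator from $\mathcal{H}$ to itself.
   Context: $\mathbb{S}^1=\mathbb{R}/\mathbb{Z}$, and the derivative $T':\mathbb{S}^1\to\mathbb{R}$ is taken with respect to the usual parallelization of the circle. A differentiable map $T:\mathbb{S}^1\to\mathbb{S}^1$ is expanding if there is $\lambda>1$ such that $|T'(x)|\ge\lambda$ for all $x\in\mathbb{S}^1$. Functions on $\mathbb{S}^1$ are complex valued. "$\mathcal{H}$ is continuously contained in $\mathcal{C}^\infty(\mathbb{S}^1)$" means that $\mathcal{H}$ is a linear subspace of $\mathcal{C}^\infty(\mathbb{S}^1)$ and the inclusion is continuous for the Hilbert norm on $\mathcal{H}$ and the usual Fréchet topology on $\mathcal{C}^\infty(\mathbb{S}^1)$. Trigonometric polynomials are the finite linear combinations of the functions $x\mapsto e^{2i\pi nx}$, $n\in\mathbb{Z}$. *)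

theory Defs
  imports "HOL-Analysis.Analysis"
begin

section \<open>Smooth functions of a real variable\<close>

definition vderiv :: "nat \<Rightarrow> (real \<Rightarrow> 'b::real_normed_vector) \<Rightarrow> real \<Rightarrow> 'b" where
  "vderiv k f = ((\<lambda>g t. vector_derivative g (at t)) ^^ k) f"

text \<open>Meant for open \<open>U\<close>: the derivatives are two-sided.\<close>

definition smooth_on :: "real set \<Rightarrow> (real \<Rightarrow> 'b::real_normed_vector) \<Rightarrow> bool" where
  "smooth_on U f \<longleftrightarrow> (\<forall>k. \<forall>t\<in>U. vderiv k f differentiable (at t))"

section \<open>The circle as a quotient of the real line\<close>

quotient_type circle = real / "\<lambda>x y :: real. x - y \<in> \<int>"
  morphisms rep_circle to_circle
proof (rule equivpI)
  show "reflp (\<lambda>x y :: real. x - y \<in> \<int>)"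
    by (simp add: reflp_def)
  show "symp (\<lambda>x y :: real. x - y \<in> \<int>)"
    by (rule sympI) (use Ints_minus in fastforce)
  show "transp (\<lambda>x y :: real. x - y \<in> \<int>)"
    by (rule transpI) (use Ints_add in fastforce)
qed

text \<open>The charts of the circle are the local inverses of the projection \<open>to_circle\<close>. Hence a
  function on the circle is smooth iff its composition with \<open>to_circle\<close> is, and a self-map of the
  circle is smooth iff around each point its composition with \<open>to_circle\<close> has a smooth real-valued
  lift.\<close>

definition smooth_circle_fun :: "(circle \<Rightarrow> complex) \<Rightarrow> bool" where
  "smooth_circle_fun \<phi> \<longleftrightarrow> smooth_on UNIV (\<phi> \<circ> to_circle)"

definition smooth_circle_map :: "(circle \<Rightarrow> circle) \<Rightarrow> bool" where
  "smooth_circle_map T \<longleftrightarrow>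
     (\<forall>t. \<exists>U f. open U \<and> t \<in> U \<and> smooth_on U f \<and>
        (\<forall>s\<in>U. T (to_circle s) = to_circle (f s)))"

definition has_circle_derivative :: "(circle \<Rightarrow> circle) \<Rightarrow> real \<Rightarrow> circle \<Rightarrow> bool" where
  "has_circle_derivative T D x \<longleftrightarrow>
     (\<exists>t f. x = to_circle t \<and> (\<forall>\<^sub>F s in nhds t. T (to_circle s) = to_circle (f s)) \<and>
        (f has_real_derivative D) (at t))"

definition circle_deriv :: "(circle \<Rightarrow> circle) \<Rightarrow> circle \<Rightarrow> real" where
  "circle_deriv T x = (THE D. has_circle_derivative T D x)"

definition expanding :: "(circle \<Rightarrow> circle) \<Rightarrow> bool" where
  "expanding T \<longleftrightarrow>
     (\<forall>x. \<exists>D. has_circle_derivative T D x) \<and>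
     (\<exists>c>1. \<forall>x. \<bar>circle_deriv T x\<bar> \<ge> c)"

text \<open>The fibres of an expanding map are finite, so the sum below is a genuine finite sum.\<close>

definition transfer_operator :: "(circle \<Rightarrow> circle) \<Rightarrow> (circle \<Rightarrow> complex) \<Rightarrow> circle \<Rightarrow> complex" where
  "transfer_operator T \<phi> = (\<lambda>x. \<Sum>y | T y = x. complex_of_real (1 / \<bar>circle_deriv T y\<bar>) * \<phi> y)"

section \<open>Trigonometric polynomials and the Frechet topology\<close>

lift_definition circle_exp :: "int \<Rightarrow> circle \<Rightarrow> complex"
  is "\<lambda>n t. exp (2 * of_real pi * \<i> * of_int n * of_real t)"
proof -
  fix n :: int and s t :: real
  assume "s - t \<in> \<int>"
  then obtain m :: int where "s = t + of_int m"
    by (metis Ints_cases add.commute diff_add_cancel)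
  then have "2 * of_real pi * \<i> * of_int n * of_real s =
      2 * of_real pi * \<i> * of_int n * of_real t + of_real (2 * pi * of_int (n * m)) * \<i>"
    by (simp add: algebra_simps)
  moreover have "exp (of_real (2 * pi * of_int (n * m)) * \<i>) = 1"
    unfolding exp_eq_1 by (rule conjI, simp, rule exI[of _ "n * m"], simp)
  ultimately show "exp (2 * of_real pi * \<i> * of_int n * of_real s) =
      exp (2 * of_real pi * \<i> * of_int n * of_real t)"
    by (simp only: exp_add mult_1_right)
qed

definition trig_polys :: "(circle \<Rightarrow> complex) set" where
  "trig_polys = {(\<lambda>x. \<Sum>n\<in>N. c n * circle_exp n x) | N c. finite N}"

definition smooth_seminorm :: "nat \<Rightarrow> (circle \<Rightarrow> complex) \<Rightarrow> real" where
  "smooth_seminorm k \<phi> = (SUP t. norm (vderiv k (\<phi> \<circ> to_circle) t))"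

definition smooth_topology :: "(circle \<Rightarrow> complex) topology" where
  "smooth_topology = topology_generated_by
     {{\<psi>. smooth_circle_fun \<psi> \<and> smooth_seminorm k (\<lambda>x. \<psi> x - \<phi> x) < r} | k \<phi> r.
        smooth_circle_fun \<phi> \<and> r > 0}"

section \<open>Hilbert spaces of complex functions\<close>

definition function_subspace :: "('a \<Rightarrow> complex) set \<Rightarrow> bool" where
  "function_subspace H \<longleftrightarrow> (\<lambda>x. 0) \<in> H \<and>
     (\<forall>f\<in>H. \<forall>g\<in>H. (\<lambda>x. f x + g x) \<in> H) \<and> (\<forall>c. \<forall>f\<in>H. (\<lambda>x. c * f x) \<in> H)"

definition complex_inner_product ::
  "('a \<Rightarrow> complex) set \<Rightarrow> (('a \<Rightarrow> complex) \<Rightarrow> ('a \<Rightarrow> complex) \<Rightarrow> complex) \<Rightarrow> bool" where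
  "complex_inner_product H ip \<longleftrightarrow>
     (\<forall>f\<in>H. \<forall>g\<in>H. \<forall>h\<in>H. ip (\<lambda>x. f x + g x) h = ip f h + ip g h) \<and>
     (\<forall>c. \<forall>f\<in>H. \<forall>g\<in>H. ip (\<lambda>x. c * f x) g = c * ip f g) \<and>
     (\<forall>f\<in>H. \<forall>g\<in>H. ip g f = cnj (ip f g)) \<and>
     (\<forall>f\<in>H. f \<noteq> (\<lambda>x. 0) \<longrightarrow> Re (ip f f) > 0)"

text \<open>The distance is extended by zero outside \<open>H\<close> because the library's metric spaces require
  symmetry and nonnegativity on the whole type.\<close>

definition ip_dist ::
  "('a \<Rightarrow> complex) set \<Rightarrow> (('a \<Rightarrow> complex) \<Rightarrow> ('a \<Rightarrow> complex) \<Rightarrow> complex)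
     \<Rightarrow> ('a \<Rightarrow> complex) \<Rightarrow> ('a \<Rightarrow> complex) \<Rightarrow> real" where
  "ip_dist H ip f g =
     (if f \<in> H \<and> g \<in> H then sqrt (Re (ip (\<lambda>x. f x - g x) (\<lambda>x. f x - g x))) else 0)"

definition hilbert_function_space ::
  "('a \<Rightarrow> complex) set \<Rightarrow> (('a \<Rightarrow> complex) \<Rightarrow> ('a \<Rightarrow> complex) \<Rightarrow> complex) \<Rightarrow> bool" where
  "hilbert_function_space H ip \<longleftrightarrow>
     function_subspace H \<and> complex_inner_product H ip \<and> Metric_space.mcomplete H (ip_dist H ip)"

definition hilbert_topology ::
  "('a \<Rightarrow> complex) set \<Rightarrow> (('a \<Rightarrow> complex) \<Rightarrow> ('a \<Rightarrow> complex) \<Rightarrow> complex)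
     \<Rightarrow> ('a \<Rightarrow> complex) topology" where
  "hilbert_topology H ip = Metric_space.mtopology H (ip_dist H ip)"

definition compact_operator_on ::
  "('a \<Rightarrow> complex) set \<Rightarrow> (('a \<Rightarrow> complex) \<Rightarrow> ('a \<Rightarrow> complex) \<Rightarrow> complex)
     \<Rightarrow> (('a \<Rightarrow> complex) \<Rightarrow> 'a \<Rightarrow> complex) \<Rightarrow> bool" where
  "compact_operator_on H ip A \<longleftrightarrow>
     A ` H \<subseteq> H \<and>
     (\<forall>f\<in>H. \<forall>g\<in>H. A (\<lambda>x. f x + g x) = (\<lambda>x. A f x + A g x)) \<and>
     (\<forall>c. \<forall>f\<in>H. A (\<lambda>x. c * f x) = (\<lambda>x. c * A f x)) \<and>
     (\<forall>B. Metric_space.mbounded H (ip_dist H ip) B \<longrightarrow>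
        compactin (hilbert_topology H ip) (hilbert_topology H ip closure_of (A ` B)))"

end

theory Submission
  imports Defs "HOL-Library.Diagonal_Subsequence" "HOL-Complex_Analysis.Great_Picard"
begin

text \<open>The space \<open>H\<close> carries the squared norm
\<open>\<Sum>k. A k * (\<integral> \<bar>D k \<phi>\<bar>\<^sup>2)\<close>, a mixture of all the integer Sobolev norms with weights \<open>A k\<close> that
decrease very fast; here \<open>D k\<close> is the \<open>k\<close>-th derivative. The weights are adapted to the map \<open>T\<close>.

The dynamical input is an estimate of Lasota-Yorke type, \<open>lifted_transfer_vderiv_bound\<close>. Lift \<open>T\<close>
to a diffeomorphism \<open>F\<close> of the line with \<open>\<bar>F'\<bar> \<ge> c > 1\<close>. The transfer operator becomes a finite sum of
terms \<open>\<bar>G'\<bar> (\<phi> \<circ> G)\<close> where \<open>G\<close> is the inverse of \<open>F\<close>, shifted by integers. Every derivative that falls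
on \<open>\<phi>\<close> produces a factor \<open>G'\<close>, which is at most \<open>1 / c\<close> in absolute value, and every derivative that
falls elsewhere leaves a lower derivative of \<open>\<phi>\<close>. Hence
\<open>\<parallel>D k (L \<phi>)\<parallel>\<^sup>2 \<le> M * (1 / c) ^ (2 * k) * \<parallel>D k \<phi>\<parallel>\<^sup>2 + C k * (\<Sum>i<k. \<parallel>D i \<phi>\<parallel>\<^sup>2)\<close>
in \<open>L\<^sup>2\<close>, where \<open>M\<close> does not depend on \<open>k\<close> but nothing is known about the growth of \<open>C\<close>. It is essential
that the leading term is measured in \<open>L\<^sup>2\<close> on both sides: the passage to the supremum norm would cost one
derivative, and \<open>A k / A (Suc k)\<close> is unbounded.

The unknown constants are beaten by the weights: \<open>rapidly_decreasing_weights\<close> chooses \<open>A\<close> recursively so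
that \<open>A k * C k \<le> (1 / 2) ^ k * A i\<close> for all \<open>i < k\<close>. After this choice the \<open>k\<close>-th term of the squared norm of
\<open>L \<phi>\<close> is at most \<open>(M * (1 / c) ^ (2 * k) + (1 / 2) ^ k) * \<parallel>\<phi>\<parallel>\<^sup>2\<close>. This is a summable sequence, uniformly over the unit ball, so
\<open>L\<close> is bounded and, by dominated convergence, it turns convergence of each single derivative in \<open>L\<^sup>2\<close> into
convergence in \<open>H\<close>. A bounded sequence of \<open>H\<close> has a subsequence all of whose derivatives converge
uniformly (\<open>smooth_periodic_montel\<close>, from the Sobolev inequality, the Arzela-Ascoli theorem and a diagonal
argument). The two facts together give compactness of \<open>L\<close> (\<open>compact_operator_criterion\<close>). The same
compactness of balls, with lower semicontinuity of the norm, gives completeness of \<open>H\<close>.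

Trigonometric polynomials belong to \<open>H\<close> because \<open>A\<close> decreases faster than every geometric sequence. They
are dense because Fourier partial sums commute with derivatives and are orthogonal projections of \<open>L\<^sup>2\<close>:
every term of the squared norm of the remainder is dominated by the same term for \<open>\<phi>\<close>, and tends to zero
along a subsequence by \<open>smooth_periodic_montel\<close> and uniqueness of Fourier coefficients.\<close>

section \<open>Smooth functions on the line\<close>

lemma vderiv_0 [simp]: "vderiv 0 f = f"
  by (simp add: vderiv_def)

lemma vderiv_Suc: "vderiv (Suc k) f = (\<lambda>t. vector_derivative (vderiv k f) (at t))"
  by (simp add: vderiv_def)

lemma vderiv_vderiv: "vderiv k (vderiv l f) = vderiv (k + l) f"
  by (simp add: vderiv_def funpow_add)

lemma vderiv_Suc_shift: "vderiv (Suc k) f = vderiv k (vderiv 1 f)"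
  by (simp add: vderiv_vderiv)

lemma vderiv_eqI:
  assumes "\<And>t. (f has_vector_derivative g t) (at t)"
  shows "vderiv 1 f = g"
  using assms by (auto simp: vderiv_def intro!: vector_derivative_at)

text \<open>Membership in \<open>smooth_on UNIV\<close> mentions all iterated derivatives of \<open>f\<close> at once, which resists induction for
products and compositions. This finite version recurses on the derivative of \<open>f\<close> instead, so that the product
rule and the chain rule turn directly into induction steps.\<close>

primrec times_differentiable :: "nat \<Rightarrow> (real \<Rightarrow> 'b::real_normed_vector) \<Rightarrow> bool" where
  "times_differentiable 0 f \<longleftrightarrow> (\<forall>t. f differentiable (at t))"
| "times_differentiable (Suc n) f \<longleftrightarrow>
     (\<forall>t. f differentiable (at t)) \<and> times_differentiable n (vderiv 1 f)"

lemma times_differentiable_iff: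
  "times_differentiable n f \<longleftrightarrow> (\<forall>k\<le>n. \<forall>t. vderiv k f differentiable (at t))"
proof (induction n arbitrary: f)
  case (Suc n)
  have "(\<forall>k\<le>Suc n. \<forall>t. vderiv k f differentiable (at t)) \<longleftrightarrow>
      (\<forall>t. f differentiable (at t)) \<and> (\<forall>k\<le>n. \<forall>t. vderiv (Suc k) f differentiable (at t))"
    by (metis Suc_le_mono le0 not0_implies_Suc vderiv_0)
  then show ?case
    by (simp only: times_differentiable.simps Suc.IH vderiv_Suc_shift)
qed simp

lemma smooth_iff_times_differentiable:
  "smooth_on UNIV f \<longleftrightarrow> (\<forall>n. times_differentiable n f)"
  by (auto simp: smooth_on_def times_differentiable_iff)

lemma times_differentiable_less: "times_differentiable (Suc n) f \<Longrightarrow> times_differentiable n f"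
  by (simp add: times_differentiable_iff)

lemma smooth_differentiable: "smooth_on UNIV f \<Longrightarrow> f differentiable (at t)"
  unfolding smooth_on_def by (metis UNIV_I vderiv_0)

lemma has_vderiv_1: "f differentiable (at t) \<Longrightarrow> (f has_vector_derivative vderiv 1 f t) (at t)"
  by (simp add: vderiv_def vector_derivative_works)

lemma smooth_has_vderiv:
  "smooth_on UNIV f \<Longrightarrow> (vderiv k f has_vector_derivative vderiv (Suc k) f t) (at t)"
  by (simp add: smooth_on_def vderiv_Suc vector_derivative_works)

lemma smooth_has_vderiv_1: "smooth_on UNIV f \<Longrightarrow> (f has_vector_derivative vderiv 1 f t) (at t)"
  using smooth_has_vderiv [of f 0] by simp

lemma smooth_vderiv: "smooth_on UNIV f \<Longrightarrow> smooth_on UNIV (vderiv k f)"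
  by (simp add: smooth_on_def vderiv_vderiv)

lemma smooth_continuous_on: "smooth_on UNIV f \<Longrightarrow> continuous_on S (vderiv k f)"
  by (meson continuous_at_imp_continuous_on differentiable_imp_continuous_within smooth_on_def UNIV_I)

lemma times_differentiable_add:
  "times_differentiable n f \<Longrightarrow> times_differentiable n g \<Longrightarrow> times_differentiable n (\<lambda>t. f t + g t)"
proof (induction n arbitrary: f g)
  case (Suc n)
  have "vderiv 1 (\<lambda>t. f t + g t) = (\<lambda>t. vderiv 1 f t + vderiv 1 g t)"
    using Suc.prems by (intro vderiv_eqI has_vector_derivative_add has_vderiv_1) auto
  with Suc show ?case by simp
qed simp

lemma times_differentiable_linear:
  assumes h: "bounded_linear h"
  shows "times_differentiable n f \<Longrightarrow> times_differentiable n (\<lambda>t. h (f t))"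
proof (induction n arbitrary: f)
  case (Suc n)
  have *: "((\<lambda>t. h (f t)) has_vector_derivative h (vderiv 1 f t)) (at t)" for t
    using Suc.prems by (intro bounded_linear.has_vector_derivative [OF h] has_vderiv_1) auto
  then have "vderiv 1 (\<lambda>t. h (f t)) = (\<lambda>t. h (vderiv 1 f t))"
    by (intro vderiv_eqI)
  moreover have "(\<lambda>t. h (f t)) differentiable (at t)" for t
    using * by (meson differentiableI_vector)
  ultimately show ?case using Suc by simp
next
  case 0
  then show ?case
    by (auto dest!: has_vderiv_1 intro!: differentiableI_vector bounded_linear.has_vector_derivative [OF h])
qed

lemma times_differentiable_scaleR:
  "times_differentiable n f \<Longrightarrow> times_differentiable n g \<Longrightarrow> times_differentiable n (\<lambda>t. f t *\<^sub>R g t)"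
proof (induction n arbitrary: f g)
  case (Suc n)
  have *: "((\<lambda>t. f t *\<^sub>R g t) has_vector_derivative f t *\<^sub>R vderiv 1 g t + vderiv 1 f t *\<^sub>R g t) (at t)" for t
    using Suc.prems has_vderiv_1 [of f t] has_vderiv_1 [of g t]
    by (intro has_vector_derivative_scaleR)
       (auto simp: has_real_derivative_iff_has_vector_derivative)
  then have "vderiv 1 (\<lambda>t. f t *\<^sub>R g t) = (\<lambda>t. f t *\<^sub>R vderiv 1 g t + vderiv 1 f t *\<^sub>R g t)"
    by (intro vderiv_eqI)
  moreover have "times_differentiable n (\<lambda>t. f t *\<^sub>R vderiv 1 g t + vderiv 1 f t *\<^sub>R g t)"
    using Suc.prems times_differentiable_less [of n f] times_differentiable_less [of n g]
    by (intro times_differentiable_add Suc.IH) auto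
  ultimately show ?case using * Suc.prems
    by (metis differentiableI_vector times_differentiable.simps(2))
qed simp

lemma has_vector_derivative_compose_real:
  fixes v :: "real \<Rightarrow> real"
  assumes "u differentiable (at (v t))" "v differentiable (at t)"
  shows "((\<lambda>t. u (v t)) has_vector_derivative vderiv 1 v t *\<^sub>R vderiv 1 u (v t)) (at t)"
  using vector_diff_chain_at [OF has_vderiv_1 has_vderiv_1] assms by (simp add: o_def)

text \<open>The outer function is assumed smooth and only the inner one is counted: this is the form in which
\<open>smooth_autonomous_ode\<close> gains one derivative at a time.\<close>

lemma times_differentiable_compose:
  fixes v :: "real \<Rightarrow> real"
  assumes "smooth_on UNIV u"
  shows "times_differentiable n v \<Longrightarrow> times_differentiable n (\<lambda>t. u (v t))"
  using assms
proof (induction n arbitrary: u)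
  case 0
  then show ?case
    using has_vector_derivative_compose_real smooth_differentiable
    by (metis differentiableI_vector times_differentiable.simps(1))
next
  case (Suc n)
  have *: "((\<lambda>t. u (v t)) has_vector_derivative vderiv 1 v t *\<^sub>R vderiv 1 u (v t)) (at t)" for t
    using Suc.prems smooth_differentiable by (intro has_vector_derivative_compose_real) auto
  have "times_differentiable n (\<lambda>t. vderiv 1 v t *\<^sub>R vderiv 1 u (v t))"
    using Suc times_differentiable_less [of n v]
    by (intro times_differentiable_scaleR Suc.IH smooth_vderiv) auto
  then show ?case using * vderiv_eqI [OF *]
    by (metis differentiableI_vector times_differentiable.simps(2))
qed

lemma times_differentiable_inverse:
  fixes f :: "real \<Rightarrow> real"
  assumes nz: "\<And>t. f t \<noteq> 0"
  shows "times_differentiable n f \<Longrightarrow> times_differentiable n (\<lambda>t. inverse (f t))"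
proof (induction n)
  case 0
  then show ?case using nz by auto
next
  case (Suc n)
  have *: "((\<lambda>t. inverse (f t)) has_vector_derivative
      - (vderiv 1 f t *\<^sub>R (inverse (f t) *\<^sub>R inverse (f t)))) (at t)" for t
    using Suc.prems has_vderiv_1 [of f t] DERIV_inverse' [of f "vderiv 1 f t" t UNIV] nz
    by (simp add: has_real_derivative_iff_has_vector_derivative mult_ac)
  have "times_differentiable n (\<lambda>t. - (vderiv 1 f t *\<^sub>R (inverse (f t) *\<^sub>R inverse (f t))))"
    using Suc times_differentiable_less [of n f]
    by (intro times_differentiable_linear [OF bounded_linear_minus [OF bounded_linear_ident]] times_differentiable_scaleR) auto
  then show ?case using * vderiv_eqI [OF *]
    by (metis differentiableI_vector times_differentiable.simps(2))
qed

lemma smooth_add: "smooth_on UNIV f \<Longrightarrow> smooth_on UNIV g \<Longrightarrow> smooth_on UNIV (\<lambda>t. f t + g t)"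
  by (simp add: smooth_iff_times_differentiable times_differentiable_add)

lemma smooth_linear: "bounded_linear h \<Longrightarrow> smooth_on UNIV f \<Longrightarrow> smooth_on UNIV (\<lambda>t. h (f t))"
  by (simp add: smooth_iff_times_differentiable times_differentiable_linear)

lemma smooth_scaleR: "smooth_on UNIV f \<Longrightarrow> smooth_on UNIV g \<Longrightarrow> smooth_on UNIV (\<lambda>t. f t *\<^sub>R g t)"
  by (simp add: smooth_iff_times_differentiable times_differentiable_scaleR)

lemma smooth_compose:
  fixes v :: "real \<Rightarrow> real"
  shows "smooth_on UNIV u \<Longrightarrow> smooth_on UNIV v \<Longrightarrow> smooth_on UNIV (\<lambda>t. u (v t))"
  by (simp add: smooth_iff_times_differentiable [of v] smooth_iff_times_differentiable [of "\<lambda>t. u (v t)"]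
      times_differentiable_compose)

lemma smooth_inverse:
  fixes f :: "real \<Rightarrow> real"
  shows "smooth_on UNIV f \<Longrightarrow> (\<And>t. f t \<noteq> 0) \<Longrightarrow> smooth_on UNIV (\<lambda>t. inverse (f t))"
  by (simp add: smooth_iff_times_differentiable times_differentiable_inverse)

text \<open>Bootstrapping: if \<open>G\<close> is \<open>n\<close> times differentiable then so is \<open>u \<circ> G\<close>, which is the derivative of \<open>G\<close>. This
is how the inverse of the lifted map is seen to be smooth.\<close>

lemma smooth_autonomous_ode:
  fixes G :: "real \<Rightarrow> real"
  assumes u: "smooth_on UNIV u" and G: "\<And>t. (G has_vector_derivative u (G t)) (at t)"
  shows "smooth_on UNIV G"
proof -
  have "times_differentiable n G" for n
  proof (induction n)
    case 0
    show ?case using G by (auto intro: differentiableI_vector)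
  next
    case (Suc n)
    then show ?case using times_differentiable_compose [OF u Suc.IH] vderiv_eqI [OF G] G
      by (auto intro: differentiableI_vector)
  qed
  then show ?thesis by (simp add: smooth_iff_times_differentiable)
qed

lemma vderiv_add:
  assumes "smooth_on UNIV f" "smooth_on UNIV g"
  shows "vderiv k (\<lambda>t. f t + g t) = (\<lambda>t. vderiv k f t + vderiv k g t)"
proof (induction k)
  case (Suc k)
  have "((\<lambda>t. vderiv k f t + vderiv k g t) has_vector_derivative
      vderiv (Suc k) f t + vderiv (Suc k) g t) (at t)" for t
    using assms by (intro has_vector_derivative_add smooth_has_vderiv)
  then show ?case
    by (subst vderiv_Suc) (auto simp: Suc intro!: vector_derivative_at)
qed simp

lemma vderiv_linear:
  assumes "bounded_linear h" "smooth_on UNIV f"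
  shows "vderiv k (\<lambda>t. h (f t)) = (\<lambda>t. h (vderiv k f t))"
proof (induction k)
  case (Suc k)
  have "((\<lambda>t. h (vderiv k f t)) has_vector_derivative h (vderiv (Suc k) f t)) (at t)" for t
    by (rule bounded_linear.has_vector_derivative [OF assms(1) smooth_has_vderiv [OF assms(2)]])
  then show ?case
    by (subst vderiv_Suc) (auto simp: Suc intro!: vector_derivative_at)
qed simp

lemma vderiv_zero: "vderiv k (\<lambda>t. 0) = (\<lambda>t. 0)"
  by (induction k) (auto simp: vderiv_Suc)

lemma smooth_const [simp]: "smooth_on UNIV (\<lambda>t. c)"
proof -
  have "vderiv k (\<lambda>t::real. c) = (if k = 0 then (\<lambda>t. c) else (\<lambda>t. 0))" for k
    by (induction k) (auto simp: vderiv_Suc)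
  then show ?thesis by (simp add: smooth_on_def)
qed

lemma smooth_shift: "smooth_on UNIV f \<Longrightarrow> smooth_on UNIV (\<lambda>t. f (t + a))"
proof -
  assume "smooth_on UNIV f"
  moreover have "smooth_on UNIV (\<lambda>t. t + a)"
    by (rule smooth_autonomous_ode [of "\<lambda>t. 1"]) (auto intro!: derivative_eq_intros)
  ultimately show ?thesis by (rule smooth_compose)
qed

lemma vderiv_shift:
  assumes "smooth_on UNIV f"
  shows "vderiv k (\<lambda>t. f (t + a)) = (\<lambda>t. vderiv k f (t + a))"
proof (induction k)
  case (Suc k)
  have "((\<lambda>t. vderiv k f (t + a)) has_vector_derivative vderiv (Suc k) f (t + a)) (at t)" for t
    using vector_diff_chain_at [of "\<lambda>t. t + a" 1 t "vderiv k f" "vderiv (Suc k) f (t + a)"]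
      smooth_has_vderiv [OF assms, of k "t + a"]
    by (simp add: o_def has_vector_derivative_add_const)
  then show ?case
    by (subst vderiv_Suc) (auto simp: Suc intro!: vector_derivative_at)
qed simp

lemma smooth_sum:
  assumes "\<And>i. i \<in> I \<Longrightarrow> smooth_on UNIV (f i)"
  shows "smooth_on UNIV (\<lambda>t. \<Sum>i\<in>I. f i t)"
  using assms by (induction I rule: infinite_finite_induct) (auto intro: smooth_add)

lemma vderiv_sum:
  assumes "\<And>i. i \<in> I \<Longrightarrow> smooth_on UNIV (f i)"
  shows "vderiv k (\<lambda>t. \<Sum>i\<in>I. f i t) = (\<lambda>t. \<Sum>i\<in>I. vderiv k (f i) t)"
  using assms
  by (induction I rule: infinite_finite_induct) (auto simp: vderiv_zero vderiv_add smooth_sum)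

lemma smooth_cmult: "smooth_on UNIV f \<Longrightarrow> smooth_on UNIV (\<lambda>t. c * f t :: complex)"
  by (rule smooth_linear [OF bounded_linear_mult_right])

lemma vderiv_cmult: "smooth_on UNIV f \<Longrightarrow> vderiv k (\<lambda>t. c * f t :: complex) = (\<lambda>t. c * vderiv k f t)"
  by (rule vderiv_linear [OF bounded_linear_mult_right])

lemma smooth_diff:
  "smooth_on UNIV f \<Longrightarrow> smooth_on UNIV g \<Longrightarrow> smooth_on UNIV (\<lambda>t. f t - g t)"
  using smooth_add [of f "\<lambda>t. - g t"] smooth_linear [OF bounded_linear_minus [OF bounded_linear_ident], of g]
  by simp

lemma vderiv_diff:
  assumes "smooth_on UNIV f" "smooth_on UNIV g"
  shows "vderiv k (\<lambda>t. f t - g t) = (\<lambda>t. vderiv k f t - vderiv k g t)"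
  using vderiv_add [OF assms(1), of "\<lambda>t. - g t" k] assms(2)
    vderiv_linear [OF bounded_linear_minus [OF bounded_linear_ident] assms(2), of k]
    smooth_linear [OF bounded_linear_minus [OF bounded_linear_ident] assms(2)]
  by simp

text \<open>Local lifts of a circle map differ from a global lift by constants, hence the constant \<open>c\<close>.\<close>

lemma smooth_local:
  assumes "\<And>t. \<exists>U f c. open U \<and> t \<in> U \<and> smooth_on U f \<and> (\<forall>s\<in>U. F s = f s + c)"
  shows "smooth_on UNIV F"
  unfolding smooth_on_def
proof (intro allI ballI)
  fix k t
  obtain U f c where U: "open U" "t \<in> U" "smooth_on U f" and F: "\<And>s. s \<in> U \<Longrightarrow> F s = f s + c"
    using assms [of t] by auto
  have "\<forall>s\<in>U. vderiv k F s = vderiv k f s + (if k = 0 then c else 0)"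
  proof (induction k)
    case (Suc k)
    show ?case
    proof
      fix s assume s: "s \<in> U"
      have "(vderiv k f has_vector_derivative vderiv (Suc k) f s) (at s)"
        using U(3) s by (auto simp: vderiv_Suc smooth_on_def vector_derivative_works)
      then have "((\<lambda>s. vderiv k f s + (if k = 0 then c else 0)) has_vector_derivative vderiv (Suc k) f s) (at s)"
        by (simp add: has_vector_derivative_add_const)
      then have "(vderiv k F has_vector_derivative vderiv (Suc k) f s) (at s)"
        by (rule has_vector_derivative_transform_within_open [OF _ U(1) s]) (simp add: Suc)
      then show "vderiv (Suc k) F s = vderiv (Suc k) f s + (if Suc k = 0 then c else 0)"
        by (subst vderiv_Suc) (auto intro!: vector_derivative_at)
    qed
  qed (simp add: F)
  moreover have "(vderiv k f has_vector_derivative vderiv (Suc k) f t) (at t)"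
    using U(2,3) by (auto simp: vderiv_Suc smooth_on_def vector_derivative_works)
  then have "((\<lambda>s. vderiv k f s + (if k = 0 then c else 0)) has_vector_derivative vderiv (Suc k) f t) (at t)"
    by (simp add: has_vector_derivative_add_const)
  ultimately have "(vderiv k F has_vector_derivative vderiv (Suc k) f t) (at t)"
    using has_vector_derivative_transform_within_open [OF _ U(1,2), of _ _ "vderiv k F"] by auto
  then show "vderiv k F differentiable (at t)"
    by (rule differentiableI_vector)
qed

section \<open>The metric of an inner product on functions\<close>

context
  fixes H :: "('a \<Rightarrow> complex) set"
  assumes sub: "function_subspace H"
begin

lemma subspace_zero: "(\<lambda>x. 0) \<in> H"
  using sub by (simp add: function_subspace_def)

lemma subspace_add: "f \<in> H \<Longrightarrow> g \<in> H \<Longrightarrow> (\<lambda>x. f x + g x) \<in> H"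
  using sub by (simp add: function_subspace_def)

lemma subspace_scale: "f \<in> H \<Longrightarrow> (\<lambda>x. c * f x) \<in> H"
  using sub by (simp add: function_subspace_def)

lemma subspace_diff: "f \<in> H \<Longrightarrow> g \<in> H \<Longrightarrow> (\<lambda>x. f x - g x) \<in> H"
  using subspace_add [OF _ subspace_scale, of f g "- 1"] by simp

context
  fixes ip
  assumes ip: "complex_inner_product H ip"
begin

lemma ip_add: "f \<in> H \<Longrightarrow> g \<in> H \<Longrightarrow> h \<in> H \<Longrightarrow> ip (\<lambda>x. f x + g x) h = ip f h + ip g h"
  by (rule ip [unfolded complex_inner_product_def, THEN conjunct1, rule_format])

lemma ip_scale: "f \<in> H \<Longrightarrow> g \<in> H \<Longrightarrow> ip (\<lambda>x. c * f x) g = c * ip f g"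
  by (rule ip [unfolded complex_inner_product_def, THEN conjunct2, THEN conjunct1, rule_format])

lemma re_ip_commute: "f \<in> H \<Longrightarrow> g \<in> H \<Longrightarrow> Re (ip g f) = Re (ip f g)"
  using ip [unfolded complex_inner_product_def, THEN conjunct2, THEN conjunct2, THEN conjunct1, rule_format, of f g]
  by simp

lemma re_ip_pos: "f \<in> H \<Longrightarrow> f \<noteq> (\<lambda>x. 0) \<Longrightarrow> Re (ip f f) > 0"
  by (rule ip [unfolded complex_inner_product_def, THEN conjunct2, THEN conjunct2, THEN conjunct2, rule_format])

text \<open>Only real multiples are expanded: the real part of the inner product is a real inner product with the same
norm, which is all that the triangle inequality needs.\<close>

lemma re_ip_add_scaled:
  assumes f: "f \<in> H" and g: "g \<in> H"
  shows "Re (ip (\<lambda>x. f x + complex_of_real s * g x) (\<lambda>x. f x + complex_of_real s * g x)) =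
    Re (ip f f) + 2 * s * Re (ip f g) + s\<^sup>2 * Re (ip g g)"
proof -
  define h where "h = (\<lambda>x. complex_of_real s * g x)"
  have h: "h \<in> H" and fh: "(\<lambda>x. f x + h x) \<in> H"
    using subspace_scale subspace_add f g by (auto simp: h_def)
  have scale: "ip h w = s * ip g w" if "w \<in> H" for w
    using ip_scale g that by (simp add: h_def)
  have "Re (ip (\<lambda>x. f x + h x) (\<lambda>x. f x + h x)) = Re (ip (\<lambda>x. f x + h x) f) + Re (ip (\<lambda>x. f x + h x) h)"
    using ip_add [OF f h fh] re_ip_commute [OF fh f] re_ip_commute [OF fh h] by simp
  also have "\<dots> = Re (ip f f) + 2 * Re (ip h f) + Re (ip h h)"
    using ip_add [OF f h f] ip_add [OF f h h] re_ip_commute [OF f h] by simp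
  also have "Re (ip h f) = s * Re (ip f g)"
    using scale [OF f] re_ip_commute [OF f g] by simp
  also have "Re (ip h h) = s\<^sup>2 * Re (ip g g)"
    using scale [OF h] re_ip_commute [OF g h] scale [OF g] by (simp add: power2_eq_square)
  finally show ?thesis by (simp add: h_def)
qed

lemma ip_zero: "g \<in> H \<Longrightarrow> ip (\<lambda>x. 0) g = 0"
  using ip_scale [of "\<lambda>x. 0" g 0] subspace_zero by simp

lemma re_ip_nonneg: "f \<in> H \<Longrightarrow> Re (ip f f) \<ge> 0"
  using re_ip_pos ip_zero subspace_zero by (metis less_imp_le order_refl zero_complex.simps(1))

lemma re_ip_zero_iff: "f \<in> H \<Longrightarrow> Re (ip f f) = 0 \<longleftrightarrow> f = (\<lambda>x. 0)"
  using re_ip_pos ip_zero subspace_zero by (metis less_irrefl zero_complex.simps(1))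

text \<open>The Cauchy-Schwarz inequality comes from the discriminant of the nonnegative quadratic polynomial
\<open>s \<mapsto> \<parallel>f + s g\<parallel>\<^sup>2\<close>.\<close>

lemma ip_norm_triangle:
  assumes f: "f \<in> H" and g: "g \<in> H"
  shows "sqrt (Re (ip (\<lambda>x. f x + g x) (\<lambda>x. f x + g x))) \<le> sqrt (Re (ip f f)) + sqrt (Re (ip g g))"
proof -
  define a b c where "a = Re (ip f f)" "b = Re (ip g g)" "c = Re (ip f g)"
  have nonneg: "a \<ge> 0" "b \<ge> 0" using re_ip_nonneg f g by (auto simp: a_b_c_def)
  have q: "a + 2 * s * c + s\<^sup>2 * b \<ge> 0" for s
    using re_ip_add_scaled [OF f g, of s] re_ip_nonneg [OF subspace_add [OF f subspace_scale [OF g, of s]]]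
    by (simp add: a_b_c_def)
  have "c\<^sup>2 \<le> a * b"
  proof (cases "b = 0")
    case True
    \<comment> \<open>a linear polynomial in \<open>s\<close> cannot stay nonnegative; the witness gives the value \<open>- 1\<close>\<close>
    have "c = 0"
    proof (rule ccontr)
      assume "c \<noteq> 0"
      then show False using q [of "- (a + 1) / (2 * c)"] True nonneg by (simp add: field_simps)
    qed
    then show ?thesis using nonneg by simp
  next
    case False
    then show ?thesis using q [of "- c / b"] nonneg by (simp add: field_simps power2_eq_square)
  qed
  then have "c \<le> sqrt (a * b)"
    by (rule real_le_rsqrt)
  then have "c \<le> sqrt a * sqrt b"
    by (simp add: real_sqrt_mult)
  then have "a + 2 * c + b \<le> (sqrt a + sqrt b)\<^sup>2"
    using nonneg by (simp add: power2_sum)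
  then have "sqrt (a + 2 * c + b) \<le> sqrt a + sqrt b"
    using nonneg by (simp add: real_le_lsqrt)
  then show ?thesis using re_ip_add_scaled [OF f g, of 1] by (simp add: a_b_c_def)
qed

lemma ip_metric_space: "Metric_space H (ip_dist H ip)"
proof
  fix f g h assume fgh: "f \<in> H" "g \<in> H" "h \<in> H"
  show "ip_dist H ip f h \<le> ip_dist H ip f g + ip_dist H ip g h"
    using ip_norm_triangle [OF subspace_diff subspace_diff, of f g g h] fgh
    by (simp add: ip_dist_def)
next
  fix f g assume fg: "f \<in> H" "g \<in> H"
  show "ip_dist H ip f g = 0 \<longleftrightarrow> f = g"
    using re_ip_zero_iff [OF subspace_diff [OF fg]] fg by (simp add: ip_dist_def fun_eq_iff)
next
  fix f g
  show "ip_dist H ip f g \<ge> 0"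
    using re_ip_nonneg subspace_diff by (simp add: ip_dist_def)
  show "ip_dist H ip f g = ip_dist H ip g f"
  proof (cases "f \<in> H \<and> g \<in> H")
    case True
    then show ?thesis
      using re_ip_add_scaled [of "\<lambda>x. 0" "\<lambda>x. f x - g x" "- 1"] subspace_diff subspace_zero ip_zero
      by (simp add: ip_dist_def)
  qed (auto simp: ip_dist_def)
qed

end

end

section \<open>Periodic functions: Sobolev inequality and compactness\<close>

definition has_period :: "real \<Rightarrow> (real \<Rightarrow> 'b) \<Rightarrow> bool" where
  "has_period p f \<longleftrightarrow> (\<forall>t. f (t + p) = f t)"

lemma has_period_of_nat: "has_period p f \<Longrightarrow> f (t + of_nat n * p) = f t"
proof (induction n)
  case (Suc n)
  then have "f ((t + of_nat n * p) + p) = f t"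
    unfolding has_period_def by simp
  then show ?case by (simp add: algebra_simps)
qed simp

lemma has_period_of_int: "has_period p f \<Longrightarrow> f (t + of_int n * p) = f t"
proof (cases "n \<ge> 0")
  case True
  assume "has_period p f"
  then show ?thesis using has_period_of_nat [of p f t "nat n"] True by simp
next
  case False
  assume "has_period p f"
  then show ?thesis using has_period_of_nat [of p f "t + of_int n * p" "nat (- n)"] False by simp
qed

lemma has_period_reduce:
  assumes "has_period p f" "p > 0"
  obtains s where "s \<in> {0..p}" "f t = f s"
proof
  show "frac (t / p) * p \<in> {0..p}"
    using assms frac_lt_1 [of "t / p"] frac_ge_0 [of "t / p"] by (simp add: mult_le_cancel_right1)
  have "t = frac (t / p) * p + of_int \<lfloor>t / p\<rfloor> * p"
    using assms(2) by (simp add: frac_def field_simps)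
  then show "f t = f (frac (t / p) * p)"
    using has_period_of_int [OF assms(1)] by metis
qed

lemma has_period_bounded:
  fixes f :: "real \<Rightarrow> 'b::real_normed_vector"
  assumes "has_period p f" "p > 0" "continuous_on UNIV f"
  obtains M where "M \<ge> 0" "\<And>t. norm (f t) \<le> M"
proof -
  have "compact (f ` {0..p})"
    using assms(3) continuous_on_subset by (intro compact_continuous_image) auto
  then obtain M where "\<And>x. x \<in> f ` {0..p} \<Longrightarrow> norm x \<le> M"
    using compact_imp_bounded bounded_iff by metis
  then have "norm (f t) \<le> max M 0" for t
    using has_period_reduce [OF assms(1,2), of t] by (metis image_eqI max.coboundedI1)
  then show ?thesis using that by (meson max.cobounded2)
qed

lemma has_period_vderiv:
  assumes "smooth_on UNIV f" "has_period p f"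
  shows "has_period p (vderiv k f)"
proof -
  have "(\<lambda>t. f (t + p)) = f"
    using assms(2) by (auto simp: has_period_def)
  then show ?thesis
    using vderiv_shift [OF assms(1), of k p] by (metis has_period_def)
qed

lemma integral_shift_period:
  fixes f :: "real \<Rightarrow> 'b::banach"
  assumes per: "has_period 1 f" and cont: "continuous_on UNIV f"
  shows "integral {a..a+1} f = integral {0..1} f"
proof -
  have int: "f integrable_on {x..y}" for x y
    using cont continuous_on_subset by (blast intro: integrable_continuous_real)
  have shift: "integral {x..y} f = integral {x + of_int n..y + of_int n} f" for x y n
    using integral_shift_real_ivl [of "x + of_int n" "of_int n" "y + of_int n" f]
      has_period_of_int [OF per, of _ n] by simp
  have "a = frac a + of_int \<lfloor>a\<rfloor>" by (simp add: frac_def)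
  then have "integral {a..a+1} f = integral {frac a..frac a + 1} f"
    using shift [of "frac a" "frac a + 1" "\<lfloor>a\<rfloor>"] by (simp add: algebra_simps)
  also have "\<dots> = integral {frac a..1} f + integral {1..frac a + 1} f"
    using frac_lt_1 [of a] frac_ge_0 [of a] Henstock_Kurzweil_Integration.integral_combine [where a = "frac a" and c = 1 and b = "frac a + 1" and f = f] int by simp
  also have "integral {1..frac a + 1} f = integral {0..frac a} f"
    using shift [of 0 "frac a" 1] by (simp add: add.commute)
  also have "integral {frac a..1} f + integral {0..frac a} f = integral {0..1} f"
    using frac_lt_1 [of a] frac_ge_0 [of a] Henstock_Kurzweil_Integration.integral_combine [where a = 0 and c = "frac a" and b = 1 and f = f] int
    by (simp add: add.commute)
  finally show ?thesis .
qed

text \<open>The squared \<open>L\<^sup>2\<close> norm over one period. Working with squares avoids square roots: the inequality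
\<open>\<parallel>f + g\<parallel>\<^sup>2 \<le> 2 \<parallel>f\<parallel>\<^sup>2 + 2 \<parallel>g\<parallel>\<^sup>2\<close> replaces the triangle inequality wherever constants are harmless.\<close>

definition l2sq :: "(real \<Rightarrow> complex) \<Rightarrow> real" where
  "l2sq f = integral {0..1} (\<lambda>t. (norm (f t))\<^sup>2)"

lemma l2sq_nonneg: "l2sq f \<ge> 0"
proof (cases "(\<lambda>t. (norm (f t))\<^sup>2) integrable_on {0..1}")
  case True
  then show ?thesis unfolding l2sq_def by (intro integral_nonneg) auto
qed (simp add: l2sq_def not_integrable_integral)

lemma integrable_norm_sq:
  "continuous_on UNIV f \<Longrightarrow> (\<lambda>t. (norm (f t :: complex))\<^sup>2) integrable_on {a..b::real}"
  by (intro integrable_continuous_real continuous_intros) (auto intro: continuous_on_subset)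

lemma norm_add_sq_le: "(norm (x + y :: complex))\<^sup>2 \<le> 2 * (norm x)\<^sup>2 + 2 * (norm y)\<^sup>2"
proof -
  have "(norm (x + y))\<^sup>2 \<le> (norm x + norm y)\<^sup>2"
    by (intro power_mono norm_triangle_ineq) auto
  also have "\<dots> \<le> 2 * (norm x)\<^sup>2 + 2 * (norm y)\<^sup>2"
    using sum_squares_bound [of "norm x" "norm y"] by (simp add: power2_sum)
  finally show ?thesis .
qed

lemma l2sq_add_le:
  assumes "continuous_on UNIV f" "continuous_on UNIV g"
  shows "l2sq (\<lambda>t. f t + g t) \<le> 2 * l2sq f + 2 * l2sq g"
proof -
  have int: "(\<lambda>t. 2 * (norm (h t))\<^sup>2) integrable_on {0..1}" if "continuous_on UNIV h" for h :: "real \<Rightarrow> complex"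
    by (intro integrable_continuous_real continuous_intros continuous_on_subset [OF that]) auto
  have "l2sq (\<lambda>t. f t + g t) \<le> integral {0..1} (\<lambda>t. 2 * (norm (f t))\<^sup>2 + 2 * (norm (g t))\<^sup>2)"
    unfolding l2sq_def
    by (intro integral_le integrable_norm_sq integrable_add int continuous_on_add assms norm_add_sq_le)
  also have "\<dots> = 2 * l2sq f + 2 * l2sq g"
    unfolding l2sq_def using integral_add [OF int int] assms by simp
  finally show ?thesis .
qed

lemma l2sq_cmult: "l2sq (\<lambda>t. c * f t) = (norm c)\<^sup>2 * l2sq f"
  by (simp add: l2sq_def norm_mult power_mult_distrib)

lemma l2sq_diff_le:
  assumes "continuous_on UNIV f" "continuous_on UNIV g"
  shows "l2sq (\<lambda>t. f t - g t) \<le> 2 * l2sq f + 2 * l2sq g"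
  using l2sq_add_le [of f "\<lambda>t. - 1 * g t"] l2sq_cmult [of "- 1" g] assms
  by (simp add: continuous_on_minus)

lemma l2sq_le_sup:
  assumes "continuous_on UNIV f" "\<And>t. norm (f t) \<le> M"
  shows "l2sq f \<le> M\<^sup>2"
proof -
  have "l2sq f \<le> integral {0..1::real} (\<lambda>t. M\<^sup>2)"
    unfolding l2sq_def using assms
    by (intro integral_le integrable_norm_sq power_mono) auto
  then show ?thesis by simp
qed

text \<open>The derivative of \<open>\<bar>f\<bar>\<^sup>2\<close> is at most \<open>\<bar>f\<bar>\<^sup>2 + \<bar>f'\<bar>\<^sup>2\<close> in absolute value, so \<open>\<bar>f\<bar>\<^sup>2\<close> varies by at most
\<open>l2sq f + l2sq f'\<close> over a period; averaging the base point over the period gives the bound.\<close>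

lemma sobolev_sup_bound:
  assumes f: "\<And>t. (f has_vector_derivative f' t) (at t)"
    and f': "continuous_on UNIV f'" and per: "has_period 1 f"
  shows "(norm (f t))\<^sup>2 \<le> 2 * l2sq f + l2sq f'"
proof -
  have cf: "continuous_on UNIV f"
    using f by (meson continuous_at_imp_continuous_on has_vector_derivative_continuous)
  define u where "u = (\<lambda>t. (norm (f t))\<^sup>2)"
  define w where "w = (\<lambda>t. (norm (f t))\<^sup>2 + (norm (f' t))\<^sup>2)"
  have du: "(u has_vector_derivative 2 * inner (f s) (f' s)) (at s within A)" for s A
  proof -
    have "((\<lambda>t. inner (f t) (f t)) has_vector_derivative inner (f s) (f' s) + inner (f' s) (f s)) (at s)"
      using bounded_bilinear.has_vector_derivative [OF bounded_bilinear_inner f f] .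
    then show ?thesis
      by (simp add: u_def power2_norm_eq_inner inner_commute has_vector_derivative_at_within)
  qed
  have le: "\<bar>2 * inner (f s) (f' s)\<bar> \<le> w s" for s
  proof -
    have "\<bar>2 * inner (f s) (f' s)\<bar> \<le> 2 * (norm (f s) * norm (f' s))"
      using Cauchy_Schwarz_ineq2 [of "f s" "f' s"] by simp
    also have "\<dots> \<le> w s"
      using sum_squares_bound [of "norm (f s)" "norm (f' s)"] by (simp add: w_def)
    finally show ?thesis .
  qed
  have w_int: "w integrable_on {a..b}" for a b
    unfolding w_def using cf f' by (intro integrable_add integrable_norm_sq)
  have w_tot: "integral {0..1} w = l2sq f + l2sq f'"
    unfolding w_def l2sq_def using cf f' by (intro integral_add integrable_norm_sq)
  have diff: "\<bar>u b - u a\<bar> \<le> l2sq f + l2sq f'" if ab: "0 \<le> a" "a \<le> b" "b \<le> 1" for a b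
  proof -
    have i: "((\<lambda>s. 2 * inner (f s) (f' s)) has_integral (u b - u a)) {a..b}"
      by (rule fundamental_theorem_of_calculus [OF ab(2) du])
    then have "norm (u b - u a) \<le> integral {a..b} w"
      using le w_int by (subst integral_unique [OF i, symmetric], intro integral_norm_bound_integral) auto
    also have "\<dots> \<le> integral {0..1} w"
      using ab by (intro integral_subset_le w_int) (auto simp: w_def)
    finally show ?thesis using w_tot by simp
  qed
  obtain s where s: "s \<in> {0..1}" "f t = f s"
    using has_period_reduce [OF per, of t] by auto
  \<comment> \<open>integrating this lower bound of \<open>u x\<close> over \<open>x\<close> is the averaging step\<close>
  have "u s - (l2sq f + l2sq f') \<le> u x" if "x \<in> {0..1}" for x
    using diff [of s x] diff [of x s] s(1) that by (cases "s \<le> x") auto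
  then have "integral {0..1::real} (\<lambda>x. u s - (l2sq f + l2sq f')) \<le> integral {0..1} u"
    unfolding u_def using cf by (intro integral_le integrable_norm_sq) auto
  then show ?thesis
    using s(2) by (simp add: u_def l2sq_def)
qed

lemma sobolev_sup_bound_vderiv:
  assumes "smooth_on UNIV f" "has_period 1 f"
  shows "(norm (vderiv k f t))\<^sup>2 \<le> 2 * l2sq (vderiv k f) + l2sq (vderiv (Suc k) f)"
  using assms by (intro sobolev_sup_bound smooth_has_vderiv smooth_continuous_on has_period_vderiv)

lemma vderiv_lipschitz:
  assumes "smooth_on UNIV f" and M: "\<And>t. norm (vderiv (Suc k) f t) \<le> M"
  shows "norm (vderiv k f x - vderiv k f y) \<le> M * norm (x - y)"
proof (rule differentiable_bound [of UNIV])
  fix t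
  show "(vderiv k f has_derivative (\<lambda>h. h *\<^sub>R vderiv (Suc k) f t)) (at t within UNIV)"
    using smooth_has_vderiv [OF assms(1)] by (simp add: has_vector_derivative_def)
  show "onorm (\<lambda>h. h *\<^sub>R vderiv (Suc k) f t) \<le> M"
  proof (rule onorm_le)
    fix h :: real
    show "norm (h *\<^sub>R vderiv (Suc k) f t) \<le> M * norm h"
      using mult_right_mono [OF M [of t], of "\<bar>h\<bar>"] by (simp add: mult.commute)
  qed
qed auto

text \<open>Arzela-Ascoli on one period, transported to the whole line. The conclusion is stated as a Cauchy property
because this passes to subsequences without carrying a limit function along, as the diagonal argument
requires.\<close>

lemma uniformly_Cauchy_subsequence_periodic:
  fixes f :: "nat \<Rightarrow> real \<Rightarrow> complex"
  assumes per: "\<And>i. has_period 1 (f i)" and bd: "\<And>i t. norm (f i t) \<le> M"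
    and lip: "\<And>i x y. norm (f i x - f i y) \<le> L * norm (x - y)"
  obtains r where "strict_mono (r :: nat \<Rightarrow> nat)" "uniformly_Cauchy_on UNIV (\<lambda>i. f (r i))"
proof -
  have equi: "\<exists>d>0. \<forall>n y. y \<in> {0..1} \<and> norm (x - y) < d \<longrightarrow> norm (f n x - f n y) < e"
    if "e > 0" for x e
  proof (intro exI conjI allI impI)
    show "e / (\<bar>L\<bar> + 1) > 0" using that by simp
    fix n y assume *: "y \<in> {0..1} \<and> norm (x - y) < e / (\<bar>L\<bar> + 1)"
    have "norm (f n x - f n y) \<le> L * norm (x - y)" by (rule lip)
    also have "\<dots> \<le> (\<bar>L\<bar> + 1) * norm (x - y)" by (intro mult_right_mono) auto
    also have "\<dots> < e" using * by (simp add: field_simps)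
    finally show "norm (f n x - f n y) < e" .
  qed
  obtain g r where "continuous_on {0..1} g" and r: "strict_mono (r :: nat \<Rightarrow> nat)"
    and lim: "\<And>e. 0 < e \<Longrightarrow> \<exists>N. \<forall>n x. n \<ge> N \<and> x \<in> {0..1} \<longrightarrow> norm (f (r n) x - g x) < e"
    using Arzela_Ascoli [of "{0..1}" f M] bd equi by (metis compact_Icc)
  have "uniformly_Cauchy_on UNIV (\<lambda>i. f (r i))"
    unfolding uniformly_Cauchy_on_def
  proof (intro allI impI)
    fix e :: real assume "e > 0"
    then obtain N where N: "\<And>n x. n \<ge> N \<Longrightarrow> x \<in> {0..1} \<Longrightarrow> norm (f (r n) x - g x) < e / 2"
      using lim [of "e / 2"] by auto
    have "dist (f (r m) t) (f (r n) t) < e" if "m \<ge> N" "n \<ge> N" for m n t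
    proof -
      have t: "f i t = f i (frac t)" for i
        using has_period_of_int [OF per, of i "frac t" "\<lfloor>t\<rfloor>"] by (simp add: frac_def)
      have "frac t \<in> {0..1}" using frac_lt_1 [of t] frac_ge_0 [of t] by (simp add: less_imp_le)
      then have "norm (f (r m) (frac t) - g (frac t)) < e / 2" "norm (f (r n) (frac t) - g (frac t)) < e / 2"
        using N that by blast+
      then show ?thesis
        unfolding t by (metis dist_norm dist_triangle_half_l dist_commute)
    qed
    then show "\<exists>N. \<forall>t\<in>UNIV. \<forall>m\<ge>N. \<forall>n\<ge>N. dist (f (r m) t) (f (r n) t) < e" by blast
  qed
  then show ?thesis using that r by blast
qed

lemma smooth_uniform_limit:
  fixes f :: "nat \<Rightarrow> real \<Rightarrow> complex"
  assumes f: "\<And>i. smooth_on UNIV (f i)"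
    and lim: "\<And>k. uniform_limit UNIV (\<lambda>i. vderiv k (f i)) (g k) sequentially"
  shows "smooth_on UNIV (g 0) \<and> vderiv k (g 0) = g k"
proof -
  have d: "(g k has_vector_derivative g (Suc k) x) (at x)" for k x
  proof -
    have pt: "(\<lambda>i. vderiv k (f i) y) \<longlonglongrightarrow> g k y" for y k
      using tendsto_uniform_limitI [OF lim] by simp
    have "\<forall>\<^sub>F n in sequentially. \<forall>x\<in>UNIV. \<forall>h.
        norm (h *\<^sub>R vderiv (Suc k) (f n) x - h *\<^sub>R g (Suc k) x) \<le> e * norm h" if "e > 0" for e
      using uniform_limitD [OF lim [of "Suc k"] that]
    proof eventually_elim
      case (elim n)
      have "norm (h *\<^sub>R (vderiv (Suc k) (f n) x - g (Suc k) x)) \<le> e * norm h" for h x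
        using elim by (simp add: dist_norm mult.commute [of e] mult_left_mono less_imp_le)
      then show ?case by (simp add: scaleR_diff_right)
    qed
    then have "\<exists>G. \<forall>x\<in>UNIV. (\<lambda>n. vderiv k (f n) x) \<longlonglongrightarrow> G x \<and>
        (G has_derivative (\<lambda>h. h *\<^sub>R g (Suc k) x)) (at x within UNIV)"
      using pt smooth_has_vderiv [OF f]
      by (intro has_derivative_sequence [where f' = "\<lambda>n x h. h *\<^sub>R vderiv (Suc k) (f n) x" and ?x0.0 = 0])
         (auto simp: has_vector_derivative_def)
    then obtain G where G: "\<And>x. (\<lambda>n. vderiv k (f n) x) \<longlonglongrightarrow> G x"
        "\<And>x. (G has_derivative (\<lambda>h. h *\<^sub>R g (Suc k) x)) (at x)"
      by auto
    have "G = g k" using LIMSEQ_unique [OF G(1) pt] by auto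
    then show ?thesis using G(2) by (simp add: has_vector_derivative_def)
  qed
  have v: "vderiv k (g 0) = g k" for k
    by (induction k) (use d in \<open>auto simp: vderiv_Suc intro!: vector_derivative_at\<close>)
  then show ?thesis using d by (auto simp: smooth_on_def intro: differentiableI_vector)
qed

text \<open>The Frechet space of smooth periodic functions has the Montel property: \<open>L\<^sup>2\<close> bounds on all derivatives give
uniform bounds on all derivatives by the Sobolev inequality, hence equicontinuity of each derivative, and a
diagonal subsequence makes all of them converge at once.\<close>

theorem smooth_periodic_montel:
  fixes f :: "nat \<Rightarrow> real \<Rightarrow> complex"
  assumes smooth: "\<And>i. smooth_on UNIV (f i)" and per: "\<And>i. has_period 1 (f i)"
    and bd: "\<And>k. \<exists>B. \<forall>i. l2sq (vderiv k (f i)) \<le> B"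
  obtains r g where "strict_mono (r :: nat \<Rightarrow> nat)" "smooth_on UNIV g" "has_period 1 g"
    "\<And>k. uniform_limit UNIV (\<lambda>i. vderiv k (f (r i))) (vderiv k g) sequentially"
proof -
  have sup: "\<exists>M. \<forall>i t. norm (vderiv k (f i) t) \<le> M" for k
  proof -
    obtain B C where B: "\<And>i. l2sq (vderiv k (f i)) \<le> B" and C: "\<And>i. l2sq (vderiv (Suc k) (f i)) \<le> C"
      using bd by meson
    have "norm (vderiv k (f i) t) \<le> sqrt (2 * B + C)" for i t
      using sobolev_sup_bound_vderiv [OF smooth [of i] per [of i], of k t] B [of i] C [of i]
      by (intro real_le_rsqrt) auto
    then show ?thesis by blast
  qed
  interpret subseqs "\<lambda>k s. uniformly_Cauchy_on UNIV (\<lambda>i. vderiv k (f (s i)))"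
  proof
    fix k and s :: "nat \<Rightarrow> nat"
    obtain M L where M: "\<And>i t. norm (vderiv k (f i) t) \<le> M"
      and L: "\<And>i t. norm (vderiv (Suc k) (f i) t) \<le> L"
      using sup by meson
    obtain r where "strict_mono (r :: nat \<Rightarrow> nat)" "uniformly_Cauchy_on UNIV (\<lambda>i. vderiv k (f (s (r i))))"
      using uniformly_Cauchy_subsequence_periodic [of "\<lambda>i. vderiv k (f (s i))" M L] M
        has_period_vderiv [OF smooth per] vderiv_lipschitz [OF smooth L] by auto
    then show "\<exists>r'. strict_mono r' \<and> uniformly_Cauchy_on UNIV (\<lambda>i. vderiv k (f ((s \<circ> r') i)))"
      by auto
  qed
  \<comment> \<open>the diagonal sequence is a subsequence of the \<open>k\<close>-th one only from index \<open>Suc k\<close> on\<close>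
  have tail: "uniformly_Cauchy_on UNIV (\<lambda>i. vderiv k (f (diagseq (Suc k + i))))" for k
  proof -
    have "uniformly_Cauchy_on UNIV (\<lambda>i. vderiv k (f ((s \<circ> r) i)))"
      if "strict_mono r" "uniformly_Cauchy_on UNIV (\<lambda>i. vderiv k (f (s i)))" for r s :: "nat \<Rightarrow> nat" and k
      using that(2) seq_suble [OF that(1)] unfolding uniformly_Cauchy_on_def o_def
      by (meson order_trans)
    from diagseq_holds [OF this] show ?thesis by simp
  qed
  have "uniformly_Cauchy_on UNIV (\<lambda>i. vderiv k (f (diagseq i)))" for k
  proof (rule uniformly_Cauchy_onI)
    fix e :: real assume "e > 0"
    then obtain N where N: "\<And>t m n. m \<ge> N \<Longrightarrow> n \<ge> N \<Longrightarrow>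
        dist (vderiv k (f (diagseq (Suc k + m))) t) (vderiv k (f (diagseq (Suc k + n))) t) < e"
      using tail [of k] unfolding uniformly_Cauchy_on_def by blast
    have "dist (vderiv k (f (diagseq m)) t) (vderiv k (f (diagseq n)) t) < e"
      if "m \<ge> Suc k + N" "n \<ge> Suc k + N" for m n t
      using N [of "m - Suc k" "n - Suc k" t] that by simp
    then show "\<exists>N. \<forall>t\<in>UNIV. \<forall>m\<ge>N. \<forall>n\<ge>N.
        dist (vderiv k (f (diagseq m)) t) (vderiv k (f (diagseq n)) t) < e" by blast
  qed
  then have "\<exists>g. uniform_limit UNIV (\<lambda>i. vderiv k (f (diagseq i))) g sequentially" for k
    using Cauchy_uniformly_convergent unfolding uniformly_convergent_on_def by blast
  then obtain g where g: "\<And>k. uniform_limit UNIV (\<lambda>i. vderiv k (f (diagseq i))) (g k) sequentially"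
    by metis
  note lim = smooth_uniform_limit [OF smooth g]
  have "has_period 1 (g 0)"
    unfolding has_period_def
  proof
    fix t
    have "(\<lambda>i. f (diagseq i) s) \<longlonglongrightarrow> g 0 s" for s
      using tendsto_uniform_limitI [OF g [of 0]] by simp
    from this [of "t + 1"] this [of t] show "g 0 (t + 1) = g 0 t"
      using per unfolding has_period_def by (metis (no_types, lifting) LIMSEQ_unique ext)
  qed
  then show ?thesis
    using that [of diagseq "g 0"] subseq_diagseq lim g by simp
qed

lemma uniform_limit_l2sq:
  assumes smooth: "\<And>i. smooth_on UNIV (f i)" "smooth_on UNIV g"
    and lim: "uniform_limit UNIV (\<lambda>i. vderiv k (f i)) (vderiv k g) sequentially"
  shows "(\<lambda>i. l2sq (vderiv k (\<lambda>t. f i t - g t))) \<longlonglongrightarrow> 0"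
proof (rule LIMSEQ_I)
  fix e :: real assume e: "e > 0"
  obtain N where N: "\<And>i t. i \<ge> N \<Longrightarrow> dist (vderiv k (f i) t) (vderiv k g t) < sqrt (e / 2)"
    using uniform_limitD [OF lim, of "sqrt (e / 2)"] e by (auto simp: eventually_sequentially)
  have "norm (l2sq (vderiv k (\<lambda>t. f i t - g t)) - 0) < e" if "i \<ge> N" for i
  proof -
    have "l2sq (vderiv k (\<lambda>t. f i t - g t)) \<le> (sqrt (e / 2))\<^sup>2"
      using N [OF that] smooth vderiv_diff [OF smooth(1) smooth(2), of k i]
      by (intro l2sq_le_sup smooth_continuous_on smooth_diff) (auto simp: dist_norm less_imp_le)
    then show ?thesis using e l2sq_nonneg [of "vderiv k (\<lambda>t. f i t - g t)"] by simp
  qed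
  then show "\<exists>N. \<forall>i\<ge>N. norm (l2sq (vderiv k (\<lambda>t. f i t - g t)) - 0) < e" by blast
qed

section \<open>Fourier series of smooth periodic functions\<close>

definition fourier_mode :: "int \<Rightarrow> real \<Rightarrow> complex" where
  "fourier_mode n t = exp (2 * of_real pi * \<i> * of_int n * of_real t)"

lemma fourier_mode_add: "fourier_mode (m + n) t = fourier_mode m t * fourier_mode n t"
  by (simp add: fourier_mode_def exp_add [symmetric] algebra_simps)

lemma fourier_mode_add_right: "fourier_mode n (s + t) = fourier_mode n s * fourier_mode n t"
  by (simp add: fourier_mode_def exp_add [symmetric] algebra_simps)

lemma fourier_mode_zero [simp]: "fourier_mode 0 t = 1" "fourier_mode n 0 = 1"
  by (simp_all add: fourier_mode_def)

lemma fourier_mode_cis: "fourier_mode n t = cis (2 * pi * of_int n * t)"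
  by (simp add: fourier_mode_def cis_conv_exp mult_ac)

lemma norm_fourier_mode [simp]: "norm (fourier_mode n t) = 1"
  by (simp add: fourier_mode_cis)

lemma cnj_fourier_mode: "cnj (fourier_mode n t) = fourier_mode (- n) t"
  by (simp add: fourier_mode_cis cis_cnj)

lemma circle_exp_to_circle: "circle_exp n (to_circle t) = fourier_mode n t"
  by (simp add: circle_exp.abs_eq fourier_mode_def)

lemma to_circle_eq_iff: "to_circle s = to_circle t \<longleftrightarrow> s - t \<in> \<int>"
  by (rule circle.abs_eq_iff)

lemma has_period_circle: "has_period 1 (\<phi> \<circ> to_circle)"
proof -
  have "to_circle (t + 1) = to_circle t" for t
    by (simp add: to_circle_eq_iff)
  then show ?thesis by (simp add: has_period_def)
qed

lemma has_period_fourier_mode: "has_period 1 (fourier_mode n)"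
  using has_period_circle [of "circle_exp n"] by (simp add: circle_exp_to_circle [symmetric] o_def has_period_def)

lemma fourier_mode_eq_1_iff: "fourier_mode 1 t = 1 \<longleftrightarrow> t \<in> \<int>"
proof
  assume "t \<in> \<int>"
  then show "fourier_mode 1 t = 1"
    using has_period_of_int [OF has_period_fourier_mode, of 1 0] by (auto elim!: Ints_cases)
next
  assume "fourier_mode 1 t = 1"
  then obtain n :: int where "2 * pi * t = of_int (2 * n) * pi"
    by (auto simp: fourier_mode_def exp_eq_1)
  then have "t = of_int n" by simp
  then show "t \<in> \<int>" by simp
qed

lemma fourier_mode_has_vector_derivative:
  "(fourier_mode n has_vector_derivative 2 * of_real pi * \<i> * of_int n * fourier_mode n t) (at t)"
  unfolding fourier_mode_def
  by (rule has_vector_derivative_real_field) (auto intro!: derivative_eq_intros)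

lemma vderiv_fourier_mode: "vderiv k (fourier_mode n) = (\<lambda>t. (2 * of_real pi * \<i> * of_int n) ^ k * fourier_mode n t)"
proof (induction k)
  case (Suc k)
  have "((\<lambda>t. (2 * of_real pi * \<i> * of_int n) ^ k * fourier_mode n t) has_vector_derivative
      (2 * of_real pi * \<i> * of_int n) ^ k * (2 * of_real pi * \<i> * of_int n * fourier_mode n t)) (at t)" for t
    by (intro has_vector_derivative_mult_right fourier_mode_has_vector_derivative)
  then show ?case
    by (subst vderiv_Suc) (auto simp: Suc mult_ac intro!: vector_derivative_at)
qed simp

lemma smooth_fourier_mode: "smooth_on UNIV (fourier_mode n)"
  unfolding smooth_on_def vderiv_fourier_mode
  by (intro allI ballI)
     (rule differentiableI_vector [OF has_vector_derivative_mult_right [OF fourier_mode_has_vector_derivative]])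

lemma continuous_on_fourier_mode: "continuous_on S (fourier_mode n)"
  using smooth_continuous_on [OF smooth_fourier_mode, of S 0 n] by simp

definition fourier_coeff :: "(real \<Rightarrow> complex) \<Rightarrow> int \<Rightarrow> complex" where
  "fourier_coeff f n = integral {0..1} (\<lambda>t. f t * fourier_mode (- n) t)"

lemma fourier_coeff_has_integral:
  assumes "continuous_on UNIV f"
  shows "((\<lambda>t. f t * fourier_mode (- n) t) has_integral fourier_coeff f n) {0..1}"
  unfolding fourier_coeff_def
  by (intro integrable_integral integrable_continuous_real continuous_on_mult continuous_on_fourier_mode
      continuous_on_subset [OF assms]) auto

lemma fourier_coeff_unique:
  "((\<lambda>t. f t * fourier_mode (- n) t) has_integral c) {0..1} \<Longrightarrow> fourier_coeff f n = c"
  by (simp add: fourier_coeff_def integral_unique)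

lemma fourier_coeff_diff:
  assumes "continuous_on UNIV f" "continuous_on UNIV g"
  shows "fourier_coeff (\<lambda>t. f t - g t) n = fourier_coeff f n - fourier_coeff g n"
  using has_integral_diff [OF assms [THEN fourier_coeff_has_integral]]
  by (intro fourier_coeff_unique) (simp add: left_diff_distrib)

lemma fourier_coeff_mode_mult:
  "fourier_coeff (\<lambda>t. fourier_mode m t * f t) n = fourier_coeff f (n - m)"
  unfolding fourier_coeff_def
  by (intro arg_cong [where f = "integral {0..1}"])
     (auto simp: fourier_mode_add [symmetric] mult.assoc mult.left_commute [of _ "f _"] add.commute)

lemma fourier_coeff_vderiv_1:
  assumes f: "smooth_on UNIV f" and per: "has_period 1 f"
  shows "fourier_coeff (vderiv 1 f) n = 2 * of_real pi * \<i> * of_int n * fourier_coeff f n"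
proof -
  let ?c = "2 * of_real pi * \<i> * of_int n"
  let ?u = "\<lambda>t. f t * fourier_mode (- n) t"
  have cont: "continuous_on UNIV f" "continuous_on UNIV (vderiv 1 f)"
    using smooth_continuous_on [OF f, of UNIV 0] smooth_continuous_on [OF f, of UNIV 1] by simp_all
  have d: "(?u has_vector_derivative vderiv 1 f t * fourier_mode (- n) t - ?c * ?u t) (at t)" for t
  proof -
    have "(?u has_vector_derivative f t * (2 * of_real pi * \<i> * of_int (- n) * fourier_mode (- n) t)
        + vderiv 1 f t * fourier_mode (- n) t) (at t)"
      by (rule has_vector_derivative_mult [OF smooth_has_vderiv_1 [OF f] fourier_mode_has_vector_derivative])
    also have "f t * (2 * of_real pi * \<i> * of_int (- n) * fourier_mode (- n) t)
        + vderiv 1 f t * fourier_mode (- n) t = vderiv 1 f t * fourier_mode (- n) t - ?c * ?u t"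
      by (simp add: right_diff_distrib mult_ac)
    finally show ?thesis .
  qed
  then have "((\<lambda>t. vderiv 1 f t * fourier_mode (- n) t - ?c * ?u t) has_integral ?u 1 - ?u 0) {0..1}"
    by (rule fundamental_theorem_of_calculus [OF zero_le_one has_vector_derivative_at_within])
  moreover have "?u 1 = ?u 0"
    using has_period_of_int [OF per, of 0 1] has_period_of_int [OF has_period_fourier_mode, of "- n" 0 1] by simp
  moreover have "((\<lambda>t. vderiv 1 f t * fourier_mode (- n) t - ?c * ?u t) has_integral
      fourier_coeff (vderiv 1 f) n - ?c * fourier_coeff f n) {0..1}"
    by (rule has_integral_diff [OF fourier_coeff_has_integral [OF cont(2)]
          has_integral_mult_right [OF fourier_coeff_has_integral [OF cont(1)]]])
  ultimately have "?u 1 - ?u 0 = fourier_coeff (vderiv 1 f) n - ?c * fourier_coeff f n"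
    by (rule_tac has_integral_unique)
  with \<open>?u 1 = ?u 0\<close> show ?thesis by simp
qed

lemma fourier_coeff_vderiv:
  assumes f: "smooth_on UNIV f" and per: "has_period 1 f"
  shows "fourier_coeff (vderiv k f) n = (2 * of_real pi * \<i> * of_int n) ^ k * fourier_coeff f n"
proof (induction k)
  case (Suc k)
  have "vderiv (Suc k) f = vderiv 1 (vderiv k f)"
    by (simp add: vderiv_vderiv)
  then show ?case
    using fourier_coeff_vderiv_1 [OF smooth_vderiv [OF f] has_period_vderiv [OF f per], of k n] Suc by simp
qed simp

lemma fourier_coeff_fourier_mode: "fourier_coeff (fourier_mode m) n = (if m = n then 1 else 0)"
proof -
  have "fourier_coeff (\<lambda>t. 1) k = (if k = 0 then 1 else 0)" for k
    using fourier_coeff_vderiv_1 [of "\<lambda>t. 1" k] vderiv_eqI [of "\<lambda>t. 1 :: complex" "\<lambda>t. 0"]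
    by (auto simp: has_period_def fourier_coeff_def)
  then show ?thesis
    using fourier_coeff_mode_mult [of m "\<lambda>t. 1" n] by auto
qed

definition fourier_sum :: "int set \<Rightarrow> (real \<Rightarrow> complex) \<Rightarrow> real \<Rightarrow> complex" where
  "fourier_sum N f = (\<lambda>t. \<Sum>n\<in>N. fourier_coeff f n * fourier_mode n t)"

lemma smooth_fourier_sum: "smooth_on UNIV (fourier_sum N f)"
  unfolding fourier_sum_def by (intro smooth_sum smooth_cmult smooth_fourier_mode)

lemma has_period_fourier_sum: "has_period 1 (fourier_sum N f)"
  using has_period_fourier_mode by (simp add: fourier_sum_def has_period_def)

lemma continuous_on_fourier_sum: "continuous_on S (fourier_sum N f)"
  using smooth_continuous_on [OF smooth_fourier_sum, of S 0 N f] by simp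

lemma vderiv_fourier_sum:
  assumes "smooth_on UNIV f" "has_period 1 f"
  shows "vderiv k (fourier_sum N f) = fourier_sum N (vderiv k f)"
  unfolding fourier_sum_def
  by (simp add: vderiv_sum smooth_cmult smooth_fourier_mode vderiv_cmult vderiv_fourier_mode
      fourier_coeff_vderiv [OF assms] mult_ac)

lemma fourier_coeff_fourier_sum:
  assumes "finite N"
  shows "fourier_coeff (fourier_sum N f) n = (if n \<in> N then fourier_coeff f n else 0)"
proof -
  have "((\<lambda>t. \<Sum>m\<in>N. fourier_coeff f m * (fourier_mode m t * fourier_mode (- n) t)) has_integral
      (\<Sum>m\<in>N. fourier_coeff f m * fourier_coeff (fourier_mode m) n)) {0..1}"
    by (intro has_integral_sum assms has_integral_mult_right fourier_coeff_has_integral continuous_on_fourier_mode)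
  then have "fourier_coeff (fourier_sum N f) n = (\<Sum>m\<in>N. fourier_coeff f m * fourier_coeff (fourier_mode m) n)"
    by (intro fourier_coeff_unique) (simp add: fourier_sum_def sum_distrib_right mult.assoc)
  also have "\<dots> = (\<Sum>m\<in>N. if m = n then fourier_coeff f m else 0)"
    by (intro sum.cong) (auto simp: fourier_coeff_fourier_mode)
  finally show ?thesis using assms by simp
qed

text \<open>Pythagoras for the orthogonal projection onto the modes in \<open>N\<close>.\<close>

lemma l2sq_minus_fourier_sum:
  assumes "finite N" and f: "continuous_on UNIV f"
  shows "l2sq (\<lambda>t. f t - fourier_sum N f t) = l2sq f - (\<Sum>n\<in>N. (norm (fourier_coeff f n))\<^sup>2)"
proof -
  let ?S = "fourier_sum N f"
  have S: "((\<lambda>t. g t * cnj (?S t)) has_integral (\<Sum>n\<in>N. cnj (fourier_coeff f n) * fourier_coeff g n)) {0..1}"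
    if g: "continuous_on UNIV g" for g
  proof -
    have "((\<lambda>t. \<Sum>n\<in>N. cnj (fourier_coeff f n) * (g t * fourier_mode (- n) t)) has_integral
        (\<Sum>n\<in>N. cnj (fourier_coeff f n) * fourier_coeff g n)) {0..1}"
      by (intro has_integral_sum assms has_integral_mult_right fourier_coeff_has_integral g)
    then show ?thesis
      by (simp add: fourier_sum_def cnj_fourier_mode sum_distrib_left mult_ac)
  qed
  let ?B = "\<Sum>n\<in>N. (norm (fourier_coeff f n))\<^sup>2"
  have B: "Re (\<Sum>n\<in>N. cnj (fourier_coeff f n) * fourier_coeff g n) = ?B"
    if "\<And>n. n \<in> N \<Longrightarrow> fourier_coeff g n = fourier_coeff f n" for g
    using that by (simp add: mult.commute [of "cnj _"] complex_norm_square [symmetric] flip: of_real_power)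
  have i1: "((\<lambda>t. Re (f t * cnj (?S t))) has_integral ?B) {0..1}"
    using has_integral_Re [OF S [OF f]] B [of f] by (simp only:)
  have "Re (\<Sum>n\<in>N. cnj (fourier_coeff f n) * fourier_coeff ?S n) = ?B"
    by (rule B) (simp add: fourier_coeff_fourier_sum [OF assms(1)])
  then have i2: "((\<lambda>t. Re (?S t * cnj (?S t))) has_integral ?B) {0..1}"
    using has_integral_Re [OF S [OF continuous_on_fourier_sum [of UNIV N f]]] by (simp only:)
  have "((\<lambda>t. (norm (f t))\<^sup>2 - 2 * Re (f t * cnj (?S t)) + Re (?S t * cnj (?S t))) has_integral
      l2sq f - 2 * ?B + ?B) {0..1}"
    unfolding l2sq_def
    by (rule has_integral_add [OF has_integral_diff [OF integrable_integral [OF integrable_norm_sq [OF f]]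
          has_integral_mult_right [OF i1]] i2])
  moreover have "(norm (f t))\<^sup>2 - 2 * Re (f t * cnj (?S t)) + Re (?S t * cnj (?S t)) = (norm (f t - ?S t))\<^sup>2" for t
    unfolding cmod_power2 by (simp add: power2_eq_square algebra_simps)
  ultimately have "((\<lambda>t. (norm (f t - ?S t))\<^sup>2) has_integral l2sq f - ?B) {0..1}"
    by simp
  then show ?thesis
    by (simp add: l2sq_def integral_unique)
qed

lemma l2sq_minus_fourier_sum_le:
  assumes "finite N" "continuous_on UNIV f"
  shows "l2sq (\<lambda>t. f t - fourier_sum N f t) \<le> l2sq f"
  using l2sq_minus_fourier_sum [OF assms] by (simp add: sum_nonneg)

lemma bessel_inequality:
  assumes "finite N" "continuous_on UNIV f"
  shows "(\<Sum>n\<in>N. (norm (fourier_coeff f n))\<^sup>2) \<le> l2sq f"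
  using l2sq_minus_fourier_sum [OF assms] l2sq_nonneg [of "\<lambda>t. f t - fourier_sum N f t"] by simp

text \<open>The consequence of Bessel's inequality that replaces the Riemann-Lebesgue lemma below.\<close>

lemma constant_fourier_coeff_zero:
  assumes f: "continuous_on UNIV f" and N: "infinite N" "\<And>n. n \<in> N \<Longrightarrow> fourier_coeff f n = c"
  shows "c = 0"
proof (rule ccontr)
  assume "c \<noteq> 0"
  then obtain k :: nat where k: "real k * (norm c)\<^sup>2 > l2sq f"
    using reals_Archimedean3 [of "(norm c)\<^sup>2"] by auto
  obtain A where A: "A \<subseteq> N" "finite A" "card A = k"
    using infinite_arbitrarily_large [OF N(1)] by metis
  have "(\<Sum>n\<in>A. (norm (fourier_coeff f n))\<^sup>2) = real k * (norm c)\<^sup>2"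
    using A N(2) by (simp add: subset_iff)
  then show False using bessel_inequality [OF A(2) f] k by simp
qed

text \<open>Since \<open>g\<close> is differentiable at \<open>0\<close>, the quotient \<open>h = (g - g 0) / (e - 1)\<close> with \<open>e = fourier_mode 1\<close>
extends continuously over the integers. Multiplication by \<open>e\<close> shifts Fourier coefficients, so the relation
\<open>g - g 0 = e h - h\<close> and the vanishing of the coefficients of \<open>g\<close> make the coefficients of \<open>h\<close> constant on \<open>n \<ge> 0\<close> and on \<open>n < 0\<close>, with a jump \<open>g 0\<close> in
between. Both constants vanish by Bessel's inequality.\<close>

lemma zero_fourier_coeffs_imp_zero_at_0:
  fixes g :: "real \<Rightarrow> complex"
  assumes cont: "continuous_on UNIV g" and per: "has_period 1 g"
    and diff: "(g has_vector_derivative g') (at 0)"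
    and coeff: "\<And>n. fourier_coeff g n = 0"
  shows "g 0 = 0"
proof -
  define h where "h t = (if t \<in> \<int> then g' / (2 * of_real pi * \<i>) else (g t - g 0) / (fourier_mode 1 t - 1))" for t
  have hper: "has_period 1 h"
    using per has_period_fourier_mode [of 1] by (auto simp: has_period_def h_def dest: Ints_diff [OF _ Ints_1])
  have "isCont h 0"
  proof -
    have q: "((\<lambda>t. (u t - u 0) / of_real t) \<longlongrightarrow> u') (at 0)"
      if "(u has_vector_derivative u') (at 0)" for u :: "real \<Rightarrow> complex" and u'
    proof -
      have "((\<lambda>t. norm (u t - u 0 - t *\<^sub>R u') / norm t) \<longlongrightarrow> 0) (at 0)"
        using that by (simp add: has_vector_derivative_def has_derivative_at)
      moreover have "\<forall>\<^sub>F t in at 0. norm (u t - u 0 - t *\<^sub>R u') / norm t = norm ((u t - u 0) / of_real t - u')"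
        using eventually_neq_at_within [of "0::real"]
      proof eventually_elim
        case (elim t)
        then have "u t - u 0 - t *\<^sub>R u' = of_real t * ((u t - u 0) / of_real t - u')"
          by (simp add: scaleR_conv_of_real field_simps)
        then show ?case using elim by (simp add: norm_mult)
      qed
      ultimately have "((\<lambda>t. norm ((u t - u 0) / of_real t - u')) \<longlongrightarrow> 0) (at 0)"
        by (rule Lim_transform_eventually)
      then show ?thesis by (rule LIM_zero_cancel [OF tendsto_norm_zero_cancel])
    qed
    have "((\<lambda>t. ((g t - g 0) / of_real t) / ((fourier_mode 1 t - fourier_mode 1 0) / of_real t)) \<longlongrightarrow>
        g' / (2 * of_real pi * \<i>)) (at 0)"
      using q [OF diff] q [OF fourier_mode_has_vector_derivative [of 1]] by (intro tendsto_divide) auto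
    moreover have "\<forall>\<^sub>F t in at 0. ((g t - g 0) / of_real t) / ((fourier_mode 1 t - fourier_mode 1 0) / of_real t) = h t"
    proof -
      have "\<forall>\<^sub>F t in at (0::real). t \<in> {- 1<..<1} - {0}"
        by (rule eventually_at_in_open) auto
      then show ?thesis
        by eventually_elim (auto simp: h_def elim!: Ints_cases)
    qed
    ultimately have "(h \<longlongrightarrow> g' / (2 * of_real pi * \<i>)) (at 0)"
      using tendsto_cong by fast
    then show ?thesis by (simp add: isCont_def h_def)
  qed
  have "isCont h t" for t
  proof (cases "t \<in> \<int>")
    case True
    then obtain n where n: "t = of_int n" by (rule Ints_cases)
    have "h = (\<lambda>s. h (s - of_int n))"
      using has_period_of_int [OF hper, of _ "- n"] by auto
    moreover have "isCont (\<lambda>s. h (s - of_int n)) t"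
      using \<open>isCont h 0\<close> n by (intro isCont_o2 [of t "\<lambda>s. s - of_int n" h]) auto
    ultimately show ?thesis by metis
  next
    case False
    have "continuous_on (- \<int>) (\<lambda>t. (g t - g 0) / (fourier_mode 1 t - 1))"
      by (intro continuous_intros continuous_on_fourier_mode continuous_on_subset [OF cont])
         (auto simp: fourier_mode_eq_1_iff)
    then have "continuous_on (- \<int>) h"
      by (rule continuous_on_eq) (simp add: h_def)
    then show ?thesis
      using False closed_Ints continuous_on_eq_continuous_at [of "- \<int>" h] by (auto simp: open_Compl)
  qed
  then have hcont: "continuous_on UNIV h"
    by (simp add: continuous_at_imp_continuous_on)
  have gh: "(\<lambda>t. g t - g 0) = (\<lambda>t. fourier_mode 1 t * h t - h t)"
  proof
    fix t show "g t - g 0 = fourier_mode 1 t * h t - h t"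
    proof (cases "t \<in> \<int>")
      case True
      then show ?thesis
        using has_period_of_int [OF per, of 0] fourier_mode_eq_1_iff [of t] by (auto elim!: Ints_cases)
    next
      case False
      then have "h t * (fourier_mode 1 t - 1) = g t - g 0"
        using fourier_mode_eq_1_iff [of t] by (simp add: h_def)
      then show ?thesis by (simp add: right_diff_distrib mult.commute)
    qed
  qed
  \<comment> \<open>the coefficients of \<open>h\<close> jump only between \<open>- 1\<close> and \<open>0\<close>\<close>
  have rel: "fourier_coeff h (n - 1) - fourier_coeff h n = (if n = 0 then - g 0 else 0)" for n
  proof -
    have "fourier_coeff (\<lambda>t. fourier_mode 1 t * h t - h t) n = fourier_coeff h (n - 1) - fourier_coeff h n"
      using fourier_coeff_diff [of "\<lambda>t. fourier_mode 1 t * h t" h n] fourier_coeff_mode_mult [of 1 h n] hcont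
      by (simp add: continuous_on_mult continuous_on_fourier_mode)
    moreover have "fourier_coeff (\<lambda>t. g t - g 0) n = - fourier_coeff (\<lambda>t. g 0) n"
      using fourier_coeff_diff [OF cont, of "\<lambda>t. g 0" n] coeff by simp
    moreover have "fourier_coeff (\<lambda>t. g 0) n = g 0 * fourier_coeff (fourier_mode 0) n"
      by (simp add: fourier_coeff_def)
    ultimately show ?thesis
      using gh by (simp add: fourier_coeff_fourier_mode)
  qed
  have pos: "fourier_coeff h (int n) = fourier_coeff h 0" for n
  proof (induction n)
    case (Suc n)
    then show ?case using rel [of "int (Suc n)"] by simp
  qed simp
  have neg: "fourier_coeff h (- 1 - int n) = fourier_coeff h (- 1)" for n
  proof (induction n)
    case (Suc n)
    then show ?case using rel [of "- 1 - int n"] by (simp add: algebra_simps)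
  qed simp
  have "infinite (range int)" "infinite (range (\<lambda>n. - 1 - int n))"
    by (auto intro!: range_inj_infinite injI)
  then have "fourier_coeff h 0 = 0" "fourier_coeff h (- 1) = 0"
    using constant_fourier_coeff_zero [OF hcont] pos neg by (metis (no_types, lifting) imageE)+
  then show ?thesis using rel [of 0] by simp
qed

text \<open>A translation multiplies the Fourier coefficients by numbers of modulus one, so every point can be moved to the origin.\<close>

lemma fourier_uniqueness:
  assumes g: "smooth_on UNIV g" and per: "has_period 1 g" and coeff: "\<And>n. fourier_coeff g n = 0"
  shows "g t = 0"
proof -
  have cont: "continuous_on UNIV g"
    using smooth_continuous_on [OF g, of UNIV 0] by simp
  have gt: "smooth_on UNIV (\<lambda>s. g (s + t))" by (rule smooth_shift [OF g])
  have "fourier_coeff (\<lambda>s. g (s + t)) n = 0" for n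
  proof -
    let ?u = "\<lambda>s. g s * fourier_mode (- n) s"
    have "?u (s + t) = fourier_mode (- n) t * (g (s + t) * fourier_mode (- n) s)" for s
      by (simp add: fourier_mode_add_right)
    then have "integral {0..1} (\<lambda>s. ?u (s + t)) = fourier_mode (- n) t * fourier_coeff (\<lambda>s. g (s + t)) n"
      unfolding fourier_coeff_def by (simp only: integral_mult_right)
    then have "fourier_mode (- n) t * fourier_coeff (\<lambda>s. g (s + t)) n = integral {0..1} (\<lambda>s. ?u (s + t))"
      by simp
    also have "\<dots> = integral {t..t+1} ?u"
      using integral_shift_real_ivl [of t t "t + 1" ?u] by simp
    also have "\<dots> = integral {0..1} ?u"
      using per has_period_fourier_mode [of "- n"]
      by (intro integral_shift_period continuous_on_mult cont continuous_on_fourier_mode) (simp add: has_period_def)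
    also have "\<dots> = 0"
      using coeff [of n] by (simp add: fourier_coeff_def)
    finally show ?thesis
      by (metis mult_eq_0_iff norm_fourier_mode norm_zero zero_neq_one)
  qed
  moreover have "has_period 1 (\<lambda>s. g (s + t))"
    using per unfolding has_period_def by (metis add.assoc add.commute)
  ultimately have "g (0 + t) = 0"
    using smooth_continuous_on [OF gt, of UNIV 0] smooth_has_vderiv_1 [OF gt]
    by (intro zero_fourier_coeffs_imp_zero_at_0 [of "\<lambda>s. g (s + t)"]) auto
  then show ?thesis by simp
qed

text \<open>The remainders have \<open>L\<^sup>2\<close> bounded derivatives, because the partial sums are orthogonal projections that
commute with differentiation. Hence a subsequence converges with all its derivatives, and all Fourier
coefficients of the limit are zero. Convergence along a subsequence suffices for density.\<close>

theorem fourier_sums_converge_smoothly: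
  assumes f: "smooth_on UNIV f" and per: "has_period 1 f"
  obtains r where "strict_mono (r :: nat \<Rightarrow> nat)"
    "\<And>k. (\<lambda>i. l2sq (vderiv k (\<lambda>t. f t - fourier_sum {- int (r i)..int (r i)} f t))) \<longlonglongrightarrow> 0"
proof -
  define R where "R i = (\<lambda>t. f t - fourier_sum {- int i..int i} f t)" for i
  have R: "smooth_on UNIV (R i)" "has_period 1 (R i)" for i
    using smooth_diff [OF f smooth_fourier_sum] per has_period_fourier_sum
    by (auto simp: R_def has_period_def)
  have "l2sq (vderiv k (R i)) \<le> l2sq (vderiv k f)" for k i
    unfolding R_def vderiv_diff [OF f smooth_fourier_sum] vderiv_fourier_sum [OF f per]
    by (intro l2sq_minus_fourier_sum_le smooth_continuous_on f) simp
  then obtain r g where r: "strict_mono r" and g: "smooth_on UNIV g" "has_period 1 g"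
    and lim: "\<And>k. uniform_limit UNIV (\<lambda>i. vderiv k (R (r i))) (vderiv k g) sequentially"
    using smooth_periodic_montel [of R] R by metis
  have cont: "continuous_on UNIV f" "continuous_on UNIV g" "continuous_on UNIV (R i)" for i
    using smooth_continuous_on [OF f, of UNIV 0] smooth_continuous_on [OF g(1), of UNIV 0]
      smooth_continuous_on [OF R(1), of UNIV 0] by simp_all
  have "fourier_coeff g n = 0" for n
  proof -
    have "uniform_limit {0..1} (\<lambda>i t. R (r i) t * fourier_mode (- n) t) (\<lambda>t. g t * fourier_mode (- n) t) sequentially"
    proof (rule uniform_limitI)
      fix e :: real assume "e > 0"
      then have "\<forall>\<^sub>F i in sequentially. \<forall>t\<in>UNIV. dist (R (r i) t) (g t) < e"
        using uniform_limitD [OF lim [of 0]] by simp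
      then show "\<forall>\<^sub>F i in sequentially. \<forall>t\<in>{0..1}.
          dist (R (r i) t * fourier_mode (- n) t) (g t * fourier_mode (- n) t) < e"
        by eventually_elim (simp add: dist_norm norm_mult flip: left_diff_distrib)
    qed
    moreover have "continuous_on {0..1} (\<lambda>t. R (r i) t * fourier_mode (- n) t)" for i
      by (intro continuous_on_mult continuous_on_fourier_mode continuous_on_subset [OF cont(3)]) simp
    ultimately obtain I J where "\<And>i. ((\<lambda>t. R (r i) t * fourier_mode (- n) t) has_integral I i) {0..1}"
        "((\<lambda>t. g t * fourier_mode (- n) t) has_integral J) {0..1}" "I \<longlonglongrightarrow> J"
      by (rule uniform_limit_integral) (use sequentially_bot in auto)
    moreover from this have "fourier_coeff g n = J" "fourier_coeff (R (r i)) n = I i" for i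
      by (auto intro: fourier_coeff_unique)
    ultimately have "(\<lambda>i. fourier_coeff (R (r i)) n) \<longlonglongrightarrow> fourier_coeff g n"
      by simp
    moreover have "\<forall>\<^sub>F i in sequentially. fourier_coeff (R (r i)) n = 0"
      unfolding eventually_sequentially
    proof (intro exI allI impI)
      fix i assume "nat \<bar>n\<bar> \<le> i"
      then have "n \<in> {- int (r i)..int (r i)}"
        using seq_suble [OF r, of i] by auto
      then show "fourier_coeff (R (r i)) n = 0"
        unfolding R_def using fourier_coeff_diff [OF cont(1) continuous_on_fourier_sum]
        by (simp add: fourier_coeff_fourier_sum)
    qed
    then have "(\<lambda>i. fourier_coeff (R (r i)) n) \<longlonglongrightarrow> 0"
      by (rule tendsto_eventually)
    ultimately show ?thesis
      by (rule LIMSEQ_unique)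
  qed
  then have "g = (\<lambda>t. 0)"
    using fourier_uniqueness [OF g] by blast
  then have "(\<lambda>i. l2sq (vderiv k (R (r i)))) \<longlonglongrightarrow> 0" for k
    using uniform_limit_l2sq [of "\<lambda>i. R (r i)" g k] R g lim by simp
  then show ?thesis using that [of r] r unfolding R_def by simp
qed

section \<open>The lift of an expanding circle map\<close>

lemma to_circle_surj: obtains t where "x = to_circle t"
  by (metis Quotient3_abs_rep Quotient3_circle)

text \<open>Two lifts of the same map differ by an integer-valued function; continuity at the single point \<open>t\<close> already
makes it locally constant. This is used where one of the lifts is only known to be differentiable at \<open>t\<close>.\<close>

lemma integer_valued_near_constant:
  fixes g :: "real \<Rightarrow> real"
  assumes "isCont g t" and "\<forall>\<^sub>F s in nhds t. g s \<in> \<int>"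
  shows "\<forall>\<^sub>F s in nhds t. g s = g t"
proof -
  have t: "g t \<in> \<int>" using assms(2) by (rule eventually_nhds_x_imp_x)
  have "\<forall>\<^sub>F s in nhds t. dist (g s) (g t) < 1"
    using assms(1) by (intro tendstoD) (auto simp: isCont_def tendsto_at_iff_tendsto_nhds)
  then show ?thesis
    using assms(2)
  proof eventually_elim
    case (elim s)
    then show ?case using t by (metis Ints_eq_abs_less1 dist_real_def)
  qed
qed

text \<open>Up to the factor \<open>2 * pi\<close>, the lift is the argument of \<open>exp (2 \<pi> i T t)\<close>. This nowhere vanishing function of \<open>t\<close> has a
continuous logarithm because the line is contractible. Near each point it differs from a given smooth lift by a constant,
so it is smooth.\<close>

lemma circle_map_lift:
  assumes T: "smooth_circle_map T"
  obtains F where "smooth_on UNIV F" "\<And>t. T (to_circle t) = to_circle (F t)"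
proof -
  define u where "u t = circle_exp 1 (T (to_circle t))" for t
  have chart: "\<exists>U f. open U \<and> t \<in> U \<and> smooth_on U f \<and> (\<forall>s\<in>U. T (to_circle s) = to_circle (f s))" for t
    using T by (auto simp: smooth_circle_map_def)
  have chart_cont: "isCont f s" if "smooth_on U f" "s \<in> U" for U and f :: "real \<Rightarrow> real" and s
  proof -
    have "vderiv 0 f differentiable (at s)" using that unfolding smooth_on_def by blast
    then show ?thesis by (simp add: differentiable_imp_continuous_within)
  qed
  have "isCont u t" for t
  proof -
    obtain U f where U: "open U" "t \<in> U" "smooth_on U f" "\<And>s. s \<in> U \<Longrightarrow> T (to_circle s) = to_circle (f s)"
      using chart [of t] by auto
    have "isCont (fourier_mode 1) (f t)"
      using continuous_on_fourier_mode [of UNIV 1] by (simp add: continuous_on_eq_continuous_at)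
    then have "isCont (\<lambda>s. fourier_mode 1 (f s)) t"
      by (rule isCont_o2 [OF chart_cont [OF U(3,2)]])
    moreover have "\<forall>\<^sub>F s in nhds t. u s = fourier_mode 1 (f s)"
      by (rule eventually_mono [OF eventually_nhds_in_open [OF U(1,2)]])
         (simp add: u_def U(4) circle_exp_to_circle)
    ultimately show ?thesis by (simp add: isCont_cong)
  qed
  then have "continuous_on UNIV u" by (simp add: continuous_at_imp_continuous_on)
  moreover have "u t \<noteq> 0" for t
    using to_circle_surj [of "T (to_circle t)"] norm_fourier_mode
    by (metis circle_exp_to_circle norm_zero u_def zero_neq_one)
  ultimately obtain g where g: "continuous_on UNIV g" "\<And>t. u t = exp (g t)"
    using continuous_logarithm_on_contractible [of UNIV u] by auto
  define F where "F t = Im (g t) / (2 * pi)" for t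
  have lift: "T (to_circle t) = to_circle (F t)" for t
  proof -
    obtain r where r: "T (to_circle t) = to_circle r" by (rule to_circle_surj)
    then have e: "fourier_mode 1 r = exp (g t)"
      using g(2) [of t] by (simp add: u_def circle_exp_to_circle)
    then have "exp (Re (g t)) = 1"
      using norm_fourier_mode [of 1 r] by (simp add: norm_exp_eq_Re)
    then have "exp (g t) = fourier_mode 1 (F t)"
      by (simp add: fourier_mode_cis F_def exp_eq_polar)
    then have "fourier_mode 1 (F t) * fourier_mode 1 (r - F t) = fourier_mode 1 (F t) * 1"
      using e fourier_mode_add_right [of 1 "F t" "r - F t"] by simp
    then have "r - F t \<in> \<int>"
      using fourier_mode_eq_1_iff [of "r - F t"] norm_fourier_mode [of 1 "F t"] by (metis mult_left_cancel norm_zero zero_neq_one)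
    then show ?thesis using r by (simp add: to_circle_eq_iff)
  qed
  have contF: "isCont F t" for t
    unfolding F_def using g(1) by (intro continuous_intros) (auto simp: continuous_on_eq_continuous_at)
  have "smooth_on UNIV F"
  proof (rule smooth_local)
    fix t
    obtain U f where U: "open U" "t \<in> U" "smooth_on U f" "\<And>s. s \<in> U \<Longrightarrow> T (to_circle s) = to_circle (f s)"
      using chart [of t] by auto
    have "isCont (\<lambda>s. F s - f s) t"
      by (intro continuous_intros contF chart_cont [OF U(3,2)])
    moreover have "\<forall>\<^sub>F s in nhds t. F s - f s \<in> \<int>"
      by (rule eventually_mono [OF eventually_nhds_in_open [OF U(1,2)]])
         (simp add: lift [symmetric] U(4) [symmetric] flip: to_circle_eq_iff)
    ultimately have "\<forall>\<^sub>F s in nhds t. F s - f s = F t - f t"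
      by (rule integer_valued_near_constant)
    then obtain V where V: "open V" "t \<in> V" "\<And>s. s \<in> V \<Longrightarrow> F s - f s = F t - f t"
      unfolding eventually_nhds by blast
    have "smooth_on (U \<inter> V) f" using U(3) by (auto simp: smooth_on_def)
    moreover have "\<forall>s\<in>U \<inter> V. F s = f s + (F t - f t)" using V(3) by (auto simp: algebra_simps)
    ultimately show "\<exists>U f c. open U \<and> t \<in> U \<and> smooth_on U f \<and> (\<forall>s\<in>U. F s = f s + c)"
      using U(1,2) V(1,2) by (metis IntI open_Int)
  qed
  then show ?thesis using that lift by blast
qed

lemma lift_degree:
  assumes F: "continuous_on UNIV F" "\<And>t. T (to_circle t) = to_circle (F t)"
  obtains d :: int where "\<And>t. F (t + 1) = F t + of_int d"
proof -
  have Z: "F (t + 1) - F t \<in> \<int>" for t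
  proof -
    have "to_circle (t + 1) = to_circle t" by (simp add: to_circle_eq_iff)
    then show ?thesis using F(2) by (metis to_circle_eq_iff)
  qed
  have "(\<lambda>t. F (t + 1) - F t) constant_on UNIV"
  proof (rule continuous_discrete_range_constant)
    show "continuous_on UNIV (\<lambda>t. F (t + 1) - F t)"
      by (intro continuous_on_diff F(1) continuous_on_compose2 [OF F(1)] continuous_intros) auto
    fix x :: real
    show "\<exists>e>0. \<forall>y. y \<in> UNIV \<and> F (y + 1) - F y \<noteq> F (x + 1) - F x \<longrightarrow>
        e \<le> norm (F (y + 1) - F y - (F (x + 1) - F x))"
      using Z by (intro exI [of _ 1]) (metis Ints_eq_abs_less1 linorder_not_le real_norm_def zero_less_one)
  qed auto
  then obtain a where a: "\<And>t. F (t + 1) - F t = a" by (auto simp: constant_on_def)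
  then obtain d :: int where "a = of_int d" using Z by (metis Ints_cases)
  then show ?thesis using that a by (metis add.commute diff_add_cancel)
qed

lemma has_period_deriv:
  fixes F :: "real \<Rightarrow> real"
  assumes F: "smooth_on UNIV F" "\<And>t. F (t + 1) = F t + c"
  shows "has_period 1 (vderiv 1 F)"
proof -
  have "vderiv 1 (\<lambda>t. F (t + 1)) = vderiv 1 (\<lambda>t. F t + c)"
    using F(2) by simp
  moreover have "vderiv 1 (\<lambda>t. F (t + 1)) = (\<lambda>t. vderiv 1 F (t + 1))"
    by (rule vderiv_shift [OF F(1)])
  moreover have "vderiv 1 (\<lambda>t. F t + c) = vderiv 1 F"
    by (rule vderiv_eqI) (simp add: has_vector_derivative_add_const smooth_has_vderiv_1 [OF F(1)] del: One_nat_def)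
  ultimately show ?thesis
    unfolding has_period_def by metis
qed

lemma has_period_deriv_lift:
  assumes F: "smooth_on UNIV F" "\<And>t. T (to_circle t) = to_circle (F t)"
  shows "has_period 1 (vderiv 1 F)"
proof -
  obtain d :: int where "\<And>t. F (t + 1) = F t + of_int d"
    using lift_degree [of F T] smooth_continuous_on [OF F(1), of UNIV 0] F(2) by auto
  then show ?thesis by (rule has_period_deriv [OF F(1)])
qed

text \<open>The derivative of a circle map is defined through arbitrary local lifts, so this is the statement that it is
well defined.\<close>

lemma circle_deriv_lift:
  assumes F: "smooth_on UNIV F" "\<And>t. T (to_circle t) = to_circle (F t)"
  shows "circle_deriv T (to_circle s) = vderiv 1 F s"
  unfolding circle_deriv_def
proof (rule the_equality)
  have dF: "(F has_real_derivative vderiv 1 F t) (at t)" for t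
    using smooth_has_vderiv_1 [OF F(1)] by (simp add: has_real_derivative_iff_has_vector_derivative)
  show "has_circle_derivative T (vderiv 1 F s) (to_circle s)"
    using F(2) dF unfolding has_circle_derivative_def by (intro exI [of _ s] exI [of _ F]) auto
  fix D assume "has_circle_derivative T D (to_circle s)"
  then obtain t f where tf: "to_circle s = to_circle t" "\<forall>\<^sub>F s in nhds t. T (to_circle s) = to_circle (f s)"
      "(f has_real_derivative D) (at t)"
    unfolding has_circle_derivative_def by blast
  have "isCont (\<lambda>s. F s - f s) t"
    by (intro continuous_intros DERIV_isCont [OF dF] DERIV_isCont [OF tf(3)])
  moreover have "\<forall>\<^sub>F s in nhds t. F s - f s \<in> \<int>"
    using tf(2) by eventually_elim (metis F(2) to_circle_eq_iff)
  ultimately have "\<forall>\<^sub>F s in nhds t. F s - f s = F t - f t"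
    by (rule integer_valued_near_constant)
  then have ev: "\<forall>\<^sub>F s in nhds t. f s + (F t - f t) = F s"
    by eventually_elim simp
  have "((\<lambda>s. f s + (F t - f t)) has_real_derivative D) (at t)"
    using DERIV_add [OF tf(3) DERIV_const] by simp
  then have "(F has_real_derivative D) (at t)"
    using DERIV_cong_ev [OF refl ev refl, of D] by simp
  then have "D = vderiv 1 F t" using dF DERIV_unique by blast
  moreover have "has_period 1 (vderiv 1 F)"
    by (rule has_period_deriv_lift [OF F])
  moreover obtain n :: int where "s = t + of_int n * 1"
    using tf(1) by (metis Ints_cases add.commute diff_add_cancel mult.right_neutral to_circle_eq_iff)
  ultimately show "D = vderiv 1 F s" using has_period_of_int by metis
qed

text \<open>The integer \<open>d\<close> is the degree of the circle map. It can be negative, in which case \<open>F\<close> reverses the orientation.\<close>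

locale expanding_lift =
  fixes F :: "real \<Rightarrow> real" and c :: real and d :: int
  assumes smooth: "smooth_on UNIV F"
    and expanding: "\<And>t. c \<le> \<bar>vderiv 1 F t\<bar>" and c_gt_1: "c > 1"
    and degree: "\<And>t. F (t + 1) = F t + of_int d"
begin

definition G where "G = inv F"

lemma F_deriv: "(F has_real_derivative vderiv 1 F t) (at t)"
  using smooth_has_vderiv_1 [OF smooth] by (simp add: has_real_derivative_iff_has_vector_derivative)

lemma F_continuous: "continuous_on S F"
  using smooth_continuous_on [OF smooth, of S 0] by simp

lemma F_expands: "c * \<bar>x - y\<bar> \<le> \<bar>F x - F y\<bar>"
proof (induction x y rule: linorder_wlog)
  case (le x y)
  show ?case
  proof (cases "x = y")
    case False
    then obtain z where "F y - F x = (y - x) * vderiv 1 F z"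
      using MVT2 [of x y F "vderiv 1 F"] F_deriv le by auto
    then show ?thesis
      using expanding [of z] mult_right_mono [of c "\<bar>vderiv 1 F z\<bar>" "\<bar>y - x\<bar>"]
      by (simp add: abs_minus_commute [of "F x"] abs_minus_commute [of x] abs_mult mult.commute)
  qed simp
qed (simp add: abs_minus_commute)

lemma F_shift: "F (t + of_int n) = F t + of_int n * of_int d"
proof -
  have "has_period 1 (\<lambda>t. F t - of_int d * t)"
    by (simp add: has_period_def degree algebra_simps)
  from has_period_of_int [OF this, of t n] show ?thesis by (simp add: algebra_simps)
qed

lemma d_nonzero: "d \<noteq> 0"
  using F_expands [of 1 0] degree [of 0] c_gt_1 by auto

lemma F_inj: "inj F"
proof (rule injI)
  fix x y assume "F x = F y"
  then have "c * \<bar>x - y\<bar> \<le> 0" using F_expands [of x y] by simp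
  then show "x = y" using c_gt_1 by (simp add: mult_le_0_iff)
qed

lemma F_surj: "surj F"
proof -
  have "y \<in> range F" for y
  proof -
    \<comment> \<open>\<open>F\<close> moves by \<open>n d\<close> over \<open>n\<close> periods, so \<open>F n\<close> and \<open>F (- n)\<close> enclose \<open>y\<close>\<close>
    obtain n :: nat where n: "\<bar>y - F 0\<bar> \<le> real n" using real_arch_simple by blast
    have "1 \<le> \<bar>of_int d :: real\<bar>" using d_nonzero by linarith
    then have "real n \<le> \<bar>real n * of_int d\<bar>"
      using mult_left_mono [of 1 "\<bar>of_int d\<bar>" "real n"] by (simp add: abs_mult)
    then have "y \<le> F 0 + \<bar>real n * of_int d\<bar>" "F 0 - \<bar>real n * of_int d\<bar> \<le> y" using n by linarith+
    moreover have "F (real n) = F 0 + real n * of_int d" "F (- real n) = F 0 - real n * of_int d"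
      using F_shift [of 0 "int n"] F_shift [of 0 "- int n"] by simp_all
    ultimately have "\<exists>a b. F a \<le> y \<and> y \<le> F b"
      by (cases "real n * of_int d \<ge> 0") (metis abs_of_nonneg, metis abs_of_neg add_uminus_conv_diff linorder_not_le minus_diff_eq diff_minus_eq_add)
    moreover have "connected (range F)"
      by (intro connected_continuous_image F_continuous) simp
    ultimately show ?thesis using connectedD_interval [of "range F"] by blast
  qed
  then show ?thesis by auto
qed

lemma F_G [simp]: "F (G t) = t" and G_F [simp]: "G (F t) = t"
  by (simp_all add: G_def F_surj F_inj surj_f_inv_f)

lemma deriv_nonzero: "vderiv 1 F t \<noteq> 0"
  using expanding [of t] c_gt_1 by auto

lemma G_deriv: "(G has_real_derivative inverse (vderiv 1 F (G t))) (at t)"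
  using has_field_derivative_inverse_strong [OF F_deriv deriv_nonzero open_UNIV, of "G t" G]
    F_continuous by simp

lemma G_has_vector_derivative: "(G has_vector_derivative inverse (vderiv 1 F (G t))) (at t)"
  using G_deriv by (simp add: has_real_derivative_iff_has_vector_derivative)

lemma G_smooth: "smooth_on UNIV G"
  by (rule smooth_autonomous_ode [OF _ G_has_vector_derivative])
     (intro smooth_inverse smooth_vderiv smooth deriv_nonzero)

lemma vderiv_G: "vderiv (Suc 0) G t = inverse (vderiv (Suc 0) F (G t))"
  using vderiv_eqI [OF G_has_vector_derivative] by simp

lemma G_continuous: "continuous_on S G"
  using smooth_continuous_on [OF G_smooth, of S 0] by simp

lemma G_contracts: "\<bar>G x - G y\<bar> \<le> \<bar>x - y\<bar>"
proof -
  have "1 * \<bar>G x - G y\<bar> \<le> c * \<bar>G x - G y\<bar>" using c_gt_1 by (intro mult_right_mono) auto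
  then show ?thesis using F_expands [of "G x" "G y"] by simp
qed

lemma abs_vderiv_G_le: "\<bar>vderiv 1 G t\<bar> \<le> inverse c"
  using expanding [of "G t"] c_gt_1 by (simp add: vderiv_G le_imp_inverse_le)

lemma G_shift: "G (t + of_int d) = G t + 1"
  by (metis F_G G_F degree)

lemma has_period_vderiv_F: "has_period 1 (vderiv 1 F)"
  by (rule has_period_deriv [OF smooth degree])

lemma has_period_vderiv_G: "has_period (real_of_int \<bar>d\<bar>) (vderiv 1 G)"
proof -
  have *: "has_period (of_int d) (vderiv 1 G)"
    using has_period_vderiv_F by (simp add: has_period_def vderiv_G G_shift)
  show ?thesis
    using has_period_of_int [OF *, of _ "sgn d"]
    by (simp add: has_period_def abs_sgn mult.commute flip: of_int_mult)
qed

lemma deriv_sign: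
  obtains \<sigma> :: real where "\<bar>\<sigma>\<bar> = 1" "\<And>t. \<bar>vderiv 1 F t\<bar> = \<sigma> * vderiv 1 F t"
proof -
  have "connected (range (vderiv 1 F))"
    by (intro connected_continuous_image smooth_continuous_on smooth) simp
  then have "\<not> (vderiv 1 F s < 0 \<and> vderiv 1 F t > 0)" for s t
    using connectedD_interval [of "range (vderiv 1 F)" "vderiv 1 F s" "vderiv 1 F t" 0] deriv_nonzero
    by (auto simp: less_imp_le)
  then have "(\<forall>t. vderiv 1 F t > 0) \<or> (\<forall>t. vderiv 1 F t < 0)"
    using deriv_nonzero by (metis linorder_neqE)
  then show ?thesis
  proof
    assume "\<forall>t. vderiv 1 F t > 0"
    then show ?thesis by (intro that [of 1]) (auto simp: abs_of_pos)
  next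
    assume "\<forall>t. vderiv 1 F t < 0"
    then show ?thesis by (intro that [of "- 1"]) (auto simp: abs_of_neg)
  qed
qed

lemma smooth_abs_vderiv_G: "smooth_on UNIV (\<lambda>t. \<bar>vderiv 1 G t\<bar>)"
proof -
  obtain \<sigma> where s: "\<bar>\<sigma>\<bar> = 1" "\<And>t. \<bar>vderiv 1 F t\<bar> = \<sigma> * vderiv 1 F t"
    using deriv_sign by blast
  have "\<bar>vderiv 1 G t\<bar> = inverse \<sigma> *\<^sub>R vderiv 1 G t" for t
    using s(2) [of "G t"] by (simp add: vderiv_G)
  then show ?thesis
    using smooth_linear [OF bounded_linear_scaleR_right smooth_vderiv [OF G_smooth], of "inverse \<sigma>" 1] by simp
qed

text \<open>A shift of \<open>t\<close> by \<open>d\<close> moves \<open>G t\<close> by one full period, so the preimages of a point of the circle are listed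
without repetition by the residues modulo \<open>\<bar>d\<bar>\<close>.\<close>

lemma fibre_bij:
  assumes lift: "\<And>t. T (to_circle t) = to_circle (F t)"
  shows "bij_betw (\<lambda>j. to_circle (G (t + of_nat j))) {..<nat \<bar>d\<bar>} {y. T y = to_circle t}"
proof (rule bij_betw_imageI)
  show "inj_on (\<lambda>j. to_circle (G (t + of_nat j))) {..<nat \<bar>d\<bar>}"
  proof (rule inj_onI)
    fix i j assume ij: "i \<in> {..<nat \<bar>d\<bar>}" "j \<in> {..<nat \<bar>d\<bar>}"
      and "to_circle (G (t + of_nat i)) = to_circle (G (t + of_nat j))"
    then obtain n :: int where "G (t + of_nat i) = G (t + of_nat j) + of_int n"
      by (metis Ints_cases add.commute diff_add_cancel to_circle_eq_iff)
    then have "t + of_nat i = t + of_nat j + of_int n * of_int d"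
      by (metis F_G F_shift)
    then have "of_int (int i - int j) = (of_int (n * d) :: real)" by simp
    then have eq: "int i - int j = n * d" by (simp only: of_int_eq_iff)
    have "\<bar>n * d\<bar> < \<bar>d\<bar>" using ij eq by auto
    then have "n = 0" by (simp add: abs_mult mult_less_cancel_right2)
    then show "i = j" using eq by simp
  qed
  show "(\<lambda>j. to_circle (G (t + of_nat j))) ` {..<nat \<bar>d\<bar>} = {y. T y = to_circle t}"
  proof (intro equalityI subsetI)
    fix y assume "y \<in> (\<lambda>j. to_circle (G (t + of_nat j))) ` {..<nat \<bar>d\<bar>}"
    then show "y \<in> {y. T y = to_circle t}" by (auto simp: lift to_circle_eq_iff)
  next
    fix y assume "y \<in> {y. T y = to_circle t}"
    then have Ty: "T y = to_circle t" by simp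
    obtain s where s: "y = to_circle s" by (rule to_circle_surj)
    then have "F s - t \<in> \<int>" using Ty lift by (simp add: to_circle_eq_iff)
    then obtain m :: int where m: "F s = t + of_int m" by (metis Ints_cases add.commute diff_add_cancel)
    \<comment> \<open>division with remainder by the absolute value, since \<open>d\<close> may be negative\<close>
    define j where "j = m mod \<bar>d\<bar>"
    have j: "0 \<le> j" "j < \<bar>d\<bar>" using d_nonzero by (simp_all add: j_def)
    have "d dvd m - j" by (simp add: j_def minus_mod_eq_mult_div)
    then obtain q where q: "m = j + q * d" by (metis add.commute diff_add_cancel dvdE mult.commute)
    have "F (s + of_int (- q)) = t + of_int j"
      unfolding F_shift m q by simp
    then have "G (t + of_nat (nat j)) = s + of_int (- q)" using j by (metis G_F of_int_of_nat_eq int_nat_eq)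
    then have "y = to_circle (G (t + of_nat (nat j)))" by (simp add: s to_circle_eq_iff)
    then show "y \<in> (\<lambda>j. to_circle (G (t + of_nat j))) ` {..<nat \<bar>d\<bar>}"
      using j by (intro image_eqI [of _ _ "nat j"]) auto
  qed
qed

text \<open>The transfer operator acting on periodic functions of the line.\<close>

definition lifted_transfer :: "(real \<Rightarrow> complex) \<Rightarrow> real \<Rightarrow> complex" where
  "lifted_transfer f t = (\<Sum>j<nat \<bar>d\<bar>. \<bar>vderiv 1 G (t + of_nat j)\<bar> *\<^sub>R f (G (t + of_nat j)))"

lemma transfer_operator_lift:
  assumes lift: "\<And>t. T (to_circle t) = to_circle (F t)"
  shows "transfer_operator T \<phi> \<circ> to_circle = lifted_transfer (\<phi> \<circ> to_circle)"
proof
  fix t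
  have "(\<Sum>y | T y = to_circle t. complex_of_real (1 / \<bar>circle_deriv T y\<bar>) * \<phi> y) =
      (\<Sum>j<nat \<bar>d\<bar>. complex_of_real (1 / \<bar>circle_deriv T (to_circle (G (t + of_nat j)))\<bar>) *
         \<phi> (to_circle (G (t + of_nat j))))"
    by (rule sum.reindex_bij_betw [OF fibre_bij [OF lift], symmetric])
  then show "(transfer_operator T \<phi> \<circ> to_circle) t = lifted_transfer (\<phi> \<circ> to_circle) t"
    by (simp add: transfer_operator_def lifted_transfer_def circle_deriv_lift [OF smooth lift] vderiv_G
        scaleR_conv_of_real inverse_eq_divide)
qed

end

section \<open>Derivatives of the transfer operator\<close>

text \<open>Since \<open>(b (f \<circ> G))' = b' (f \<circ> G) + b G' (f' \<circ> G)\<close>, one derivative replaces the weight \<open>b\<close> of the leading term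
by \<open>b G'\<close>, which is smaller by the factor \<open>\<mu>\<close>, and the other term only has derivatives of lower order. The
induction therefore runs over all periodic weights \<open>b\<close>; periodicity is what keeps \<open>b'\<close> bounded. The constant
\<open>C\<close> is allowed to depend on \<open>b\<close> and \<open>k\<close>, whereas the leading constant is explicit.\<close>

lemma weighted_composition_vderiv_bound:
  assumes G: "smooth_on UNIV G" and G_le: "\<And>t. \<bar>vderiv 1 G t\<bar> \<le> \<mu>"
    and G_per: "has_period p (vderiv 1 G)" and p: "p > 0"
  shows "smooth_on UNIV b \<Longrightarrow> has_period p b \<Longrightarrow> (\<And>t. \<bar>b t\<bar> \<le> S) \<Longrightarrow>
    \<exists>C\<ge>0. \<forall>f :: real \<Rightarrow> complex. smooth_on UNIV f \<longrightarrow> (\<forall>t. norm (vderiv k (\<lambda>t. b t *\<^sub>R f (G t)) t) \<le>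
      S * \<mu> ^ k * norm (vderiv k f (G t)) + C * (\<Sum>i<k. norm (vderiv i f (G t))))"
proof (induction k arbitrary: b S)
  case 0
  then show ?case by (intro exI [of _ 0]) (auto intro: mult_right_mono)
next
  case (Suc k)
  have \<mu>: "\<mu> \<ge> 0" using G_le [of 0] by linarith
  have S: "S \<ge> 0" using Suc.prems(3) [of 0] by linarith
  define b1 where "b1 = vderiv 1 b"
  define b2 where "b2 t = b t * vderiv 1 G t" for t
  have b1: "smooth_on UNIV b1" "has_period p b1"
    unfolding b1_def using Suc.prems by (auto intro: smooth_vderiv has_period_vderiv)
  obtain S1 where S1: "S1 \<ge> 0" "\<And>t. \<bar>b1 t\<bar> \<le> S1"
    using has_period_bounded [OF b1(2) p] smooth_continuous_on [OF b1(1), of UNIV 0] by auto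
  have b2: "smooth_on UNIV b2" "has_period p b2"
    using smooth_scaleR [OF Suc.prems(1) smooth_vderiv [OF G, of 1]] Suc.prems(2) G_per
    by (simp_all add: b2_def [abs_def] has_period_def)
  have b2_le: "\<bar>b2 t\<bar> \<le> S * \<mu>" for t
    using Suc.prems(3) G_le S by (auto simp: b2_def abs_mult intro!: mult_mono)
  from Suc.IH [OF b1 S1(2)] obtain C1 where C1: "C1 \<ge> 0" "\<forall>f :: real \<Rightarrow> complex. smooth_on UNIV f \<longrightarrow>
      (\<forall>t. norm (vderiv k (\<lambda>t. b1 t *\<^sub>R f (G t)) t) \<le>
        S1 * \<mu> ^ k * norm (vderiv k f (G t)) + C1 * (\<Sum>i<k. norm (vderiv i f (G t))))"
    by (elim exE conjE) (rule that)
  from Suc.IH [OF b2 b2_le] obtain C2 where C2: "C2 \<ge> 0" "\<forall>f :: real \<Rightarrow> complex. smooth_on UNIV f \<longrightarrow>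
      (\<forall>t. norm (vderiv k (\<lambda>t. b2 t *\<^sub>R f (G t)) t) \<le>
        S * \<mu> * \<mu> ^ k * norm (vderiv k f (G t)) + C2 * (\<Sum>i<k. norm (vderiv i f (G t))))"
    by (elim exE conjE) (rule that)
  define C where "C = S1 * \<mu> ^ k + C1 + C2"
  have "norm (vderiv (Suc k) (\<lambda>t. b t *\<^sub>R f (G t)) t) \<le>
      S * \<mu> ^ Suc k * norm (vderiv (Suc k) f (G t)) + C * (\<Sum>i<Suc k. norm (vderiv i f (G t)))"
    if f: "smooth_on UNIV f" for f :: "real \<Rightarrow> complex" and t
  proof -
    have "((\<lambda>t. b t *\<^sub>R f (G t)) has_vector_derivative b1 t *\<^sub>R f (G t) + b2 t *\<^sub>R vderiv 1 f (G t)) (at t)" for t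
    proof -
      have "((\<lambda>t. b t *\<^sub>R f (G t)) has_vector_derivative
          b t *\<^sub>R (vderiv 1 G t *\<^sub>R vderiv 1 f (G t)) + vderiv 1 b t *\<^sub>R f (G t)) (at t)"
        using smooth_has_vderiv_1 [OF Suc.prems(1), of t]
          has_vector_derivative_compose_real [OF smooth_differentiable [OF f] smooth_differentiable [OF G]]
        by (intro has_vector_derivative_scaleR) (simp_all add: has_real_derivative_iff_has_vector_derivative)
      then show ?thesis by (simp add: b1_def b2_def add.commute)
    qed
    then have "vderiv 1 (\<lambda>t. b t *\<^sub>R f (G t)) = (\<lambda>t. b1 t *\<^sub>R f (G t) + b2 t *\<^sub>R vderiv 1 f (G t))"
      by (rule vderiv_eqI)
    then have "vderiv (Suc k) (\<lambda>t. b t *\<^sub>R f (G t)) =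
        vderiv k (\<lambda>t. b1 t *\<^sub>R f (G t) + b2 t *\<^sub>R vderiv 1 f (G t))"
      by (simp only: vderiv_Suc_shift [of k "\<lambda>t. b t *\<^sub>R f (G t)"])
    also have "\<dots> = (\<lambda>t. vderiv k (\<lambda>t. b1 t *\<^sub>R f (G t)) t + vderiv k (\<lambda>t. b2 t *\<^sub>R vderiv 1 f (G t)) t)"
      by (rule vderiv_add [OF smooth_scaleR [OF b1(1) smooth_compose [OF f G]]
            smooth_scaleR [OF b2(1) smooth_compose [OF smooth_vderiv [OF f] G]]])
    finally have "norm (vderiv (Suc k) (\<lambda>t. b t *\<^sub>R f (G t)) t) \<le>
        norm (vderiv k (\<lambda>t. b1 t *\<^sub>R f (G t)) t) + norm (vderiv k (\<lambda>t. b2 t *\<^sub>R vderiv 1 f (G t)) t)"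
      by (simp add: norm_triangle_ineq)
    also have "\<dots> \<le> (S1 * \<mu> ^ k * norm (vderiv k f (G t)) + C1 * (\<Sum>i<k. norm (vderiv i f (G t)))) +
        (S * \<mu> * \<mu> ^ k * norm (vderiv (Suc k) f (G t)) + C2 * (\<Sum>i<k. norm (vderiv (Suc i) f (G t))))"
      using C1(2) [rule_format, OF f, of t] C2(2) [rule_format, OF smooth_vderiv [OF f, of 1], of t]
      by (simp add: vderiv_vderiv)
    also have "\<dots> \<le> (S1 * \<mu> ^ k * (\<Sum>i<Suc k. norm (vderiv i f (G t))) + C1 * (\<Sum>i<Suc k. norm (vderiv i f (G t)))) +
        (S * \<mu> * \<mu> ^ k * norm (vderiv (Suc k) f (G t)) + C2 * (\<Sum>i<Suc k. norm (vderiv i f (G t))))"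
    proof -
      have "(\<Sum>i<k. norm (vderiv (Suc i) f (G t))) \<le> (\<Sum>i<Suc k. norm (vderiv i f (G t)))"
        by (subst sum.lessThan_Suc_shift) simp
      moreover have "norm (vderiv k f (G t)) \<le> (\<Sum>i<Suc k. norm (vderiv i f (G t)))"
        "(\<Sum>i<k. norm (vderiv i f (G t))) \<le> (\<Sum>i<Suc k. norm (vderiv i f (G t)))"
        by (simp_all add: sum_nonneg)
      ultimately show ?thesis
        using C1(1) C2(1) S1(1) \<mu> by (intro add_mono mult_left_mono order_refl) auto
    qed
    finally show ?thesis by (simp add: C_def algebra_simps)
  qed
  moreover have "C \<ge> 0" using C1(1) C2(1) S1(1) \<mu> by (simp add: C_def)
  ultimately show ?case by blast
qed

lemma l2sq_mono:
  assumes "continuous_on UNIV g" and "continuous_on UNIV u"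
    and "\<And>t. (norm (g t))\<^sup>2 \<le> u t"
  shows "l2sq g \<le> integral {0..1} u"
  unfolding l2sq_def using assms
  by (intro integral_le integrable_norm_sq integrable_continuous_real) (auto intro: continuous_on_subset)

lemma l2sq_le_weighted_sum:
  assumes "continuous_on UNIV g" and f: "\<And>i. i \<in> I \<Longrightarrow> continuous_on UNIV (f i)" and "finite I"
    and le: "\<And>t. (norm (g t))\<^sup>2 \<le> (\<Sum>i\<in>I. a i * (norm (f i t))\<^sup>2)"
  shows "l2sq g \<le> (\<Sum>i\<in>I. a i * l2sq (f i))"
proof -
  have "l2sq g \<le> integral {0..1} (\<lambda>t. \<Sum>i\<in>I. a i * (norm (f i t))\<^sup>2)"
    by (intro l2sq_mono continuous_intros assms)
  also have "((\<lambda>t. \<Sum>i\<in>I. a i * (norm (f i t))\<^sup>2) has_integral (\<Sum>i\<in>I. a i * l2sq (f i))) {0..1}"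
    unfolding l2sq_def
    by (intro has_integral_sum \<open>finite I\<close> has_integral_mult_right integrable_integral integrable_norm_sq f)
  then have "integral {0..1} (\<lambda>t. \<Sum>i\<in>I. a i * (norm (f i t))\<^sup>2) = (\<Sum>i\<in>I. a i * l2sq (f i))"
    by (rule integral_unique)
  finally show ?thesis .
qed

lemma l2sq_sum_le:
  assumes "\<And>i. i \<in> I \<Longrightarrow> continuous_on UNIV (f i)" and "finite I"
  shows "l2sq (\<lambda>t. \<Sum>i\<in>I. f i t) \<le> card I * (\<Sum>i\<in>I. l2sq (f i))"
proof -
  have "(norm (\<Sum>i\<in>I. f i t))\<^sup>2 \<le> (\<Sum>i\<in>I. card I * (norm (f i t))\<^sup>2)" for t
  proof -
    have "(norm (\<Sum>i\<in>I. f i t))\<^sup>2 \<le> (\<Sum>i\<in>I. norm (f i t))\<^sup>2"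
      by (intro power_mono norm_sum) simp
    also have "\<dots> \<le> (\<Sum>i\<in>I. (norm (f i t))\<^sup>2) * card I"
      by (rule sum_squared_le_sum_of_squares)
    finally show ?thesis by (simp add: sum_distrib_left mult.commute)
  qed
  then have "l2sq (\<lambda>t. \<Sum>i\<in>I. f i t) \<le> (\<Sum>i\<in>I. card I * l2sq (f i))"
    using assms by (intro l2sq_le_weighted_sum continuous_on_sum) auto
  then show ?thesis by (simp add: sum_distrib_left)
qed

context expanding_lift
begin

lemma vderiv_F_bounded:
  obtains \<Lambda> where "\<Lambda> > 0" "\<And>t. \<bar>vderiv 1 F t\<bar> \<le> \<Lambda>"
proof -
  obtain M where "\<And>t. \<bar>vderiv 1 F t\<bar> \<le> M"
    using has_period_bounded [OF has_period_vderiv_F] smooth_continuous_on [OF smooth, of UNIV 1] by auto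
  then show ?thesis
    using that [of "max M 1"] by (simp add: max.coboundedI1)
qed

text \<open>Change of variables along \<open>G\<close>. The branch contracts, so the image of a period lies in an interval of length at
most one.\<close>

lemma l2sq_compose_branch_le:
  assumes \<Lambda>: "\<Lambda> > 0" "\<And>t. \<bar>vderiv 1 F t\<bar> \<le> \<Lambda>"
    and f: "continuous_on UNIV f" "has_period 1 f"
  shows "l2sq (\<lambda>t. f (G (t + a))) \<le> \<Lambda> * l2sq f"
proof -
  define u where "u t = (norm (f t))\<^sup>2" for t
  have u_cont: "continuous_on S u" for S
    unfolding u_def by (intro continuous_intros continuous_on_subset [OF f(1)]) simp
  have uG_cont: "continuous_on S (\<lambda>t. u (G t))" for S
    by (rule continuous_on_compose2 [OF u_cont [of UNIV] G_continuous]) simp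
  have G'_cont: "continuous_on S (\<lambda>t. \<bar>vderiv 1 G t\<bar>)" for S
    by (intro continuous_intros smooth_continuous_on G_smooth)
  obtain l h where lh: "G ` {a..a+1} = {l..h}"
    using connected_compact_interval_1 [of "G ` {a..a+1}"]
      connected_continuous_image [OF G_continuous, of "{a..a+1}"]
      compact_continuous_image [OF G_continuous, of "{a..a+1}"] by auto
  have "h \<le> l + 1"
  proof (cases "l \<le> h")
    case True
    then have "l \<in> G ` {a..a+1}" "h \<in> G ` {a..a+1}" using lh by auto
    then obtain x y where "x \<in> {a..a+1}" "y \<in> {a..a+1}" "l = G x" "h = G y" by blast
    then show ?thesis using G_contracts [of x y] by auto
  qed simp
  have "u absolutely_integrable_on {l..h}"
    by (rule absolutely_integrable_continuous_real [OF u_cont])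
  moreover have "inj_on G {a..a+1}"
    by (metis F_G inj_onI)
  ultimately have "integral {a..a+1} (\<lambda>t. \<bar>vderiv 1 G t\<bar> * u (G t)) = integral {l..h} u"
    using has_absolute_integral_change_of_variables_1' [of "{a..a+1}" G "vderiv 1 G" u "integral {l..h} u"]
      G_deriv lh by (simp add: has_field_derivative_at_within vderiv_G)
  also have "\<dots> \<le> integral {l..l+1} u"
    using \<open>h \<le> l + 1\<close> by (intro integral_subset_le integrable_continuous_real u_cont) (auto simp: u_def)
  also have "\<dots> = l2sq f"
    unfolding l2sq_def u_def [symmetric]
    using f(2) by (intro integral_shift_period u_cont) (simp add: has_period_def u_def)
  finally have main: "integral {a..a+1} (\<lambda>t. \<bar>vderiv 1 G t\<bar> * u (G t)) \<le> l2sq f" .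
  have "l2sq (\<lambda>t. f (G (t + a))) = integral {a..a+1} (\<lambda>t. u (G t))"
    using integral_shift_real_ivl [of a a "a + 1" "\<lambda>t. u (G t)"] by (simp add: l2sq_def u_def)
  also have "\<dots> \<le> integral {a..a+1} (\<lambda>t. \<Lambda> * (\<bar>vderiv 1 G t\<bar> * u (G t)))"
  proof (intro integral_le integrable_continuous_real continuous_on_mult continuous_on_const uG_cont G'_cont)
    fix t
    have "1 \<le> \<Lambda> * \<bar>vderiv 1 G t\<bar>"
      using \<Lambda>(2) [of "G t"] deriv_nonzero [of "G t"] by (simp add: vderiv_G field_simps)
    from mult_right_mono [OF this, of "u (G t)"]
    show "u (G t) \<le> \<Lambda> * (\<bar>vderiv 1 G t\<bar> * u (G t))"
      by (simp add: u_def mult.assoc)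
  qed
  also have "\<dots> = \<Lambda> * integral {a..a+1} (\<lambda>t. \<bar>vderiv 1 G t\<bar> * u (G t))"
    by simp
  also have "\<dots> \<le> \<Lambda> * l2sq f"
    using main \<Lambda>(1) by (intro mult_left_mono) auto
  finally show ?thesis .
qed

lemma smooth_branch_term:
  assumes "smooth_on UNIV f"
  shows "smooth_on UNIV (\<lambda>t. \<bar>vderiv 1 G t\<bar> *\<^sub>R f (G t))"
  by (rule smooth_scaleR [OF smooth_abs_vderiv_G smooth_compose [OF assms G_smooth]])

lemma smooth_lifted_transfer:
  assumes "smooth_on UNIV f"
  shows "smooth_on UNIV (lifted_transfer f)"
  unfolding lifted_transfer_def [abs_def]
  using smooth_shift [OF smooth_branch_term [OF assms]] by (intro smooth_sum) simp

text \<open>The Lasota-Yorke estimate: \<open>M\<close> is uniform in \<open>k\<close>, and the contraction factor is a power of the inverse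
expansion constant.\<close>

theorem lifted_transfer_vderiv_bound:
  obtains M where "M \<ge> 0"
    "\<And>k. \<exists>C\<ge>0. \<forall>f. smooth_on UNIV f \<and> has_period 1 f \<longrightarrow>
       l2sq (vderiv k (lifted_transfer f)) \<le>
         M * (inverse c ^ 2) ^ k * l2sq (vderiv k f) + C * (\<Sum>i<k. l2sq (vderiv i f))"
proof -
  obtain \<Lambda> where \<Lambda>: "\<Lambda> > 0" "\<And>t. \<bar>vderiv 1 F t\<bar> \<le> \<Lambda>" using vderiv_F_bounded by blast
  define D where "D = nat \<bar>d\<bar>"
  define \<mu> where "\<mu> = inverse c"
  have \<mu>: "\<mu> \<ge> 0" using c_gt_1 by (simp add: \<mu>_def)
  define M where "M = real D * real D * (2 * \<mu>\<^sup>2 * \<Lambda>)"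
  have per_abs: "has_period (real_of_int \<bar>d\<bar>) (\<lambda>t. \<bar>vderiv 1 G t\<bar>)"
    using has_period_vderiv_G by (simp add: has_period_def)
  have "\<exists>C\<ge>0. \<forall>f. smooth_on UNIV f \<and> has_period 1 f \<longrightarrow>
       l2sq (vderiv k (lifted_transfer f)) \<le>
         M * (\<mu> ^ 2) ^ k * l2sq (vderiv k f) + C * (\<Sum>i<k. l2sq (vderiv i f))" for k
  proof -
    have "real_of_int \<bar>d\<bar> > 0" using d_nonzero by simp
    from weighted_composition_vderiv_bound [OF G_smooth abs_vderiv_G_le has_period_vderiv_G this
        smooth_abs_vderiv_G per_abs, of "inverse c" k, folded \<mu>_def]
    have "\<exists>C\<ge>0. \<forall>f :: real \<Rightarrow> complex. smooth_on UNIV f \<longrightarrow>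
        (\<forall>t. norm (vderiv k (\<lambda>t. \<bar>vderiv 1 G t\<bar> *\<^sub>R f (G t)) t) \<le>
          \<mu> * \<mu> ^ k * norm (vderiv k f (G t)) + C * (\<Sum>i<k. norm (vderiv i f (G t))))"
      using abs_vderiv_G_le by (simp add: \<mu>_def)
    then obtain C where C: "C \<ge> 0" "\<forall>f :: real \<Rightarrow> complex. smooth_on UNIV f \<longrightarrow>
        (\<forall>t. norm (vderiv k (\<lambda>t. \<bar>vderiv 1 G t\<bar> *\<^sub>R f (G t)) t) \<le>
          \<mu> * \<mu> ^ k * norm (vderiv k f (G t)) + C * (\<Sum>i<k. norm (vderiv i f (G t))))"
      by (elim exE conjE) (rule that)
    \<comment> \<open>squaring separates the leading term from the rest; the \<open>k\<close> lower terms are merged by Cauchy-Schwarz\<close>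
    define a where "a i = (if i = k then 2 * (\<mu> * \<mu> ^ k)\<^sup>2 else 2 * C\<^sup>2 * real k)" for i
    have a: "a i \<ge> 0" for i by (simp add: a_def)
    have pt: "(norm (vderiv k (\<lambda>t. \<bar>vderiv 1 G t\<bar> *\<^sub>R f (G t)) t))\<^sup>2 \<le> (\<Sum>i<Suc k. a i * (norm (vderiv i f (G t)))\<^sup>2)"
      if "smooth_on UNIV f" for f :: "real \<Rightarrow> complex" and t
    proof -
      have "(norm (vderiv k (\<lambda>t. \<bar>vderiv 1 G t\<bar> *\<^sub>R f (G t)) t))\<^sup>2 \<le>
          (\<mu> * \<mu> ^ k * norm (vderiv k f (G t)) + C * (\<Sum>i<k. norm (vderiv i f (G t))))\<^sup>2"
        by (rule power_mono [OF C(2) [rule_format, OF that] norm_ge_zero])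
      also have "\<dots> \<le> 2 * (\<mu> * \<mu> ^ k * norm (vderiv k f (G t)))\<^sup>2 + 2 * (C * (\<Sum>i<k. norm (vderiv i f (G t))))\<^sup>2"
        using sum_squares_bound [of "\<mu> * \<mu> ^ k * norm (vderiv k f (G t))" "C * (\<Sum>i<k. norm (vderiv i f (G t)))"]
        by (simp add: power2_sum)
      also have "(C * (\<Sum>i<k. norm (vderiv i f (G t))))\<^sup>2 \<le> C\<^sup>2 * ((\<Sum>i<k. (norm (vderiv i f (G t)))\<^sup>2) * real k)"
        using sum_squared_le_sum_of_squares [of "\<lambda>i. norm (vderiv i f (G t))" "{..<k}"]
        by (simp add: power_mult_distrib mult_left_mono)
      also have "2 * (\<mu> * \<mu> ^ k * norm (vderiv k f (G t)))\<^sup>2 + 2 * (C\<^sup>2 * ((\<Sum>i<k. (norm (vderiv i f (G t)))\<^sup>2) * real k)) =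
          (\<Sum>i<Suc k. a i * (norm (vderiv i f (G t)))\<^sup>2)"
        by (simp add: a_def power_mult_distrib sum_distrib_left sum_distrib_right mult_ac)
      finally show ?thesis by simp
    qed
    have branch: "l2sq (vderiv k (\<lambda>t. \<bar>vderiv 1 G (t + s)\<bar> *\<^sub>R f (G (t + s)))) \<le> (\<Sum>i<Suc k. a i * (\<Lambda> * l2sq (vderiv i f)))"
      if f: "smooth_on UNIV f" "has_period 1 f" for f s
    proof -
      have "l2sq (vderiv k (\<lambda>t. \<bar>vderiv 1 G (t + s)\<bar> *\<^sub>R f (G (t + s)))) \<le>
          (\<Sum>i<Suc k. a i * l2sq (\<lambda>t. vderiv i f (G (t + s))))"
      proof (rule l2sq_le_weighted_sum)
        note shift = smooth_shift [OF smooth_branch_term [OF f(1)], of s]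
        show "continuous_on UNIV (vderiv k (\<lambda>t. \<bar>vderiv 1 G (t + s)\<bar> *\<^sub>R f (G (t + s))))"
          by (rule smooth_continuous_on [OF shift])
        show "continuous_on UNIV (\<lambda>t. vderiv i f (G (t + s)))" for i
          using smooth_continuous_on [OF smooth_shift [OF smooth_compose [OF smooth_vderiv [OF f(1), of i] G_smooth], of s], of UNIV 0]
          by simp
        show "(norm (vderiv k (\<lambda>t. \<bar>vderiv 1 G (t + s)\<bar> *\<^sub>R f (G (t + s))) t))\<^sup>2 \<le>
            (\<Sum>i<Suc k. a i * (norm (vderiv i f (G (t + s))))\<^sup>2)" for t
          using pt [OF f(1), of "t + s"] fun_cong [OF vderiv_shift [OF smooth_branch_term [OF f(1)], of k s], of t]
          by metis
      qed auto
      also have "\<dots> \<le> (\<Sum>i<Suc k. a i * (\<Lambda> * l2sq (vderiv i f)))"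
        by (intro sum_mono mult_left_mono a l2sq_compose_branch_le \<Lambda> smooth_continuous_on f has_period_vderiv)
      finally show ?thesis .
    qed
    define C' where "C' = real D * real D * (2 * C\<^sup>2 * real k * \<Lambda>)"
    have "l2sq (vderiv k (lifted_transfer f)) \<le>
         M * (\<mu> ^ 2) ^ k * l2sq (vderiv k f) + C' * (\<Sum>i<k. l2sq (vderiv i f))"
      if f: "smooth_on UNIV f" "has_period 1 f" for f
    proof -
      note sm = smooth_shift [OF smooth_branch_term [OF f(1)]]
      have "vderiv k (lifted_transfer f) =
          (\<lambda>t. \<Sum>j<D. vderiv k (\<lambda>t. \<bar>vderiv 1 G (t + of_nat j)\<bar> *\<^sub>R f (G (t + of_nat j))) t)"
        unfolding lifted_transfer_def [abs_def] D_def by (rule vderiv_sum [OF sm])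
      then have "l2sq (vderiv k (lifted_transfer f)) \<le>
          card {..<D} * (\<Sum>j<D. l2sq (vderiv k (\<lambda>t. \<bar>vderiv 1 G (t + of_nat j)\<bar> *\<^sub>R f (G (t + of_nat j)))))"
        using l2sq_sum_le [OF smooth_continuous_on [OF sm], of "{..<D}"] by simp
      also have "\<dots> \<le> card {..<D} * (\<Sum>j<D. \<Sum>i<Suc k. a i * (\<Lambda> * l2sq (vderiv i f)))"
        by (intro mult_left_mono sum_mono branch f) simp
      also have "\<dots> = M * (\<mu> ^ 2) ^ k * l2sq (vderiv k f) + C' * (\<Sum>i<k. l2sq (vderiv i f))"
        by (simp add: a_def M_def C'_def power_mult_distrib sum_distrib_left mult_ac distrib_left
            flip: power_mult)
      finally show ?thesis .
    qed
    moreover have "C' \<ge> 0" using \<Lambda>(1) by (simp add: C'_def)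
    ultimately show ?thesis by blast
  qed
  moreover have "M \<ge> 0" using \<Lambda>(1) by (simp add: M_def)
  ultimately show ?thesis using that [of M] by (simp add: \<mu>_def)
qed

end

section \<open>The Hilbert space of a weight sequence\<close>

definition l2ip :: "(real \<Rightarrow> complex) \<Rightarrow> (real \<Rightarrow> complex) \<Rightarrow> complex" where
  "l2ip f g = integral {0..1} (\<lambda>t. f t * cnj (g t))"

lemma l2ip_has_integral:
  assumes "continuous_on UNIV f" "continuous_on UNIV g"
  shows "((\<lambda>t. f t * cnj (g t)) has_integral l2ip f g) {0..1}"
  unfolding l2ip_def
  by (intro integrable_integral integrable_continuous_real continuous_intros)
     (auto intro: continuous_on_subset [OF assms(1)] continuous_on_subset [OF assms(2)])

lemma l2ip_add_left:
  assumes "continuous_on UNIV f" "continuous_on UNIV g" "continuous_on UNIV h"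
  shows "l2ip (\<lambda>t. f t + g t) h = l2ip f h + l2ip g h"
  using has_integral_add [OF l2ip_has_integral [OF assms(1,3)] l2ip_has_integral [OF assms(2,3)]]
  by (simp add: l2ip_def integral_unique distrib_right)

lemma l2ip_cmult_left: "l2ip (\<lambda>t. c * f t) g = c * l2ip f g"
  by (simp add: l2ip_def mult.assoc)

lemma l2ip_commute: "l2ip g f = cnj (l2ip f g)"
  unfolding l2ip_def by (subst integral_cnj) (simp add: mult.commute)

lemma l2ip_self:
  assumes "continuous_on UNIV f"
  shows "l2ip f f = of_real (l2sq f)"
proof -
  have "((\<lambda>t. complex_of_real ((norm (f t))\<^sup>2)) has_integral of_real (l2sq f)) {0..1}"
    unfolding l2sq_def
    by (intro has_integral_of_real integrable_integral integrable_norm_sq assms)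
  then show ?thesis
    by (simp add: l2ip_def complex_norm_square integral_unique del: of_real_power)
qed

lemma norm_l2ip_le:
  assumes "continuous_on UNIV f" "continuous_on UNIV g"
  shows "norm (l2ip f g) \<le> l2sq f + l2sq g"
proof -
  have "norm (l2ip f g) \<le> integral {0..1} (\<lambda>t. (norm (f t))\<^sup>2 + (norm (g t))\<^sup>2)"
    unfolding l2ip_def
  proof (rule integral_norm_bound_integral)
    show "(\<lambda>t. f t * cnj (g t)) integrable_on {0..1}"
      using l2ip_has_integral [OF assms] by blast
    show "(\<lambda>t. (norm (f t))\<^sup>2 + (norm (g t))\<^sup>2) integrable_on {0..1}"
      by (intro integrable_add integrable_norm_sq assms)
    show "norm (f t * cnj (g t)) \<le> (norm (f t))\<^sup>2 + (norm (g t))\<^sup>2" for t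
      using sum_squares_bound [of "norm (f t)" "norm (g t)"]
        mult_nonneg_nonneg [OF norm_ge_zero [of "f t"] norm_ge_zero [of "g t"]]
      unfolding norm_mult complex_mod_cnj by linarith
  qed
  also have "\<dots> = l2sq f + l2sq g"
    unfolding l2sq_def by (intro integral_add integrable_norm_sq assms)
  finally show ?thesis .
qed

definition circle_vderiv :: "nat \<Rightarrow> (circle \<Rightarrow> complex) \<Rightarrow> real \<Rightarrow> complex" where
  "circle_vderiv k \<phi> = vderiv k (\<phi> \<circ> to_circle)"

definition circle_energy :: "nat \<Rightarrow> (circle \<Rightarrow> complex) \<Rightarrow> real" where
  "circle_energy k \<phi> = l2sq (circle_vderiv k \<phi>)"

lemma periodic_descends:
  assumes "has_period 1 f"
  obtains \<phi> :: "circle \<Rightarrow> 'b" where "\<phi> \<circ> to_circle = f"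
proof
  show "(\<lambda>x. f (rep_circle x)) \<circ> to_circle = f"
  proof
    fix t
    have "rep_circle (to_circle t) - t \<in> \<int>"
      by (metis Quotient3_abs_rep Quotient3_circle to_circle_eq_iff)
    then obtain n :: int where "rep_circle (to_circle t) = t + of_int n"
      by (metis Ints_cases add.commute diff_add_cancel)
    then show "((\<lambda>x. f (rep_circle x)) \<circ> to_circle) t = f t"
      using has_period_of_int [OF assms, of t n] by simp
  qed
qed

lemma smooth_circle_fun_add:
  "smooth_circle_fun \<phi> \<Longrightarrow> smooth_circle_fun \<psi> \<Longrightarrow> smooth_circle_fun (\<lambda>x. \<phi> x + \<psi> x)"
  using smooth_add by (force simp: smooth_circle_fun_def o_def)

lemma smooth_circle_fun_diff:
  "smooth_circle_fun \<phi> \<Longrightarrow> smooth_circle_fun \<psi> \<Longrightarrow> smooth_circle_fun (\<lambda>x. \<phi> x - \<psi> x)"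
  using smooth_diff by (force simp: smooth_circle_fun_def o_def)

lemma smooth_circle_fun_cmult: "smooth_circle_fun \<phi> \<Longrightarrow> smooth_circle_fun (\<lambda>x. c * \<phi> x)"
  using smooth_cmult by (force simp: smooth_circle_fun_def o_def)

lemma circle_vderiv_add:
  "smooth_circle_fun \<phi> \<Longrightarrow> smooth_circle_fun \<psi> \<Longrightarrow>
    circle_vderiv k (\<lambda>x. \<phi> x + \<psi> x) = (\<lambda>t. circle_vderiv k \<phi> t + circle_vderiv k \<psi> t)"
  using vderiv_add [of "\<phi> \<circ> to_circle" "\<psi> \<circ> to_circle" k]
  by (simp add: smooth_circle_fun_def circle_vderiv_def o_def)

lemma circle_vderiv_diff:
  "smooth_circle_fun \<phi> \<Longrightarrow> smooth_circle_fun \<psi> \<Longrightarrow>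
    circle_vderiv k (\<lambda>x. \<phi> x - \<psi> x) = (\<lambda>t. circle_vderiv k \<phi> t - circle_vderiv k \<psi> t)"
  using vderiv_diff [of "\<phi> \<circ> to_circle" "\<psi> \<circ> to_circle" k]
  by (simp add: smooth_circle_fun_def circle_vderiv_def o_def)

lemma circle_vderiv_cmult:
  "smooth_circle_fun \<phi> \<Longrightarrow> circle_vderiv k (\<lambda>x. c * \<phi> x) = (\<lambda>t. c * circle_vderiv k \<phi> t)"
  using vderiv_cmult [of "\<phi> \<circ> to_circle" k c]
  by (simp add: smooth_circle_fun_def circle_vderiv_def o_def)

lemma circle_vderiv_continuous: "smooth_circle_fun \<phi> \<Longrightarrow> continuous_on S (circle_vderiv k \<phi>)"
  by (simp add: smooth_circle_fun_def circle_vderiv_def smooth_continuous_on)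

lemma circle_energy_nonneg: "circle_energy k \<phi> \<ge> 0"
  by (simp add: circle_energy_def l2sq_nonneg)

lemma circle_energy_add_le:
  "smooth_circle_fun \<phi> \<Longrightarrow> smooth_circle_fun \<psi> \<Longrightarrow>
    circle_energy k (\<lambda>x. \<phi> x + \<psi> x) \<le> 2 * circle_energy k \<phi> + 2 * circle_energy k \<psi>"
  by (simp add: circle_energy_def circle_vderiv_add l2sq_add_le circle_vderiv_continuous)

lemma circle_energy_diff_le:
  "smooth_circle_fun \<phi> \<Longrightarrow> smooth_circle_fun \<psi> \<Longrightarrow>
    circle_energy k (\<lambda>x. \<phi> x - \<psi> x) \<le> 2 * circle_energy k \<phi> + 2 * circle_energy k \<psi>"
  by (simp add: circle_energy_def circle_vderiv_diff l2sq_diff_le circle_vderiv_continuous)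

lemma circle_energy_cmult:
  "smooth_circle_fun \<phi> \<Longrightarrow> circle_energy k (\<lambda>x. c * \<phi> x) = (norm c)\<^sup>2 * circle_energy k \<phi>"
  by (simp add: circle_energy_def circle_vderiv_cmult l2sq_cmult)

lemma norm_circle_vderiv_le:
  "smooth_circle_fun \<phi> \<Longrightarrow> (norm (circle_vderiv k \<phi> t))\<^sup>2 \<le> 2 * circle_energy k \<phi> + circle_energy (Suc k) \<phi>"
  unfolding circle_vderiv_def circle_energy_def smooth_circle_fun_def
  by (rule sobolev_sup_bound_vderiv [OF _ has_period_circle])

lemma smooth_circle_montel:
  assumes smooth: "\<And>i. smooth_circle_fun (\<phi> i)" and bd: "\<And>k. \<exists>B. \<forall>i. circle_energy k (\<phi> i) \<le> B"
  obtains r \<psi> where "strict_mono (r :: nat \<Rightarrow> nat)" "smooth_circle_fun \<psi>"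
    "\<And>k. (\<lambda>i. circle_energy k (\<lambda>x. \<phi> (r i) x - \<psi> x)) \<longlonglongrightarrow> 0"
proof -
  have sm: "smooth_on UNIV (\<phi> i \<circ> to_circle)" for i
    using smooth by (simp add: smooth_circle_fun_def)
  obtain r g where r: "strict_mono (r :: nat \<Rightarrow> nat)" and g: "smooth_on UNIV g" "has_period 1 g"
    and lim: "\<And>k. uniform_limit UNIV (\<lambda>i. vderiv k (\<phi> (r i) \<circ> to_circle)) (vderiv k g) sequentially"
    using smooth_periodic_montel [of "\<lambda>i. \<phi> i \<circ> to_circle"] sm has_period_circle bd
    unfolding circle_energy_def circle_vderiv_def by metis
  obtain \<psi> where \<psi>: "\<psi> \<circ> to_circle = g" using periodic_descends [OF g(2)] by blast
  have "(\<lambda>x. \<phi> (r i) x - \<psi> x) \<circ> to_circle = (\<lambda>t. (\<phi> (r i) \<circ> to_circle) t - g t)" for i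
    using \<psi> by auto
  then have "(\<lambda>i. circle_energy k (\<lambda>x. \<phi> (r i) x - \<psi> x)) \<longlonglongrightarrow> 0" for k
    using uniform_limit_l2sq [OF sm g(1) lim, of k] by (simp add: circle_energy_def circle_vderiv_def)
  moreover have "smooth_circle_fun \<psi>" using \<psi> g(1) by (simp add: smooth_circle_fun_def)
  ultimately show ?thesis using that r by blast
qed

lemma smooth_circle_fun_circle_exp: "smooth_circle_fun (circle_exp n)"
  using smooth_fourier_mode [of n] by (simp add: smooth_circle_fun_def o_def circle_exp_to_circle)

lemma circle_energy_circle_exp: "circle_energy k (circle_exp n) = ((2 * pi * of_int n)\<^sup>2) ^ k"
proof -
  have "circle_vderiv k (circle_exp n) = (\<lambda>t. (2 * of_real pi * \<i> * of_int n) ^ k * fourier_mode n t)"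
    using vderiv_fourier_mode [of k n] by (simp add: circle_vderiv_def o_def circle_exp_to_circle)
  moreover have "(norm ((2 * of_real pi * \<i> * of_int n :: complex) ^ k))\<^sup>2 = ((2 * pi * of_int n)\<^sup>2) ^ k"
  proof -
    have "(norm (2 * of_real pi * \<i> * of_int n :: complex))\<^sup>2 = (2 * pi * of_int n)\<^sup>2"
      by (simp add: norm_mult power_mult_distrib)
    then show ?thesis by (metis norm_power power_mult mult.commute)
  qed
  moreover have "l2sq (fourier_mode n) = 1"
    by (simp add: l2sq_def)
  ultimately show ?thesis
    by (simp only: circle_energy_def l2sq_cmult mult_1_right)
qed

lemma smooth_seminorm_le:
  assumes "\<And>t. norm (circle_vderiv k \<phi> t) \<le> M"
  shows "smooth_seminorm k \<phi> \<le> M"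
  unfolding smooth_seminorm_def using assms by (intro cSUP_least) (auto simp: circle_vderiv_def)

lemma norm_circle_vderiv_le_seminorm:
  assumes "smooth_circle_fun \<phi>"
  shows "norm (circle_vderiv k \<phi> t) \<le> smooth_seminorm k \<phi>"
proof -
  have sm: "smooth_on UNIV (\<phi> \<circ> to_circle)" using assms by (simp add: smooth_circle_fun_def)
  obtain M where "\<And>t. norm (vderiv k (\<phi> \<circ> to_circle) t) \<le> M"
    using has_period_bounded [OF has_period_vderiv [OF sm has_period_circle], of k] smooth_continuous_on [OF sm]
    by (metis zero_less_one)
  then show ?thesis
    unfolding smooth_seminorm_def circle_vderiv_def by (intro cSUP_upper bdd_aboveI2) auto
qed

lemma smooth_seminorm_diff_triangle:
  assumes "smooth_circle_fun \<phi>" "smooth_circle_fun \<psi>" "smooth_circle_fun \<eta>"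
  shows "smooth_seminorm k (\<lambda>x. \<phi> x - \<eta> x) \<le>
    smooth_seminorm k (\<lambda>x. \<phi> x - \<psi> x) + smooth_seminorm k (\<lambda>x. \<psi> x - \<eta> x)"
proof (rule smooth_seminorm_le)
  fix t
  have "circle_vderiv k (\<lambda>x. \<phi> x - \<eta> x) t =
      circle_vderiv k (\<lambda>x. \<phi> x - \<psi> x) t + circle_vderiv k (\<lambda>x. \<psi> x - \<eta> x) t"
    using assms by (simp add: circle_vderiv_diff)
  also have "norm \<dots> \<le> smooth_seminorm k (\<lambda>x. \<phi> x - \<psi> x) + smooth_seminorm k (\<lambda>x. \<psi> x - \<eta> x)"
    using assms by (intro norm_triangle_mono norm_circle_vderiv_le_seminorm smooth_circle_fun_diff)
  finally show "norm (circle_vderiv k (\<lambda>x. \<phi> x - \<eta> x) t) \<le>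
    smooth_seminorm k (\<lambda>x. \<phi> x - \<psi> x) + smooth_seminorm k (\<lambda>x. \<psi> x - \<eta> x)" .
qed

text \<open>The summability condition says that \<open>A\<close> is the coefficient sequence of an entire function; it is what puts
trigonometric polynomials into the space.\<close>

locale derivative_weights =
  fixes A :: "nat \<Rightarrow> real"
  assumes A_pos: "A k > 0" and A_summable: "summable (\<lambda>k. A k * x ^ k)"
begin

definition H :: "(circle \<Rightarrow> complex) set" where
  "H = {\<phi>. smooth_circle_fun \<phi> \<and> summable (\<lambda>k. A k * circle_energy k \<phi>)}"

definition total_energy :: "(circle \<Rightarrow> complex) \<Rightarrow> real" where
  "total_energy \<phi> = (\<Sum>k. A k * circle_energy k \<phi>)"

definition ip :: "(circle \<Rightarrow> complex) \<Rightarrow> (circle \<Rightarrow> complex) \<Rightarrow> complex" where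
  "ip \<phi> \<psi> = (\<Sum>k. of_real (A k) * l2ip (circle_vderiv k \<phi>) (circle_vderiv k \<psi>))"

lemma H_smooth: "\<phi> \<in> H \<Longrightarrow> smooth_circle_fun \<phi>"
  by (simp add: H_def)

lemma H_summable: "\<phi> \<in> H \<Longrightarrow> summable (\<lambda>k. A k * circle_energy k \<phi>)"
  by (simp add: H_def)

lemma weighted_energy_nonneg: "A k * circle_energy k \<phi> \<ge> 0"
  using A_pos [of k] circle_energy_nonneg by simp

lemma H_I:
  assumes "smooth_circle_fun \<phi>" and le: "\<And>n. (\<Sum>k<n. A k * circle_energy k \<phi>) \<le> B"
  shows "\<phi> \<in> H" "total_energy \<phi> \<le> B"
proof -
  have s: "summable (\<lambda>k. A k * circle_energy k \<phi>)"
    using le weighted_energy_nonneg by (intro summableI_nonneg_bounded)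
  then show "\<phi> \<in> H" using assms(1) by (simp add: H_def)
  show "total_energy \<phi> \<le> B" unfolding total_energy_def by (rule suminf_le_const [OF s le])
qed

lemma partial_energy_le: "\<phi> \<in> H \<Longrightarrow> (\<Sum>k<n. A k * circle_energy k \<phi>) \<le> total_energy \<phi>"
  unfolding total_energy_def
  by (intro sum_le_suminf H_summable) (auto simp: weighted_energy_nonneg)

lemma weighted_energy_le: "\<phi> \<in> H \<Longrightarrow> A k * circle_energy k \<phi> \<le> total_energy \<phi>"
  using partial_energy_le [of \<phi> "Suc k"] sum_nonneg [of "{..<k}" "\<lambda>k. A k * circle_energy k \<phi>"]
    weighted_energy_nonneg by force

lemma total_energy_nonneg: "\<phi> \<in> H \<Longrightarrow> total_energy \<phi> \<ge> 0"
  using partial_energy_le [of \<phi> 0] by simp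

lemma H_add:
  assumes "\<phi> \<in> H" "\<psi> \<in> H"
  shows "(\<lambda>x. \<phi> x + \<psi> x) \<in> H" "total_energy (\<lambda>x. \<phi> x + \<psi> x) \<le> 2 * total_energy \<phi> + 2 * total_energy \<psi>"
proof -
  have "(\<Sum>k<n. A k * circle_energy k (\<lambda>x. \<phi> x + \<psi> x)) \<le> 2 * total_energy \<phi> + 2 * total_energy \<psi>" for n
  proof -
    have "(\<Sum>k<n. A k * circle_energy k (\<lambda>x. \<phi> x + \<psi> x)) \<le>
        (\<Sum>k<n. A k * (2 * circle_energy k \<phi> + 2 * circle_energy k \<psi>))"
      using assms A_pos by (intro sum_mono mult_left_mono circle_energy_add_le H_smooth) (auto simp: less_imp_le)
    also have "\<dots> = 2 * (\<Sum>k<n. A k * circle_energy k \<phi>) + 2 * (\<Sum>k<n. A k * circle_energy k \<psi>)"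
      by (simp add: sum_distrib_left sum.distrib distrib_left mult_ac)
    finally show ?thesis using partial_energy_le [OF assms(1), of n] partial_energy_le [OF assms(2), of n] by linarith
  qed
  then show "(\<lambda>x. \<phi> x + \<psi> x) \<in> H" "total_energy (\<lambda>x. \<phi> x + \<psi> x) \<le> 2 * total_energy \<phi> + 2 * total_energy \<psi>"
    using H_I [OF smooth_circle_fun_add [OF assms [THEN H_smooth]]] by blast+
qed

lemma H_cmult: "\<phi> \<in> H \<Longrightarrow> (\<lambda>x. c * \<phi> x) \<in> H"
  using summable_mult [of "\<lambda>k. A k * circle_energy k \<phi>" "(norm c)\<^sup>2"]
  by (simp add: H_def smooth_circle_fun_cmult circle_energy_cmult mult_ac)

lemma H_zero: "(\<lambda>x. 0) \<in> H"
proof -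
  have "circle_energy k (\<lambda>x. 0) = 0" for k
    by (simp add: circle_energy_def circle_vderiv_def o_def vderiv_zero l2sq_def)
  then show ?thesis by (simp add: H_def smooth_circle_fun_def o_def)
qed

lemma H_subspace: "function_subspace H"
  using H_zero H_add(1) H_cmult by (simp add: function_subspace_def)

lemma H_diff: "\<phi> \<in> H \<Longrightarrow> \<psi> \<in> H \<Longrightarrow> (\<lambda>x. \<phi> x - \<psi> x) \<in> H"
  by (rule subspace_diff [OF H_subspace])

lemma total_energy_diff_le:
  assumes "\<phi> \<in> H" "\<psi> \<in> H"
  shows "total_energy (\<lambda>x. \<phi> x - \<psi> x) \<le> 2 * total_energy \<phi> + 2 * total_energy \<psi>"
proof -
  have "total_energy (\<lambda>x. - 1 * \<psi> x) = total_energy \<psi>"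
    unfolding total_energy_def using circle_energy_cmult [OF H_smooth [OF assms(2)], of _ "- 1"] by simp
  then show ?thesis using H_add(2) [OF assms(1) H_cmult [OF assms(2), of "- 1"]] by simp
qed

lemma ip_summable:
  assumes "\<phi> \<in> H" "\<psi> \<in> H"
  shows "summable (\<lambda>k. of_real (A k) * l2ip (circle_vderiv k \<phi>) (circle_vderiv k \<psi>))"
proof (rule summable_comparison_test')
  show "summable (\<lambda>k. A k * circle_energy k \<phi> + A k * circle_energy k \<psi>)"
    using assms by (intro summable_add H_summable)
  show "norm (of_real (A k) * l2ip (circle_vderiv k \<phi>) (circle_vderiv k \<psi>)) \<le>
      A k * circle_energy k \<phi> + A k * circle_energy k \<psi>" for k
    using norm_l2ip_le [OF circle_vderiv_continuous circle_vderiv_continuous] assms [THEN H_smooth] A_pos [of k]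
    by (simp add: norm_mult circle_energy_def flip: distrib_left)
qed

lemma ip_self:
  assumes "\<phi> \<in> H"
  shows "ip \<phi> \<phi> = of_real (total_energy \<phi>)"
proof -
  have "(\<lambda>k. of_real (A k * circle_energy k \<phi>)) sums complex_of_real (total_energy \<phi>)"
    unfolding total_energy_def by (intro sums_of_real summable_sums H_summable assms)
  then show ?thesis
    unfolding ip_def using assms
    by (simp add: l2ip_self circle_vderiv_continuous H_smooth circle_energy_def sums_iff)
qed

lemma total_energy_eq_0:
  assumes "\<phi> \<in> H" "total_energy \<phi> \<le> 0"
  shows "\<phi> = (\<lambda>x. 0)"
proof
  fix x
  have "circle_energy k \<phi> = 0" for k
    using weighted_energy_le [OF assms(1), of k] assms(2) A_pos [of k] circle_energy_nonneg [of k \<phi>]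
    by (smt (verit) mult_pos_pos)
  then have "circle_vderiv 0 \<phi> t = 0" for t
    using norm_circle_vderiv_le [OF H_smooth [OF assms(1)], of 0 t] by simp
  then have "\<phi> (to_circle t) = 0" for t
    by (simp add: circle_vderiv_def)
  then show "\<phi> x = 0" using to_circle_surj [of x] by metis
qed

lemma H_inner_product: "complex_inner_product H ip"
  unfolding complex_inner_product_def
proof (intro conjI ballI allI impI)
  fix f g h assume fgh: "f \<in> H" "g \<in> H" "h \<in> H"
  show "ip (\<lambda>x. f x + g x) h = ip f h + ip g h"
    unfolding ip_def using fgh
    by (subst suminf_add [OF ip_summable ip_summable])
       (auto simp: circle_vderiv_add H_smooth l2ip_add_left circle_vderiv_continuous distrib_left)
next
  fix c f g assume fg: "f \<in> H" "g \<in> H"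
  have "ip (\<lambda>x. c * f x) g = (\<Sum>k. c * (of_real (A k) * l2ip (circle_vderiv k f) (circle_vderiv k g)))"
    unfolding ip_def using fg by (simp add: circle_vderiv_cmult H_smooth l2ip_cmult_left mult_ac)
  then show "ip (\<lambda>x. c * f x) g = c * ip f g"
    unfolding ip_def using suminf_mult [OF ip_summable [OF fg]] by simp
next
  fix f g assume fg: "f \<in> H" "g \<in> H"
  have "(\<lambda>k. cnj (of_real (A k) * l2ip (circle_vderiv k f) (circle_vderiv k g))) sums cnj (ip f g)"
    unfolding ip_def sums_cnj by (rule summable_sums [OF ip_summable [OF fg]])
  moreover have "cnj (of_real (A k) * l2ip (circle_vderiv k f) (circle_vderiv k g)) =
      of_real (A k) * l2ip (circle_vderiv k g) (circle_vderiv k f)" for k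
    using l2ip_commute [of "circle_vderiv k g" "circle_vderiv k f"] by simp
  ultimately have "(\<lambda>k. of_real (A k) * l2ip (circle_vderiv k g) (circle_vderiv k f)) sums cnj (ip f g)"
    by (simp only:)
  then show "ip g f = cnj (ip f g)"
    unfolding ip_def [of g f] by (rule sums_unique [symmetric])
next
  fix f assume "f \<in> H" "f \<noteq> (\<lambda>x. 0)"
  then have "\<not> total_energy f \<le> 0" using total_energy_eq_0 by blast
  then show "Re (ip f f) > 0" using \<open>f \<in> H\<close> by (simp add: ip_self)
qed

sublocale Metric_space H "ip_dist H ip"
  by (rule ip_metric_space [OF H_subspace H_inner_product])

lemma dist_eq: "\<phi> \<in> H \<Longrightarrow> \<psi> \<in> H \<Longrightarrow> ip_dist H ip \<phi> \<psi> = sqrt (total_energy (\<lambda>x. \<phi> x - \<psi> x))"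
  by (simp add: ip_dist_def ip_self H_diff)

text \<open>Lower semicontinuity of the norm, up to a factor that comes from the use of squared norms.\<close>

lemma H_limit:
  assumes i: "\<And>i. \<phi> i \<in> H" "\<And>i. total_energy (\<phi> i) \<le> B" and \<psi>: "smooth_circle_fun \<psi>"
    and lim: "\<And>k. (\<lambda>i. circle_energy k (\<lambda>x. \<phi> i x - \<psi> x)) \<longlonglongrightarrow> 0"
  shows "\<psi> \<in> H" "total_energy \<psi> \<le> 2 * B"
proof -
  have "(\<Sum>k<n. A k * circle_energy k \<psi>) \<le> 2 * B" for n
  proof (rule LIMSEQ_le_const)
    show "(\<lambda>i. 2 * B + 2 * (\<Sum>k<n. A k * circle_energy k (\<lambda>x. \<phi> i x - \<psi> x))) \<longlonglongrightarrow> 2 * B"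
      by (rule tendsto_eq_intros lim refl)+ simp
    have "(\<Sum>k<n. A k * circle_energy k \<psi>) \<le>
        2 * B + 2 * (\<Sum>k<n. A k * circle_energy k (\<lambda>x. \<phi> i x - \<psi> x))" for i
    proof -
      have "circle_energy k \<psi> \<le> 2 * circle_energy k (\<phi> i) + 2 * circle_energy k (\<lambda>x. \<phi> i x - \<psi> x)" for k
        using circle_energy_diff_le [OF H_smooth [OF i(1)] smooth_circle_fun_diff [OF H_smooth [OF i(1)] \<psi>], of k i i]
        by simp
      then have "(\<Sum>k<n. A k * circle_energy k \<psi>) \<le>
          (\<Sum>k<n. A k * (2 * circle_energy k (\<phi> i) + 2 * circle_energy k (\<lambda>x. \<phi> i x - \<psi> x)))"
        using A_pos by (intro sum_mono mult_left_mono) (auto simp: less_imp_le)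
      also have "\<dots> = 2 * (\<Sum>k<n. A k * circle_energy k (\<phi> i)) + 2 * (\<Sum>k<n. A k * circle_energy k (\<lambda>x. \<phi> i x - \<psi> x))"
        by (simp add: sum_distrib_left sum.distrib distrib_left mult_ac)
      finally show ?thesis using partial_energy_le [OF i(1) [of i], of n] i(2) [of i] by linarith
    qed
    then show "\<exists>N. \<forall>i\<ge>N. (\<Sum>k<n. A k * circle_energy k \<psi>) \<le>
        2 * B + 2 * (\<Sum>k<n. A k * circle_energy k (\<lambda>x. \<phi> i x - \<psi> x))" by blast
  qed
  then show "\<psi> \<in> H" "total_energy \<psi> \<le> 2 * B" using H_I [OF \<psi>] by blast+
qed

text \<open>A bound on the norm bounds each \<open>L\<^sup>2\<close> norm of a derivative, with a constant that depends on its order.\<close>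

lemma H_ball_compact:
  assumes i: "\<And>i. \<phi> i \<in> H" "\<And>i. total_energy (\<phi> i) \<le> B"
  obtains r \<psi> where "strict_mono (r :: nat \<Rightarrow> nat)" "\<psi> \<in> H"
    "\<And>k. (\<lambda>i. circle_energy k (\<lambda>x. \<phi> (r i) x - \<psi> x)) \<longlonglongrightarrow> 0"
proof -
  have bd: "\<exists>B. \<forall>i. circle_energy k (\<phi> i) \<le> B" for k
  proof -
    have "circle_energy k (\<phi> i) \<le> B / A k" for i
      using weighted_energy_le [OF i(1), of k i] i(2) [of i] A_pos [of k] by (simp add: field_simps)
    then show ?thesis by blast
  qed
  obtain r \<psi> where r: "strict_mono (r :: nat \<Rightarrow> nat)" "smooth_circle_fun \<psi>"
    "\<And>k. (\<lambda>i. circle_energy k (\<lambda>x. \<phi> (r i) x - \<psi> x)) \<longlonglongrightarrow> 0"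
    using smooth_circle_montel [OF H_smooth [OF i(1)] bd] by blast
  have "\<psi> \<in> H"
    by (rule H_limit(1) [of "\<lambda>i. \<phi> (r i)", OF i(1) i(2) r(2) r(3)])
  then show ?thesis using that r by blast
qed

text \<open>Compactness provides a limit of a subsequence for each derivative separately; lower semicontinuity applied to
the differences \<open>\<sigma> i - \<sigma> j\<close> upgrades this to convergence of the whole Cauchy sequence in the norm.\<close>

lemma H_mcomplete: "mcomplete"
  unfolding mcomplete_def
proof (intro allI impI)
  fix \<sigma> assume "MCauchy \<sigma>"
  then have \<sigma>: "\<sigma> i \<in> H" and cauchy: "\<And>e. e > 0 \<Longrightarrow> \<exists>N. \<forall>i j. N \<le> i \<longrightarrow> N \<le> j \<longrightarrow> ip_dist H ip (\<sigma> i) (\<sigma> j) < e" for i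
    by (auto simp: MCauchy_def)
  have cauchy': "\<exists>N. \<forall>i\<ge>N. \<forall>j\<ge>N. total_energy (\<lambda>x. \<sigma> i x - \<sigma> j x) \<le> e" if "e > 0" for e
  proof -
    obtain N where N: "\<And>i j. N \<le> i \<Longrightarrow> N \<le> j \<Longrightarrow> ip_dist H ip (\<sigma> i) (\<sigma> j) < sqrt e"
      using cauchy [of "sqrt e"] \<open>e > 0\<close> by auto
    then have "total_energy (\<lambda>x. \<sigma> i x - \<sigma> j x) \<le> e" if "i \<ge> N" "j \<ge> N" for i j
      using N [OF that] by (simp add: dist_eq \<sigma>)
    then show ?thesis by blast
  qed
  obtain N where N: "\<And>i j. i \<ge> N \<Longrightarrow> j \<ge> N \<Longrightarrow> total_energy (\<lambda>x. \<sigma> i x - \<sigma> j x) \<le> 1"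
    using cauchy' [of 1] by auto
  have bd: "total_energy (\<sigma> (N + i)) \<le> 2 * 1 + 2 * total_energy (\<sigma> N)" for i
    using H_add(2) [OF H_diff [OF \<sigma> \<sigma>] \<sigma>, of "N + i" N N] N [of "N + i" N] by simp
  obtain r \<psi> where r: "strict_mono (r :: nat \<Rightarrow> nat)" and \<psi>: "\<psi> \<in> H"
    and lim: "\<And>k. (\<lambda>i. circle_energy k (\<lambda>x. \<sigma> (N + r i) x - \<psi> x)) \<longlonglongrightarrow> 0"
    by (rule H_ball_compact [of "\<lambda>i. \<sigma> (N + i)", OF \<sigma> bd]) (rule that)
  have "limitin mtopology \<sigma> \<psi> sequentially"
    unfolding limitin_metric eventually_sequentially
  proof (intro conjI allI impI \<psi>)
    fix e :: real assume e: "e > 0"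
    obtain M where M: "\<And>i j. i \<ge> M \<Longrightarrow> j \<ge> M \<Longrightarrow> total_energy (\<lambda>x. \<sigma> i x - \<sigma> j x) \<le> e\<^sup>2 / 4"
      using cauchy' [of "e\<^sup>2 / 4"] e by auto
    have "\<sigma> i \<in> H \<and> ip_dist H ip (\<sigma> i) \<psi> < e" if "i \<ge> M" for i
    proof -
      \<comment> \<open>the shift of the index by \<open>M\<close> puts the whole subsequence into the range where \<open>\<sigma>\<close> is \<open>e\<^sup>2 / 4\<close>-close\<close>
      have le: "M \<le> N + r (j + M)" for j
        using seq_suble [OF r, of "j + M"] by linarith
      have "total_energy (\<lambda>x. \<sigma> i x - \<psi> x) \<le> 2 * (e\<^sup>2 / 4)"
      proof (rule H_limit(2))
        show "(\<lambda>x. \<sigma> i x - \<sigma> (N + r (j + M)) x) \<in> H" for j by (rule H_diff [OF \<sigma> \<sigma>])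
        show "total_energy (\<lambda>x. \<sigma> i x - \<sigma> (N + r (j + M)) x) \<le> e\<^sup>2 / 4" for j by (rule M [OF that le])
        show "smooth_circle_fun (\<lambda>x. \<sigma> i x - \<psi> x)" by (rule H_smooth [OF H_diff [OF \<sigma> \<psi>]])
        fix k
        have "circle_energy k (\<lambda>x. (\<sigma> i x - \<sigma> (N + r (j + M)) x) - (\<sigma> i x - \<psi> x)) =
            circle_energy k (\<lambda>x. \<sigma> (N + r (j + M)) x - \<psi> x)" for j
          using circle_energy_cmult [OF H_smooth [OF H_diff [OF \<sigma> [of "N + r (j + M)"] \<psi>]], of k "- 1"] by simp
        then show "(\<lambda>j. circle_energy k (\<lambda>x. (\<sigma> i x - \<sigma> (N + r (j + M)) x) - (\<sigma> i x - \<psi> x))) \<longlonglongrightarrow> 0"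
          using LIMSEQ_ignore_initial_segment [OF lim [of k], of M] by simp
      qed
      then have "total_energy (\<lambda>x. \<sigma> i x - \<psi> x) < e\<^sup>2"
        using zero_less_power [OF e, of 2] by linarith
      then have "sqrt (total_energy (\<lambda>x. \<sigma> i x - \<psi> x)) < e"
        using e by (simp add: real_sqrt_less_iff real_less_lsqrt total_energy_nonneg H_diff \<sigma> \<psi>)
      then show ?thesis by (simp add: dist_eq \<sigma> \<psi>)
    qed
    then show "\<exists>M. \<forall>i\<ge>M. \<sigma> i \<in> H \<and> ip_dist H ip (\<sigma> i) \<psi> < e" by blast
  qed
  then show "\<exists>x. limitin mtopology \<sigma> x sequentially" by blast
qed

lemma H_hilbert: "hilbert_function_space H ip"
  unfolding hilbert_function_space_def using H_subspace H_inner_product H_mcomplete by blast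

text \<open>Tannery's theorem for the series that defines the squared norm.\<close>

lemma H_dominated_convergence:
  assumes "\<And>i. \<phi> i \<in> H" and "\<psi> \<in> H"
    and lim: "\<And>k. (\<lambda>i. circle_energy k (\<lambda>x. \<phi> i x - \<psi> x)) \<longlonglongrightarrow> 0"
    and dom: "\<And>k i. A k * circle_energy k (\<lambda>x. \<phi> i x - \<psi> x) \<le> s k" and "summable s"
  shows "limitin mtopology \<phi> \<psi> sequentially"
proof -
  let ?a = "\<lambda>k i. A k * circle_energy k (\<lambda>x. \<phi> i x - \<psi> x)"
  have "(\<lambda>i. ?a k i) \<longlonglongrightarrow> 0" for k
    using tendsto_mult_right_zero [OF lim] by simp
  moreover have "\<forall>\<^sub>F (k, i) in at_top \<times>\<^sub>F sequentially. norm (?a k i) \<le> s k"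
    using dom weighted_energy_nonneg by (intro always_eventually) auto
  ultimately have "(\<lambda>i. \<Sum>k. ?a k i) \<longlonglongrightarrow> (\<Sum>k. 0)"
    using tannerys_theorem [of ?a "\<lambda>k. 0" sequentially s] \<open>summable s\<close> by auto
  then have "(\<lambda>i. sqrt (total_energy (\<lambda>x. \<phi> i x - \<psi> x))) \<longlonglongrightarrow> sqrt 0"
    unfolding total_energy_def by (intro tendsto_real_sqrt) simp
  then show ?thesis
    using assms(1,2) by (simp add: limitin_metric_dist_null dist_eq)
qed

lemma circle_exp_in_H: "circle_exp n \<in> H"
  by (simp add: H_def smooth_circle_fun_circle_exp circle_energy_circle_exp A_summable)

lemma trig_polys_subset_H: "trig_polys \<subseteq> H"
proof -
  have "(\<lambda>x. \<Sum>n\<in>N. c n * circle_exp n x) \<in> H" if "finite N" for N and c :: "int \<Rightarrow> complex"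
    using that
    by (induction N rule: finite_induct) (simp_all add: H_zero H_add(1) H_cmult circle_exp_in_H)
  then show ?thesis by (auto simp: trig_polys_def)
qed

lemma trig_polys_dense: "mtopology closure_of trig_polys = H"
proof (intro equalityI subsetI)
  fix \<phi> assume \<phi>: "\<phi> \<in> H"
  define S where "S i = (\<lambda>x. \<Sum>n\<in>{- int i..int i}. fourier_coeff (\<phi> \<circ> to_circle) n * circle_exp n x)" for i
  have S: "S i \<in> trig_polys" for i unfolding S_def trig_polys_def by blast
  have S_H: "S i \<in> H" for i using S trig_polys_subset_H by blast
  have sm: "smooth_on UNIV (\<phi> \<circ> to_circle)" using H_smooth [OF \<phi>] by (simp add: smooth_circle_fun_def)
  have lift: "(\<lambda>x. \<phi> x - S i x) \<circ> to_circle =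
      (\<lambda>t. (\<phi> \<circ> to_circle) t - fourier_sum {- int i..int i} (\<phi> \<circ> to_circle) t)" for i
    by (auto simp: S_def fourier_sum_def circle_exp_to_circle)
  obtain r where "strict_mono (r :: nat \<Rightarrow> nat)"
    and r: "\<And>k. (\<lambda>i. circle_energy k (\<lambda>x. \<phi> x - S (r i) x)) \<longlonglongrightarrow> 0"
    using fourier_sums_converge_smoothly [OF sm has_period_circle]
    unfolding circle_energy_def circle_vderiv_def lift by blast
  have sym: "circle_energy k (\<lambda>x. S i x - \<phi> x) = circle_energy k (\<lambda>x. \<phi> x - S i x)" for k i
    using circle_energy_cmult [OF H_smooth [OF H_diff [OF \<phi> S_H]], of k "- 1" i] by simp
  have "circle_energy k (\<lambda>x. \<phi> x - S i x) \<le> circle_energy k \<phi>" for k i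
    unfolding circle_energy_def circle_vderiv_def lift vderiv_diff [OF sm smooth_fourier_sum]
      vderiv_fourier_sum [OF sm has_period_circle]
    by (intro l2sq_minus_fourier_sum_le smooth_continuous_on sm) simp
  then have "limitin mtopology (\<lambda>i. S (r i)) \<phi> sequentially"
    using r A_pos H_summable [OF \<phi>]
    by (intro H_dominated_convergence [where s = "\<lambda>k. A k * circle_energy k \<phi>"] S_H \<phi>)
       (auto simp: sym less_imp_le mult_left_mono)
  then show "\<phi> \<in> mtopology closure_of trig_polys"
    unfolding limitin_metric metric_closure_of eventually_sequentially in_mball mem_Collect_eq
    using S \<phi> commute by (metis order_refl)
qed (use closure_of_subset_topspace [of mtopology] in auto)

lemma H_continuous_inclusion: "continuous_map (hilbert_topology H ip) smooth_topology (\<lambda>\<phi>. \<phi>)"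
  unfolding smooth_topology_def continuous_on_generated_topo_iff hilbert_topology_def
proof (intro conjI allI impI)
  fix U assume "U \<in> {{\<psi>. smooth_circle_fun \<psi> \<and> smooth_seminorm k (\<lambda>x. \<psi> x - \<phi> x) < r} | k \<phi> r.
      smooth_circle_fun \<phi> \<and> r > 0}"
  then obtain k \<phi> r where U: "U = {\<psi>. smooth_circle_fun \<psi> \<and> smooth_seminorm k (\<lambda>x. \<psi> x - \<phi> x) < r}"
    and \<phi>: "smooth_circle_fun \<phi>" by blast
  have "\<exists>e>0. mball \<psi> e \<subseteq> U \<inter> H" if "\<psi> \<in> U \<inter> H" for \<psi>
  proof -
    \<comment> \<open>\<open>K\<close> is the constant with which the norm of \<open>H\<close> controls the \<open>k\<close>-th seminorm, by the Sobolev inequality\<close>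
    define K where "K = 2 / A k + 1 / A (Suc k)"
    have K: "K > 0" using A_pos by (simp add: K_def add_pos_pos)
    define \<delta> where "\<delta> = r - smooth_seminorm k (\<lambda>x. \<psi> x - \<phi> x)"
    have \<delta>: "\<delta> > 0" and \<psi>: "\<psi> \<in> H" using that by (auto simp: U \<delta>_def)
    have "\<eta> \<in> U" if "\<eta> \<in> mball \<psi> (\<delta> / 2 / sqrt K)" for \<eta>
    proof -
      have \<eta>: "\<eta> \<in> H" and d: "sqrt (total_energy (\<lambda>x. \<eta> x - \<psi> x)) < \<delta> / 2 / sqrt K"
        using that dist_eq [of \<eta> \<psi>] commute by auto
      have "smooth_seminorm k (\<lambda>x. \<eta> x - \<psi> x) \<le> \<delta> / 2"
      proof (rule smooth_seminorm_le)
        fix t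
        let ?u = "\<lambda>x. \<eta> x - \<psi> x"
        have u: "?u \<in> H" using \<eta> \<psi> by (rule H_diff)
        have le: "circle_energy j ?u \<le> total_energy ?u / A j" for j
          using weighted_energy_le [OF u, of j] A_pos [of j] by (simp add: field_simps)
        have "K * total_energy ?u = 2 * (total_energy ?u / A k) + total_energy ?u / A (Suc k)"
          by (simp add: K_def distrib_right)
        then have "2 * circle_energy k ?u + circle_energy (Suc k) ?u \<le> K * total_energy ?u"
          using le [of k] le [of "Suc k"] by linarith
        then have "(norm (circle_vderiv k ?u t))\<^sup>2 \<le> K * total_energy ?u"
          using norm_circle_vderiv_le [OF H_smooth [OF u], of k t] by linarith
        then have "norm (circle_vderiv k ?u t) \<le> sqrt K * sqrt (total_energy ?u)"
          by (simp add: real_le_rsqrt flip: real_sqrt_mult)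
        also have "\<dots> \<le> sqrt K * (\<delta> / 2 / sqrt K)" using d K by (intro mult_left_mono) auto
        finally show "norm (circle_vderiv k ?u t) \<le> \<delta> / 2" using K by simp
      qed
      then have "smooth_seminorm k (\<lambda>x. \<eta> x - \<phi> x) < r"
      proof -
        have "a < r" if "b \<le> (r - b') / 2" "a \<le> b + b'" "0 < r - b'" for a b b' :: real
          using that by (simp add: field_simps)
        from this [OF _ smooth_seminorm_diff_triangle [OF H_smooth [OF \<eta>] H_smooth [OF \<psi>] \<phi>, of k]]
        show ?thesis using \<open>smooth_seminorm k (\<lambda>x. \<eta> x - \<psi> x) \<le> \<delta> / 2\<close> \<delta> by (simp only: \<delta>_def)
      qed
      then show ?thesis using H_smooth [OF \<eta>] by (simp add: U)
    qed
    then have "mball \<psi> (\<delta> / 2 / sqrt K) \<subseteq> U \<inter> H"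
      by (meson Int_iff mball_subset_mspace subset_iff)
    moreover have "\<delta> / 2 / sqrt K > 0" using \<delta> K by simp
    ultimately show ?thesis by (intro exI [of _ "\<delta> / 2 / sqrt K"] conjI)
  qed
  then have "openin mtopology (U \<inter> H)"
    unfolding openin_mtopology by (intro conjI allI impI Int_lower2)
  then show "openin mtopology ((\<lambda>\<phi>. \<phi>) -` U \<inter> topspace mtopology)"
    by simp
next
  show "(\<lambda>\<phi>. \<phi>) ` topspace mtopology \<subseteq> \<Union> {{\<psi>. smooth_circle_fun \<psi> \<and>
      smooth_seminorm k (\<lambda>x. \<psi> x - \<phi> x) < r} | k \<phi> r. smooth_circle_fun \<phi> \<and> r > 0}"
  proof
    fix \<phi> assume "\<phi> \<in> (\<lambda>\<phi>. \<phi>) ` topspace mtopology"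
    then have \<phi>: "smooth_circle_fun \<phi>" by (simp add: H_smooth)
    have "smooth_seminorm 0 (\<lambda>x. \<phi> x - \<phi> x) \<le> 0"
      by (rule smooth_seminorm_le) (simp add: circle_vderiv_def o_def)
    then have "\<phi> \<in> {\<psi>. smooth_circle_fun \<psi> \<and> smooth_seminorm 0 (\<lambda>x. \<psi> x - \<phi> x) < 1}"
      using \<phi> by simp
    moreover have "{\<psi>. smooth_circle_fun \<psi> \<and> smooth_seminorm 0 (\<lambda>x. \<psi> x - \<phi> x) < 1} \<in>
        {{\<psi>. smooth_circle_fun \<psi> \<and> smooth_seminorm k (\<lambda>x. \<psi> x - \<phi> x) < r} | k \<phi> r.
          smooth_circle_fun \<phi> \<and> r > 0}"
      by (rule CollectI, rule exI [of _ 0], rule exI [of _ \<phi>], rule exI [of _ 1]) (simp add: \<phi>)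
    ultimately show "\<phi> \<in> \<Union> {{\<psi>. smooth_circle_fun \<psi> \<and>
        smooth_seminorm k (\<lambda>x. \<psi> x - \<phi> x) < r} | k \<phi> r. smooth_circle_fun \<phi> \<and> r > 0}"
      by (rule UnionI [rotated])
  qed
qed

text \<open>The assumption on the weights absorbs the lower order terms: they contribute at most \<open>(1 / 2) ^ k\<close> times the total
energy to the \<open>k\<close>-th term. So the \<open>k\<close>-th term of the norm of \<open>L \<phi>\<close> is at most a summable sequence times the
total energy of \<open>\<phi>\<close>. This dominates, uniformly on bounded sets, and a subsequence that converges in each
derivative is mapped to a convergent one.\<close>

lemma compact_operator_criterion:
  assumes smooth: "\<And>\<phi>. smooth_circle_fun \<phi> \<Longrightarrow> smooth_circle_fun (L \<phi>)"
    and add: "\<And>\<phi> \<psi>. L (\<lambda>x. \<phi> x + \<psi> x) = (\<lambda>x. L \<phi> x + L \<psi> x)"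
    and scale: "\<And>c \<phi>. L (\<lambda>x. c * \<phi> x) = (\<lambda>x. c * L \<phi> x)"
    and bound: "\<And>k \<phi>. smooth_circle_fun \<phi> \<Longrightarrow>
      circle_energy k (L \<phi>) \<le> M * \<theta> ^ k * circle_energy k \<phi> + C k * (\<Sum>i<k. circle_energy i \<phi>)"
    and "M \<ge> 0" "0 \<le> \<theta>" "\<theta> < 1" "\<And>k. C k \<ge> 0"
    and A_C: "\<And>i k. i < k \<Longrightarrow> A k * C k \<le> (1 / 2) ^ k * A i"
  shows "compact_operator_on H ip L"
proof -
  define s where "s k = M * \<theta> ^ k + (1 / 2) ^ k" for k
  have s: "summable s"
    unfolding s_def using \<open>0 \<le> \<theta>\<close> \<open>\<theta> < 1\<close> by (intro summable_add summable_mult summable_geometric) auto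
  have dom: "A k * circle_energy k (L \<phi>) \<le> s k * total_energy \<phi>" if \<phi>: "\<phi> \<in> H" for k \<phi>
  proof -
    have "A k * circle_energy k (L \<phi>) \<le>
        A k * (M * \<theta> ^ k * circle_energy k \<phi> + C k * (\<Sum>i<k. circle_energy i \<phi>))"
      using A_pos [of k] bound [OF H_smooth [OF \<phi>], of k] by simp
    also have "\<dots> = M * \<theta> ^ k * (A k * circle_energy k \<phi>) + (\<Sum>i<k. A k * C k * circle_energy i \<phi>)"
      by (simp add: sum_distrib_left algebra_simps)
    also have "\<dots> \<le> M * \<theta> ^ k * total_energy \<phi> + (\<Sum>i<k. (1 / 2) ^ k * A i * circle_energy i \<phi>)"
      using weighted_energy_le [OF \<phi>] A_C circle_energy_nonneg assms(5,6)
      by (intro add_mono mult_left_mono sum_mono mult_right_mono) auto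
    also have "(\<Sum>i<k. (1 / 2) ^ k * A i * circle_energy i \<phi>) = (1 / 2) ^ k * (\<Sum>i<k. A i * circle_energy i \<phi>)"
      by (simp add: sum_distrib_left mult.assoc)
    also have "\<dots> \<le> (1 / 2) ^ k * total_energy \<phi>"
      by (intro mult_left_mono partial_energy_le \<phi>) simp
    finally show ?thesis by (simp add: s_def distrib_right)
  qed
  have L_H: "L \<phi> \<in> H" if "\<phi> \<in> H" for \<phi>
  proof -
    have "summable (\<lambda>k. A k * circle_energy k (L \<phi>))"
    proof (rule summable_comparison_test' [OF summable_mult2 [OF s]])
      show "norm (A k * circle_energy k (L \<phi>)) \<le> s k * total_energy \<phi>" for k
        using dom [OF that, of k] weighted_energy_nonneg [of k "L \<phi>"] by simp
    qed
    then show ?thesis using smooth [OF H_smooth [OF that]] by (simp add: H_def)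
  qed
  have L_diff: "L (\<lambda>x. \<phi> x - \<psi> x) = (\<lambda>x. L \<phi> x - L \<psi> x)" for \<phi> \<psi>
    using add [of \<phi> "\<lambda>x. - 1 * \<psi> x"] scale [of "- 1" \<psi>] by simp
  have "mtotally_bounded (L ` B)" if B: "mbounded B" for B
    unfolding mtotally_bounded_sequentially
  proof (intro conjI allI impI)
    have B_H: "B \<subseteq> H" using B by (simp add: mbounded_subset_mspace)
    then show "L ` B \<subseteq> H" using L_H by blast
    fix \<sigma> :: "nat \<Rightarrow> circle \<Rightarrow> complex" assume "range \<sigma> \<subseteq> L ` B"
    then have "\<forall>i. \<exists>\<phi>. \<phi> \<in> B \<and> \<sigma> i = L \<phi>" by blast
    then obtain \<phi> where \<phi>: "\<And>i. \<phi> i \<in> B" "\<And>i. \<sigma> i = L (\<phi> i)" by metis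
    have \<phi>_H: "\<phi> i \<in> H" for i using \<phi>(1) B_H by blast
    obtain R where R: "\<And>f g. f \<in> B \<Longrightarrow> g \<in> B \<Longrightarrow> ip_dist H ip f g \<le> R"
      using B unfolding mbounded_alt by blast
    have bd: "total_energy (\<phi> i) \<le> 2 * R\<^sup>2 + 2 * total_energy (\<phi> 0)" for i
    proof -
      have "sqrt (total_energy (\<lambda>x. \<phi> i x - \<phi> 0 x)) \<le> R"
        using R [OF \<phi>(1) \<phi>(1), of i 0] by (simp add: dist_eq \<phi>_H)
      then have "total_energy (\<lambda>x. \<phi> i x - \<phi> 0 x) \<le> R\<^sup>2"
        by (rule sqrt_le_D)
      then show ?thesis
        using H_add(2) [OF H_diff [OF \<phi>_H \<phi>_H] \<phi>_H, of i 0 0] by simp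
    qed
    obtain r \<psi> where r: "strict_mono (r :: nat \<Rightarrow> nat)" and \<psi>: "\<psi> \<in> H"
      and lim: "\<And>k. (\<lambda>i. circle_energy k (\<lambda>x. \<phi> (r i) x - \<psi> x)) \<longlonglongrightarrow> 0"
      by (rule H_ball_compact [of \<phi>, OF \<phi>_H bd]) (rule that)
    define K where "K = 2 * (2 * R\<^sup>2 + 2 * total_energy (\<phi> 0)) + 2 * total_energy \<psi>"
    have K: "total_energy (\<lambda>x. \<phi> i x - \<psi> x) \<le> K" for i
    proof -
      have "2 * total_energy (\<phi> i) + 2 * total_energy \<psi> \<le> K"
        unfolding K_def by (intro add_mono mult_left_mono bd) auto
      with total_energy_diff_le [OF \<phi>_H \<psi>] show ?thesis by (rule order_trans)
    qed
    have "limitin mtopology (\<lambda>i. \<sigma> (r i)) (L \<psi>) sequentially"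
    proof (rule H_dominated_convergence)
      show "\<sigma> (r i) \<in> H" for i using \<phi>(2) L_H \<phi>_H by simp
      show "L \<psi> \<in> H" by (rule L_H [OF \<psi>])
      show "summable (\<lambda>k. s k * K)" by (rule summable_mult2 [OF s])
      have "s k \<ge> 0" for k using \<open>M \<ge> 0\<close> \<open>0 \<le> \<theta>\<close> by (simp add: s_def)
      then show "A k * circle_energy k (\<lambda>x. \<sigma> (r i) x - L \<psi> x) \<le> s k * K" for k i
        using dom [OF H_diff [OF \<phi>_H \<psi>], of k "r i"] K [of "r i"]
        by (simp add: \<phi>(2) flip: L_diff) (meson mult_left_mono order_trans)
      fix k
      let ?b = "\<lambda>i. M * \<theta> ^ k * circle_energy k (\<lambda>x. \<phi> (r i) x - \<psi> x) +
        C k * (\<Sum>j<k. circle_energy j (\<lambda>x. \<phi> (r i) x - \<psi> x))"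
      have "?b \<longlonglongrightarrow> M * \<theta> ^ k * 0 + C k * (\<Sum>j<k. 0)"
        by (intro tendsto_intros lim)
      then have b: "?b \<longlonglongrightarrow> 0" by simp
      have le: "circle_energy k (\<lambda>x. \<sigma> (r i) x - L \<psi> x) \<le> ?b i" for i
        using bound [OF H_smooth [OF H_diff [OF \<phi>_H \<psi>]], of k "r i"] by (simp add: \<phi>(2) L_diff)
      show "(\<lambda>i. circle_energy k (\<lambda>x. \<sigma> (r i) x - L \<psi> x)) \<longlonglongrightarrow> 0"
        by (rule tendsto_sandwich [OF always_eventually always_eventually tendsto_const b])
           (intro allI circle_energy_nonneg, intro allI le)
    qed
    then have "MCauchy (\<sigma> \<circ> r)"
      using convergent_imp_MCauchy [of "\<sigma> \<circ> r"] \<phi>(2) L_H \<phi>_H by (auto simp: o_def)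
    then show "\<exists>r. strict_mono r \<and> MCauchy (\<sigma> \<circ> r)" using r by blast
  qed
  then have "compactin (hilbert_topology H ip) (hilbert_topology H ip closure_of (L ` B))" if "mbounded B" for B
    using that mtotally_bounded_eq_compact_closure_of [OF H_mcomplete] by (simp add: hilbert_topology_def)
  then show ?thesis
    unfolding compact_operator_on_def using L_H add scale
    by (intro conjI ballI allI impI image_subsetI) auto
qed

end

section \<open>Weights adapted to an expanding map\<close>

text \<open>Take \<open>A k\<close> as a product of ratios \<open>q k\<close>. The factor \<open>(1 / 2) ^ k / (1 + C k)\<close> of \<open>q k\<close> gives the last property for
\<open>i = k - 1\<close>, hence for smaller \<open>i\<close> because \<open>A\<close> decreases. The factor \<open>1 / Suc k\<close> makes \<open>A\<close> decrease at least like
inverse factorials.\<close>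

lemma rapidly_decreasing_weights:
  fixes C :: "nat \<Rightarrow> real"
  assumes C: "\<And>k. C k \<ge> 0"
  obtains A :: "nat \<Rightarrow> real" where "\<And>k. A k > 0" "\<And>x. summable (\<lambda>k. A k * x ^ k)"
    "\<And>i k. i < k \<Longrightarrow> A k * C k \<le> (1 / 2) ^ k * A i"
proof
  define q where "q k = (1 / 2) ^ k / (real (Suc k) * (1 + C k))" for k
  define A where "A k = (\<Prod>i\<le>k. q i)" for k
  have C1: "1 + C k > 0" for k using C [of k] by linarith
  have q_pos: "q k > 0" for k using C1 [of k] by (simp add: q_def)
  have q_le: "q k \<le> 1 / real (Suc k)" for k
  proof -
    have "(1 / 2 :: real) ^ k \<le> 1 + C k" using C [of k] power_le_one [of "1 / 2 :: real" k] by simp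
    then have "(1 / 2) ^ k / (1 + C k) \<le> 1" using C1 [of k] by simp
    from mult_right_mono [OF this, of "1 / real (Suc k)"] show ?thesis
      by (simp add: q_def mult.commute)
  qed
  have q_C: "q k * C k \<le> (1 / 2) ^ k" for k
  proof -
    have "1 * (1 + C k) \<le> real (Suc k) * (1 + C k)"
      using C1 [of k] by (intro mult_right_mono) auto
    then have "C k \<le> real (Suc k) * (1 + C k)" by simp
    then have "C k / (real (Suc k) * (1 + C k)) \<le> 1" using C1 [of k] by simp
    from mult_left_mono [OF this, of "(1 / 2) ^ k"] show ?thesis by (simp add: q_def)
  qed
  have A_Suc: "A (Suc k) = A k * q (Suc k)" for k by (simp add: A_def)
  show A_pos: "A k > 0" for k by (simp add: A_def q_pos prod_pos)
  have "A k \<le> 1 / fact k" for k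
  proof (induction k)
    case 0
    show ?case using q_le [of 0] by (simp add: A_def)
  next
    case (Suc k)
    have "A k * q (Suc k) \<le> 1 / fact k * (1 / real (Suc (Suc k)))"
      using Suc q_le [of "Suc k"] q_pos [of "Suc k"] by (intro mult_mono) auto
    also have "\<dots> \<le> 1 / fact k * (1 / real (Suc k))"
      by (intro mult_left_mono) (auto simp: frac_le)
    finally show ?case by (simp add: A_Suc mult.commute)
  qed
  then have "norm (A k * x ^ k) \<le> inverse (fact k) * \<bar>x\<bar> ^ k" for k x
    using mult_right_mono [of "A k" "1 / fact k" "\<bar>x\<bar> ^ k"] A_pos [of k]
    by (simp add: abs_mult power_abs inverse_eq_divide)
  then show "summable (\<lambda>k. A k * x ^ k)" for x
    by (intro summable_comparison_test' [OF summable_exp [of "\<bar>x\<bar>"]]) blast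
  have q_le_1: "q k \<le> 1" for k
    using q_le [of k] by (rule order_trans) simp
  have "A (Suc k) \<le> A k" for k
    using A_pos [of k] q_le_1 [of "Suc k"] by (simp add: A_Suc mult_left_le)
  then have anti: "A k \<le> A i" if "i \<le> k" for i k
    using that by (rule lift_Suc_antimono_le)
  show "A k * C k \<le> (1 / 2) ^ k * A i" if less: "i < k" for i k
  proof -
    obtain j where j: "k = Suc j" "i \<le> j" using less by (cases k) auto
    have "A k * C k = A j * (q k * C k)" by (simp add: j A_Suc)
    also have "\<dots> \<le> A i * (1 / 2) ^ k"
      using anti [OF j(2)] A_pos [of i] q_C [of k] q_pos [of k] C [of k] by (intro mult_mono) (auto simp: less_imp_le)
    finally show ?thesis by (simp add: mult.commute)
  qed
qed

lemma transfer_operator_add: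
  "transfer_operator T (\<lambda>x. \<phi> x + \<psi> x) = (\<lambda>x. transfer_operator T \<phi> x + transfer_operator T \<psi> x)"
  by (simp add: transfer_operator_def distrib_left sum.distrib add_divide_distrib)

lemma transfer_operator_scale:
  "transfer_operator T (\<lambda>x. c * \<phi> x) = (\<lambda>x. c * transfer_operator T \<phi> x)"
  by (simp add: transfer_operator_def sum_distrib_left mult_ac)

theorem theorem1:
  fixes T :: "circle \<Rightarrow> circle"
  assumes "smooth_circle_map T" and "expanding T"
  shows "\<exists>(H :: (circle \<Rightarrow> complex) set) ip.
    hilbert_function_space H ip \<and>
    H \<subseteq> {\<phi>. smooth_circle_fun \<phi>} \<and>
    continuous_map (hilbert_topology H ip) smooth_topology (\<lambda>\<phi>. \<phi>) \<and>
    trig_polys \<subseteq> H \<and>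
    hilbert_topology H ip closure_of trig_polys = H \<and>
    compact_operator_on H ip (transfer_operator T)"
proof -
  obtain F where F: "smooth_on UNIV F" "\<And>t. T (to_circle t) = to_circle (F t)"
    using circle_map_lift [OF assms(1)] by blast
  obtain d :: int where d: "\<And>t. F (t + 1) = F t + of_int d"
    using lift_degree [of F T] smooth_continuous_on [OF F(1), of UNIV 0] F(2) by auto
  obtain c where c: "c > 1" "\<And>x. c \<le> \<bar>circle_deriv T x\<bar>"
    using assms(2) by (auto simp: expanding_def)
  interpret lift: expanding_lift F c d
    by unfold_locales (use F d c circle_deriv_lift [OF F] in \<open>metis+\<close>)
  obtain M where "M \<ge> 0" and "\<And>k. \<exists>C\<ge>0. \<forall>f. smooth_on UNIV f \<and> has_period 1 f \<longrightarrow>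
       l2sq (vderiv k (lift.lifted_transfer f)) \<le>
         M * (inverse c ^ 2) ^ k * l2sq (vderiv k f) + C * (\<Sum>i<k. l2sq (vderiv i f))"
    using lift.lifted_transfer_vderiv_bound by blast
  then obtain C where C: "\<And>k. C k \<ge> 0" "\<And>k f. smooth_on UNIV f \<Longrightarrow> has_period 1 f \<Longrightarrow>
       l2sq (vderiv k (lift.lifted_transfer f)) \<le>
         M * (inverse c ^ 2) ^ k * l2sq (vderiv k f) + C k * (\<Sum>i<k. l2sq (vderiv i f))"
    by metis
  \<comment> \<open>only now can the weights be chosen: they depend on the constants \<open>C\<close>, hence on \<open>T\<close>\<close>
  obtain A where A: "\<And>k. A k > 0" "\<And>x. summable (\<lambda>k. A k * x ^ k)"
      "\<And>i k. i < k \<Longrightarrow> A k * C k \<le> (1 / 2) ^ k * A i"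
    using rapidly_decreasing_weights [of C] C(1) by blast
  interpret derivative_weights A
    by unfold_locales (rule A)+
  note lifted = lift.transfer_operator_lift [OF F(2)]
  have "compact_operator_on H ip (transfer_operator T)"
  proof (rule compact_operator_criterion)
    show "smooth_circle_fun (transfer_operator T \<phi>)" if "smooth_circle_fun \<phi>" for \<phi>
      using that lift.smooth_lifted_transfer by (simp add: smooth_circle_fun_def lifted)
    show "circle_energy k (transfer_operator T \<phi>) \<le>
        M * (inverse c ^ 2) ^ k * circle_energy k \<phi> + C k * (\<Sum>i<k. circle_energy i \<phi>)"
      if "smooth_circle_fun \<phi>" for k \<phi>
      unfolding circle_energy_def circle_vderiv_def lifted
      using that C(2) [OF _ has_period_circle] by (simp add: smooth_circle_fun_def)
    show "inverse c ^ 2 < 1" using c(1) by (simp add: power_less_one_iff inverse_less_1_iff)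
  qed (use \<open>M \<ge> 0\<close> C(1) A(3) in \<open>simp_all add: transfer_operator_add transfer_operator_scale\<close>)
  then show ?thesis
    using H_hilbert H_smooth H_continuous_inclusion trig_polys_subset_H trig_polys_dense
    by (intro exI [of _ H] exI [of _ ip]) (auto simp: hilbert_topology_def)
qed

end
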